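(* Let $k,m\ge1$ and $r\ge2$ be integers, $q=2r-1>1$, $g=\gcd(m,k)$, $R=\mathbb Q[x,y]$, and let $I=E_2(L)\cap R=\langle A_q(x),G_k(x,y),H_m(x,y)\rangle$ for the oriented ordered two-component pretzel link $L=P(2k,2r-1,2m)$ (with $y=t_1$, $x=t_2$). With $\mathcal D$, $\mathcal S$, $\Pi_j$, $h$, $Q_j$ as defined in the context, assume $\mathcal D\neq\varnothing$ and define $$\mathcal B:=\{\Pi_0(x),\ y^g-h(x)\}\cup\{\Pi_j(x)Q_j(x,y):\ j\in\mathcal S\setminus\{0,g\}\}.$$ Then $\mathcal B$ is a Gröbner basis of $I$ with respect to the lexicographic order with $y>x$, and $$\operatorname{in}_{\mathrm{lex}}(I)=\langle x^{\deg\Pi_j}y^j:\ j\in\mathcal S\rangle.$$ Consequently, $\mathrm{AG}_2(L)$ is the reduced Gröbner basis obtained by monic normalization and interreduction of $\mathcal B$. The Gröbner basis $\mathcal B$ has at most four elements and may contain redundant elements before this interreduction.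
   Context: $A_q(x)=\frac{1+x^q}{1+x}$, $G_k(x,y)=\frac{1-(xy)^k}{1-xy}$, $H_m(x,y)=\frac{x^m-y^m}{x-y}$ (polynomials). $\Phi_n(x)$ is the $n$th cyclotomic polynomial. For $\delta\mid q$, $\delta>1$: $\mathcal K_\delta=\mathbb Q[x]/(\Phi_{2\delta}(x))$, $x_\delta$ is the class of $x$, $p_\delta(y)\in\mathcal K_\delta[y]$ is the monic gcd of $G_k(x_\delta,y)$ and $H_m(x_\delta,y)$, and $d_\delta=\deg_y p_\delta$ (one has $d_\delta\le g$). Put $\mathcal D=\{\delta>1:\delta\mid q,\ d_\delta>0\}$. For $0\le n\le g$ let $\Pi_n(x)=\prod_{\delta\in\mathcal D,\ d_\delta>n}\Phi_{2\delta}(x)$ (empty product $=1$), and $\mathcal S=\{0,g\}\cup\{d_\delta:\delta\in\mathcal D\}$. Choose $u,v\in\mathbb Z$ with $um+vk=g$ and put $e=um-vk$. Since $\Pi_0(0)=1$, $x$ is invertible modulo $\Pi_0$; let $h(x)\in\mathbb Q[x]$ be the unique polynomial with $\deg h<\deg\Pi_0$ and $h\equiv x^e\pmod{\Pi_0}$ (negative powers interpreted in $\mathbb Q[x]/(\Pi_0)$; the result does not depend on the choice of $u,v$). For $j\in\mathcal S\setminus\{0,g\}$ let $Q_j(x,y)\in\mathbb Q[x,y]$ be the unique polynomial, monic in $y$ of $y$-degree $j$, each of whose coefficients (as polynomial in $y$) has $x$-degree less than $\deg(\Pi_0/\Pi_j)$, such that $Q_j(x_\delta,y)=y^{\,j-d_\delta}p_\delta(y)$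 for all $\delta\in\mathcal D$ with $d_\delta\le j$. $\operatorname{in}_{\mathrm{lex}}(I)$ is the initial (leading monomial) ideal. $\mathrm{AG}_2(L)$ is the reduced Gröbner basis, for the lexicographic order $y>x$, of $E_2(L)\cap R$, where $E_2(L)\subset\mathbb Q[x^{\pm1},y^{\pm1}]$ is the second elementary ideal of the link group with $\phi$ sending the positive meridian of the $i$th component to the $i$th standard basis vector of $\mathbb Z^2$: for a presentation with $n$ generators it is generated by the $(n-2)\times(n-2)$ minors of the Fox matrix evaluated under $\phi$. For $L=P(2k,2r-1,2m)$ the link group is $\langle a,b,c\mid r_1,r_2\rangle$, $r_1=(cb)^r b^{-1}(cb)^{-r}(ac^{-1})^m c(ca^{-1})^m$, $r_2=(ab)^{-k}b(ab)^k(cb)^{r-1}c^{-1}(cb)^{-(r-1)}$, with $a\mapsto y$, $b,c\mapsto x$; one has $I=E_2(L)\cap R=\langle A_q,G_k,H_m\rangle$. *)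

theory Defs
  imports
    Complex_Main
    "HOL-Library.Product_Plus"
    "HOL-Library.Poly_Mapping"
    "HOL-Computational_Algebra.Computational_Algebra"
    "HOL-Number_Theory.Cong"
    "Jordan_Normal_Form.Determinant"
    "Jordan_Normal_Form.DL_Submatrix"
begin

text \<open>The ring of rational polynomials in \<open>x, y\<close> is rendered as \<open>rat poly poly\<close>: the outer variable is \<open>y\<close> and the
  coefficients are polynomials in \<open>x\<close>.  Throughout, exponents are pairs with the exponent of
  \<open>y = t\<^sub>1\<close> first and that of \<open>x = t\<^sub>2\<close> second.\<close>

abbreviation X :: "rat poly poly" where "X \<equiv> [:[:0, 1:]:]"
abbreviation Y :: "rat poly poly" where "Y \<equiv> [:0, 1:]"

text \<open>A commutative ring viewed as a module over itself.\<close>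

definition ideal_gen :: "'a::comm_ring_1 set \<Rightarrow> 'a set" where
  "ideal_gen S = Modules.module.span (*) S"


section \<open>The defining polynomials\<close>

text \<open>For odd \<open>q\<close> and all \<open>k\<close>, \<open>m\<close> the three divisions below are exact.\<close>

definition A_pol :: "nat \<Rightarrow> rat poly" where
  "A_pol q = (1 + monom 1 q) div (1 + monom 1 1)"

definition G_pol :: "nat \<Rightarrow> rat poly poly" where
  "G_pol k = (1 - (X * Y) ^ k) div (1 - X * Y)"

definition H_pol :: "nat \<Rightarrow> rat poly poly" where
  "H_pol m = (X ^ m - Y ^ m) div (X - Y)"


section \<open>Fox calculus, elementary ideals and the pretzel links\<close>

text \<open>Laurent polynomials: the group ring of \<open>\<int>\<^sup>2\<close> over the rationals.\<close>

type_synonym laurent = "(int \<times> int) \<Rightarrow>\<^sub>0 rat"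

abbreviation lmon :: "int \<times> int \<Rightarrow> laurent" where
  "lmon e \<equiv> Poly_Mapping.single e 1"

definition to_laurent :: "rat poly poly \<Rightarrow> laurent" where
  "to_laurent f = (\<Sum>j\<le>degree f. \<Sum>i\<le>degree (coeff f j).
     Poly_Mapping.single (int j, int i) (coeff (coeff f j) i))"

text \<open>Words in a free group: \<open>(i, True)\<close> is the \<open>i\<close>th generator and \<open>(i, False)\<close> its inverse.\<close>

type_synonym word = "(nat \<times> bool) list"

definition word_inv :: "word \<Rightarrow> word" where
  "word_inv w = rev (map (\<lambda>(i, s). (i, \<not> s)) w)"

definition word_pow :: "word \<Rightarrow> nat \<Rightarrow> word" where
  "word_pow w n = concat (replicate n w)"

text \<open>The image under \<open>\<phi>\<close> of the Fox derivative of a word with respect to the \<open>j\<close>th generator;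
  \<open>\<phi>\<close> gives the exponent vectors of the images of the generators.  The clauses are
  \<open>\<partial>(uw) = \<partial>u + u \<partial>w\<close> for a letter \<open>u\<close>, with \<open>\<partial>\<^sub>j g\<^sub>i = \<delta>\<^sub>i\<^sub>j\<close> and
  \<open>\<partial>\<^sub>j (inverse of g\<^sub>i) = - (inverse of g\<^sub>i) \<delta>\<^sub>i\<^sub>j\<close>.\<close>

fun fox :: "(nat \<Rightarrow> int \<times> int) \<Rightarrow> nat \<Rightarrow> word \<Rightarrow> laurent" where
  "fox \<phi> j [] = 0"
| "fox \<phi> j ((i, True) # w) = (if i = j then 1 else 0) + lmon (\<phi> i) * fox \<phi> j w"
| "fox \<phi> j ((i, False) # w) = - (if i = j then lmon (- \<phi> i) else 0) + lmon (- \<phi> i) * fox \<phi> j w"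

definition fox_matrix :: "(nat \<Rightarrow> int \<times> int) \<Rightarrow> nat \<Rightarrow> word list \<Rightarrow> laurent mat" where
  "fox_matrix \<phi> n rels = mat (length rels) n (\<lambda>(i, j). fox \<phi> j (rels ! i))"

text \<open>The \<open>d\<close>th elementary ideal of a presentation with generators \<open>0, \<dots>, n - 1\<close> (for \<open>d \<le> n\<close>).\<close>

definition elementary_ideal ::
    "nat \<Rightarrow> (nat \<Rightarrow> int \<times> int) \<Rightarrow> nat \<Rightarrow> word list \<Rightarrow> laurent set" where
  "elementary_ideal d \<phi> n rels = ideal_gen
     {det (submatrix (fox_matrix \<phi> n rels) I J) | I J.
        I \<subseteq> {..<length rels} \<and> J \<subseteq> {..<n} \<and> card I = n - d \<and> card J = n - d}"

text \<open>The group of the oriented ordered link \<open>P(2k, 2r - 1, 2m)\<close>, with generators \<open>a, b, c\<close>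
  numbered \<open>0, 1, 2\<close>.  The generator \<open>a\<close> is a positive meridian of the first component, \<open>b\<close> and
  \<open>c\<close> are positive meridians of the second.\<close>

definition pretzel_relators :: "nat \<Rightarrow> nat \<Rightarrow> nat \<Rightarrow> word list" where
  "pretzel_relators k r m = (
     let a = [(0, True)]; b = [(1, True)]; c = [(2, True)] in
     [ word_pow (c @ b) r @ word_inv b @ word_inv (word_pow (c @ b) r)
         @ word_pow (a @ word_inv c) m @ c @ word_pow (c @ word_inv a) m,
       word_inv (word_pow (a @ b) k) @ b @ word_pow (a @ b) k
         @ word_pow (c @ b) (r - 1) @ word_inv c @ word_inv (word_pow (c @ b) (r - 1)) ])"

definition pretzel_phi :: "nat \<Rightarrow> int \<times> int" where
  "pretzel_phi i = (if i = 0 then (1, 0) else (0, 1))"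

definition E2 :: "nat \<Rightarrow> nat \<Rightarrow> nat \<Rightarrow> laurent set" where
  "E2 k r m = elementary_ideal 2 pretzel_phi 3 (pretzel_relators k r m)"

definition E2_poly :: "nat \<Rightarrow> nat \<Rightarrow> nat \<Rightarrow> rat poly poly set" where
  "E2_poly k r m = {f. to_laurent f \<in> E2 k r m}"


section \<open>Groebner bases for the lexicographic order with y > x\<close>

definition supp :: "rat poly poly \<Rightarrow> (nat \<times> nat) set" where
  "supp f = {(j, i). coeff (coeff f j) i \<noteq> 0}"

definition coeff2 :: "rat poly poly \<Rightarrow> nat \<times> nat \<Rightarrow> rat" where
  "coeff2 f e = coeff (coeff f (fst e)) (snd e)"

definition term2 :: "rat \<Rightarrow> nat \<times> nat \<Rightarrow> rat poly poly" where
  "term2 c e = monom (monom c (snd e)) (fst e)"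

abbreviation mon2 :: "nat \<times> nat \<Rightarrow> rat poly poly" where
  "mon2 e \<equiv> term2 1 e"

definition lex_le :: "nat \<times> nat \<Rightarrow> nat \<times> nat \<Rightarrow> bool" where
  "lex_le e e' \<longleftrightarrow> fst e < fst e' \<or> fst e = fst e' \<and> snd e \<le> snd e'"

definition lead_exp :: "rat poly poly \<Rightarrow> nat \<times> nat" where
  "lead_exp f = (THE e. e \<in> supp f \<and> (\<forall>e' \<in> supp f. lex_le e' e))"

definition lead_mon :: "rat poly poly \<Rightarrow> rat poly poly" where
  "lead_mon f = mon2 (lead_exp f)"

definition lead_cf :: "rat poly poly \<Rightarrow> rat" where
  "lead_cf f = coeff2 f (lead_exp f)"

definition in_lex :: "rat poly poly set \<Rightarrow> rat poly poly set" where
  "in_lex I = ideal_gen {lead_mon f | f. f \<in> I \<and> f \<noteq> 0}"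

definition is_GB :: "rat poly poly set \<Rightarrow> rat poly poly set \<Rightarrow> bool" where
  "is_GB G I \<longleftrightarrow> finite G \<and> G \<subseteq> I \<and> 0 \<notin> G \<and> ideal_gen (lead_mon ` G) = in_lex I"

definition is_reduced_GB :: "rat poly poly set \<Rightarrow> rat poly poly set \<Rightarrow> bool" where
  "is_reduced_GB G I \<longleftrightarrow> is_GB G I \<and> (\<forall>g \<in> G. lead_cf g = 1) \<and>
     (\<forall>g \<in> G. \<forall>e \<in> supp g. mon2 e \<notin> ideal_gen (lead_mon ` (G - {g})))"

definition AG2 :: "nat \<Rightarrow> nat \<Rightarrow> nat \<Rightarrow> rat poly poly set" where
  "AG2 k r m = (THE G. is_reduced_GB G (E2_poly k r m))"

definition monic :: "rat poly poly \<Rightarrow> rat poly poly" where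
  "monic f = term2 (inverse (lead_cf f)) 0 * f"

text \<open>One reduction step: a term of \<open>f\<close> divisible by the leading monomial of \<open>g\<close> is cancelled.\<close>

definition reduces_by :: "rat poly poly \<Rightarrow> rat poly poly \<Rightarrow> rat poly poly \<Rightarrow> bool" where
  "reduces_by g f f' \<longleftrightarrow> g \<noteq> 0 \<and>
     (\<exists>t. lead_exp g + t \<in> supp f \<and>
          f' = f - term2 (coeff2 f (lead_exp g + t) / lead_cf g) t * g)"

text \<open>Interreduction: an element is replaced by a one-step reduct (renormalized, or dropped if it
  is zero) modulo another element, as long as this is possible.\<close>

definition interreduction_step :: "rat poly poly set \<Rightarrow> rat poly poly set \<Rightarrow> bool" where
  "interreduction_step F F' \<longleftrightarrow>
     (\<exists>f \<in> F. \<exists>g \<in> F - {f}. \<exists>f'. reduces_by g f f' \<and>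
        F' = (F - {f}) \<union> (if f' = 0 then {} else {monic f'}))"

definition interreduces_to :: "rat poly poly set \<Rightarrow> rat poly poly set \<Rightarrow> bool" where
  "interreduces_to F G \<longleftrightarrow>
     interreduction_step\<^sup>*\<^sup>* F G \<and> (\<nexists>F'. interreduction_step G F')"


section \<open>The polynomials p, the sets D and S, and the basis B\<close>

definition cyclotomic :: "nat \<Rightarrow> rat poly" where
  "cyclotomic n = (THE p. map_poly of_rat p =
     (\<Prod>j \<in> {j. j < n \<and> coprime j n}. [:- cis (2 * pi * real j / real n), 1:]))"

text \<open>Elements of \<open>K[y]\<close>, where \<open>K\<close> is the quotient of the rational polynomials in \<open>x\<close> by a
  modulus \<open>P\<close>, are represented by elements of \<open>rat poly poly\<close>.  The following are equality and
  divisibility of the represented elements in \<open>K[y]\<close>.\<close>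

definition eq_mod :: "rat poly \<Rightarrow> rat poly poly \<Rightarrow> rat poly poly \<Rightarrow> bool" where
  "eq_mod P f g \<longleftrightarrow> [:P:] dvd f - g"

definition dvd_mod :: "rat poly \<Rightarrow> rat poly poly \<Rightarrow> rat poly poly \<Rightarrow> bool" where
  "dvd_mod P f g \<longleftrightarrow> (\<exists>h. eq_mod P g (f * h))"

text \<open>The monic gcd of \<open>G\<^sub>k(x\<^sub>\<delta>, y)\<close> and \<open>H\<^sub>m(x\<^sub>\<delta>, y)\<close> in \<open>K\<^sub>\<delta>[y]\<close>, given by its representative with
  coefficients reduced modulo the cyclotomic polynomial (so that its \<open>y\<close>-degree is that of the
  represented element).\<close>

definition p_pol :: "nat \<Rightarrow> nat \<Rightarrow> nat \<Rightarrow> rat poly poly" where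
  "p_pol k m \<delta> = (let P = cyclotomic (2 * \<delta>) in
     THE p. lead_coeff p = 1 \<and> (\<forall>i. degree (coeff p i) < degree P) \<and>
       dvd_mod P p (G_pol k) \<and> dvd_mod P p (H_pol m) \<and>
       (\<forall>f. dvd_mod P f (G_pol k) \<and> dvd_mod P f (H_pol m) \<longrightarrow> dvd_mod P f p))"

definition d_deg :: "nat \<Rightarrow> nat \<Rightarrow> nat \<Rightarrow> nat" where
  "d_deg k m \<delta> = degree (p_pol k m \<delta>)"

definition D_set :: "nat \<Rightarrow> nat \<Rightarrow> nat \<Rightarrow> nat set" where
  "D_set k m q = {\<delta>. \<delta> > 1 \<and> \<delta> dvd q \<and> d_deg k m \<delta> > 0}"

definition S_set :: "nat \<Rightarrow> nat \<Rightarrow> nat \<Rightarrow> nat set" where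
  "S_set k m q = {0, gcd m k} \<union> d_deg k m ` D_set k m q"

definition Pi_pol :: "nat \<Rightarrow> nat \<Rightarrow> nat \<Rightarrow> nat \<Rightarrow> rat poly" where
  "Pi_pol k m q n = (\<Prod>\<delta> \<in> {\<delta> \<in> D_set k m q. d_deg k m \<delta> > n}. cyclotomic (2 * \<delta>))"

text \<open>The congruence \<open>h = x\<^sup>e\<close> modulo \<open>\<Pi>\<^sub>0\<close>, for an integer \<open>e\<close> of either sign; at most one of the
  two exponents is nonzero, and \<open>x\<close> is a unit modulo \<open>\<Pi>\<^sub>0\<close>.\<close>

definition h_pol :: "nat \<Rightarrow> nat \<Rightarrow> nat \<Rightarrow> int \<Rightarrow> rat poly" where
  "h_pol k m q e = (THE h. degree h < degree (Pi_pol k m q 0) \<and>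
     [h * monom 1 (nat (- e)) = monom 1 (nat e)] (mod Pi_pol k m q 0))"

definition Q_pol :: "nat \<Rightarrow> nat \<Rightarrow> nat \<Rightarrow> nat \<Rightarrow> rat poly poly" where
  "Q_pol k m q j = (THE Q. degree Q = j \<and> lead_coeff Q = 1 \<and>
     (\<forall>i. degree (coeff Q i) < degree (Pi_pol k m q 0 div Pi_pol k m q j)) \<and>
     (\<forall>\<delta> \<in> D_set k m q. d_deg k m \<delta> \<le> j \<longrightarrow>
        eq_mod (cyclotomic (2 * \<delta>)) Q (Y ^ (j - d_deg k m \<delta>) * p_pol k m \<delta>)))"

definition B_set :: "nat \<Rightarrow> nat \<Rightarrow> nat \<Rightarrow> int \<Rightarrow> rat poly poly set" where
  "B_set k m q e =
     {[:Pi_pol k m q 0:], Y ^ gcd m k - [:h_pol k m q e:]} \<union>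
     {[:Pi_pol k m q j:] * Q_pol k m q j | j. j \<in> S_set k m q - {0, gcd m k}}"

end

theory Submission
  imports
    Defs
    "Jordan_Normal_Form.Char_Poly"
    "HOL-Computational_Algebra.Field_as_Ring"
begin

text \<open>
  The elementary ideal.  Fox calculus turns the presentation into a \<open>2 \<times> 3\<close> matrix whose entries are,
  up to monomials, \<open>\<plusminus>A\<close>, \<open>(1 - x) H\<close>, \<open>(x - 1) G\<close> and the combinations of these forced by the
  fundamental identity of Fox calculus (\<open>fox_entries\<close>).  Since \<open>A(1) = 1\<close>, the factor \<open>1 - x\<close> can be
  cancelled modulo \<open>A\<close>, so the entries generate the same Laurent ideal as \<open>A\<close>, \<open>G\<close> and \<open>H\<close>.  Modulo
  \<open>G = 1 + xy + \<dots>\<close> the monomial \<open>xy\<close> is a unit, hence passing to Laurent polynomials and back adds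
  nothing: the contracted ideal is \<open>I = \<langle>A, G, H\<rangle>\<close> (\<open>E2_poly_eq\<close>).

  Localization.  The polynomial \<open>A\<close> is the product of the pairwise coprime \<open>\<Phi> = \<Phi>\<^bsub>2\<delta>\<^esub>\<close> with
  \<open>\<delta> | q\<close>, \<open>\<delta> > 1\<close>, so by the Chinese remainder theorem \<open>f \<in> I\<close> can be tested in each ideal
  \<open>\<langle>\<Phi>, G, H\<rangle>\<close> separately.  Modulo \<open>\<Phi>\<close> the equations \<open>(x y)\<^sup>k = 1\<close> and \<open>y\<^sup>m = x\<^sup>m\<close> force
  \<open>y\<^sup>g = x\<^sup>e\<close>; they are incompatible unless \<open>\<delta> | lcm(k, m)\<close>, and then they are equivalent to this single
  equation.  Dividing by \<open>1 - x y\<close> and \<open>x - y\<close> removes the roots \<open>1/x\<close> and \<open>x\<close>, which solve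
  \<open>y\<^sup>g = x\<^sup>e\<close> exactly when \<open>\<delta> | m\<close> and \<open>\<delta> | k\<close>.  So \<open>\<langle>\<Phi>, G, H\<rangle> = \<langle>\<Phi>, p\<^sub>\<delta>\<rangle>\<close> with \<open>p\<^sub>\<delta>\<close> monic
  in \<open>y\<close> of degree \<open>g\<close>, \<open>g - 1\<close>, \<open>g - 2\<close> or \<open>0\<close> (\<open>p_pol_properties\<close>).  The coefficients that have
  to be inverted modulo \<open>\<Phi>\<close> are powers of \<open>x\<close>, positive integers, and factors of some \<open>x\<^sup>l - 1\<close> with
  \<open>2\<delta>\<close> not dividing \<open>l\<close>; all of these are coprime to \<open>\<Phi>\<close>.

  The staircase.  A multiple of the monic \<open>p\<^sub>\<delta>\<close> of smaller \<open>y\<close>-degree vanishes modulo \<open>\<Phi>\<close>.  Hence the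
  leading coefficient of an element of \<open>I\<close> of \<open>y\<close>-degree \<open>n\<close> is divisible by all \<open>\<Phi>\<^bsub>2\<delta>\<^esub>\<close> with
  \<open>d\<^sub>\<delta> > n\<close>, that is, by \<open>\<Pi>\<^sub>n\<close> (\<open>Pi_dvd_lead_coeff\<close>).  As \<open>\<Pi>\<^sub>n\<close> changes only at \<open>n \<in> S\<close>, all leading
  monomials are multiples of \<open>x\<^bsup>deg \<Pi>(j)\<^esup> y\<^sup>j\<close> with \<open>j \<in> S\<close>, and the elements of \<open>B\<close> lie in \<open>I\<close> and have
  exactly these leading monomials (\<open>B_is_GB\<close>).

  Interreduction.  Each step keeps a monic Groebner basis of the same ideal and decreases a multiset
  measure, a basis that admits no step is reduced, and a reduced Groebner basis is unique
  (\<open>interreduction_yields_unique_reduced_GB\<close>).  Redundancy occurs for \<open>k = m = q = 3\<close>: there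
  \<open>\<Pi>\<^sub>1 = 1\<close>, so the leading monomial \<open>y\<^sup>3\<close> is a multiple of the leading monomial \<open>y\<close>.
\<close>

text \<open>From here on \<open>monic\<close> is the normalization that makes the leading coefficient of a bivariate polynomial 1.\<close>

hide_const (open) Missing_Polynomial.monic


section \<open>Ideals and congruences modulo ideals\<close>

lemma module_over_itself: "Modules.module ((*) :: 'a::comm_ring_1 \<Rightarrow> 'a \<Rightarrow> 'a)"
  by unfold_locales (auto simp: algebra_simps)

lemma ideal_gen_base: "a \<in> S \<Longrightarrow> a \<in> ideal_gen S"
  unfolding ideal_gen_def by (rule module.span_base[OF module_over_itself])

lemma ideal_gen_zero: "0 \<in> ideal_gen S"
  unfolding ideal_gen_def by (rule module.span_zero[OF module_over_itself])

lemma ideal_gen_add: "a \<in> ideal_gen S \<Longrightarrow> b \<in> ideal_gen S \<Longrightarrow> a + b \<in> ideal_gen S"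
  unfolding ideal_gen_def by (rule module.span_add[OF module_over_itself])

lemma ideal_gen_mult: "a \<in> ideal_gen S \<Longrightarrow> r * a \<in> ideal_gen S"
  unfolding ideal_gen_def by (rule module.span_scale[OF module_over_itself])

lemma ideal_gen_mult_right: "a \<in> ideal_gen S \<Longrightarrow> a * r \<in> ideal_gen S"
  by (metis ideal_gen_mult mult.commute)

lemma ideal_gen_uminus: "a \<in> ideal_gen S \<Longrightarrow> - a \<in> ideal_gen S"
  using ideal_gen_mult[of a S "- 1"] by simp

lemma ideal_gen_diff: "a \<in> ideal_gen S \<Longrightarrow> b \<in> ideal_gen S \<Longrightarrow> a - b \<in> ideal_gen S"
  using ideal_gen_add[of a S "- b"] ideal_gen_uminus[of b S] by simp

lemma ideal_gen_dvd: "a \<in> S \<Longrightarrow> a dvd b \<Longrightarrow> b \<in> ideal_gen S"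
  by (auto elim!: dvdE intro: ideal_gen_mult_right ideal_gen_base)

lemma ideal_gen_induct [consumes 1, case_names zero step]:
  assumes "a \<in> ideal_gen S" "P 0" "\<And>r s b. s \<in> S \<Longrightarrow> P b \<Longrightarrow> P (r * s + b)"
  shows "P a"
  using module.span_induct_alt[OF module_over_itself assms(1)[unfolded ideal_gen_def], of P] assms(2,3)
  by blast

lemma ideal_gen_subset_iff: "ideal_gen S \<subseteq> ideal_gen T \<longleftrightarrow> S \<subseteq> ideal_gen T"
proof
  assume S: "S \<subseteq> ideal_gen T"
  show "ideal_gen S \<subseteq> ideal_gen T"
  proof
    fix a assume "a \<in> ideal_gen S"
    then show "a \<in> ideal_gen T"
      by (induction rule: ideal_gen_induct) (use S in \<open>auto intro!: ideal_gen_zero ideal_gen_add ideal_gen_mult\<close>)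
  qed
qed (auto intro: ideal_gen_base)

lemma ideal_gen_eqI: "S \<subseteq> ideal_gen T \<Longrightarrow> T \<subseteq> ideal_gen S \<Longrightarrow> ideal_gen S = ideal_gen T"
  by (simp add: equalityI ideal_gen_subset_iff)

lemma ideal_gen_mono: "S \<subseteq> T \<Longrightarrow> ideal_gen S \<subseteq> ideal_gen T"
  by (auto simp: ideal_gen_subset_iff intro: ideal_gen_base)

lemma ideal_gen_insert: "f \<in> ideal_gen (insert a S) \<longleftrightarrow> (\<exists>r. f - r * a \<in> ideal_gen S)"
  unfolding ideal_gen_def by (subst module.span_insert[OF module_over_itself]) auto

lemma ideal_gen_one: "1 \<in> ideal_gen S \<Longrightarrow> a \<in> ideal_gen S"
  using ideal_gen_mult[of 1 S a] by simp

definition ideal_cong :: "'a::comm_ring_1 set \<Rightarrow> 'a \<Rightarrow> 'a \<Rightarrow> bool" where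
  "ideal_cong S a b \<longleftrightarrow> a - b \<in> ideal_gen S"

lemma ideal_cong_refl [simp]: "ideal_cong S a a"
  by (simp add: ideal_cong_def ideal_gen_zero)

lemma ideal_cong_sym: "ideal_cong S a b \<Longrightarrow> ideal_cong S b a"
  unfolding ideal_cong_def using ideal_gen_uminus by fastforce

lemma ideal_cong_trans [trans]: "ideal_cong S a b \<Longrightarrow> ideal_cong S b c \<Longrightarrow> ideal_cong S a c"
  unfolding ideal_cong_def using ideal_gen_add[of "a - b" S "b - c"] by simp

lemma ideal_cong_mult: "ideal_cong S a b \<Longrightarrow> ideal_cong S c d \<Longrightarrow> ideal_cong S (a * c) (b * d)"
proof -
  assume "ideal_cong S a b" "ideal_cong S c d"
  then have "(a - b) * c + b * (c - d) \<in> ideal_gen S"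
    unfolding ideal_cong_def by (intro ideal_gen_add ideal_gen_mult ideal_gen_mult_right)
  then show ?thesis by (simp add: ideal_cong_def algebra_simps)
qed

lemma ideal_cong_power: "ideal_cong S a b \<Longrightarrow> ideal_cong S (a ^ n) (b ^ n)"
  by (induction n) (auto intro: ideal_cong_mult)

text \<open>Relations between generators are applied below by rewriting inside congruences modulo an ideal; this
  fact turns the outcome back into membership.\<close>

lemma ideal_cong_mem: "ideal_cong S a b \<Longrightarrow> a \<in> ideal_gen S \<longleftrightarrow> b \<in> ideal_gen S"
  unfolding ideal_cong_def using ideal_gen_diff[of a S "a - b"] ideal_gen_add[of "a - b" S b] by auto

section \<open>Leading monomials, reduced Groebner bases and interreduction\<close>

text \<open>Divisibility of the monomials with these exponents.\<close>

abbreviation exp_dvd :: "nat \<times> nat \<Rightarrow> nat \<times> nat \<Rightarrow> bool" where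
  "exp_dvd s t \<equiv> fst s \<le> fst t \<and> snd s \<le> snd t"

lemma supp_iff_coeff2: "e \<in> supp f \<longleftrightarrow> coeff2 f e \<noteq> 0"
  by (cases e) (simp add: supp_def coeff2_def)

lemma coeff2_linear [simp]:
  "coeff2 (f + g) e = coeff2 f e + coeff2 g e" "coeff2 (f - g) e = coeff2 f e - coeff2 g e"
  "coeff2 0 e = 0"
  by (simp_all add: coeff2_def)

lemma poly2_eq_0_iff: "f = 0 \<longleftrightarrow> supp f = {}"
proof
  assume "supp f = {}"
  then show "f = 0"
    by (intro poly_eqI) (auto simp: supp_def)
qed (simp add: supp_def)

lemma lex_le_refl [simp]: "lex_le e e"
  by (simp add: lex_le_def)

lemma lex_le_antisym: "lex_le d e \<Longrightarrow> lex_le e d \<Longrightarrow> d = e"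
  by (auto simp: lex_le_def prod_eq_iff)

lemma lex_le_add: "lex_le d e \<Longrightarrow> lex_le (d + t) (e + t)"
  by (auto simp: lex_le_def)

lemma exp_dvd_imp_lex_le: "exp_dvd d e \<Longrightarrow> lex_le d e"
  by (auto simp: lex_le_def)

lemma lead_expI:
  assumes "e \<in> supp f" "\<And>e'. e' \<in> supp f \<Longrightarrow> lex_le e' e"
  shows "lead_exp f = e"
  unfolding lead_exp_def using assms by (intro the_equality) (auto intro: lex_le_antisym)

text \<open>For \<open>y > x\<close> the leading term sits in the leading coefficient with respect to \<open>y\<close>.  This reduces all
  questions on leading monomials to degrees of polynomials in one variable.\<close>

lemma lead_exp_eq:
  assumes "f \<noteq> 0"
  shows "lead_exp f = (degree f, degree (lead_coeff f))"
proof (rule lead_expI)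
  show "(degree f, degree (lead_coeff f)) \<in> supp f"
    using assms by (simp add: supp_def)
  fix e assume e: "e \<in> supp f"
  then have "coeff f (fst e) \<noteq> 0" "coeff (coeff f (fst e)) (snd e) \<noteq> 0"
    by (auto simp: supp_def)
  then have "fst e \<le> degree f" "snd e \<le> degree (coeff f (fst e))"
    by (auto intro: le_degree)
  then show "lex_le e (degree f, degree (lead_coeff f))"
    by (auto simp: lex_le_def)
qed

lemma lead_exp_in_supp: "f \<noteq> 0 \<Longrightarrow> lead_exp f \<in> supp f"
  by (simp add: lead_exp_eq supp_def)

lemma supp_le_lead_exp:
  assumes "e \<in> supp f"
  shows "lex_le e (lead_exp f)"
proof -
  have "f \<noteq> 0" using assms by (auto simp: supp_def)
  have "coeff f (fst e) \<noteq> 0" "coeff (coeff f (fst e)) (snd e) \<noteq> 0"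
    using assms by (auto simp: supp_def)
  then have "fst e \<le> degree f" "snd e \<le> degree (coeff f (fst e))"
    by (auto intro: le_degree)
  then show ?thesis
    unfolding lead_exp_eq[OF \<open>f \<noteq> 0\<close>] by (auto simp: lex_le_def)
qed

lemma finite_supp: "finite (supp f)"
proof (rule finite_subset)
  show "supp f \<subseteq> (SIGMA j:{..degree f}. {..degree (coeff f j)})"
    by (auto simp: supp_def le_degree intro: le_degree)
qed auto

lemma term2_mult_term2: "term2 b s * term2 c t = term2 (b * c) (s + t)"
  by (simp add: term2_def mult_monom)

lemma coeff2_term2_mult:
  "coeff2 (term2 c t * f) e = (if exp_dvd t e then c * coeff2 f (e - t) else 0)"
  by (simp add: coeff2_def term2_def coeff_monom_mult)

lemma coeff2_term2_mult_add [simp]: "coeff2 (term2 c t * f) (e + t) = c * coeff2 f e"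
  by (simp add: coeff2_term2_mult)

lemma supp_term2_mult: "e \<in> supp (term2 c t * f) \<Longrightarrow> \<exists>d \<in> supp f. e = d + t"
  by (auto simp: supp_iff_coeff2 coeff2_term2_mult prod_eq_iff split: if_splits intro!: bexI[of _ "e - t"])

lemma supp_mon2 [simp]: "supp (mon2 e) = {e}"
  by (auto simp: supp_def term2_def split: if_splits)

text \<open>The polynomials all of whose terms are multiples of some generator form an ideal, so the ideal
  generated by monomials contains nothing else.\<close>

lemma monomial_ideal_supp:
  assumes "f \<in> ideal_gen (mon2 ` E)" "e \<in> supp f"
  shows "\<exists>t\<in>E. exp_dvd t e"
  using assms
proof (induction arbitrary: e rule: ideal_gen_induct)
  case (step r s b)
  then obtain t where t: "t \<in> E" "s = mon2 t" by blast
  from step.prems have "e \<in> supp (mon2 t * r) \<or> e \<in> supp b"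
    by (auto simp: supp_iff_coeff2 t mult.commute)
  then show ?case
  proof
    assume "e \<in> supp (mon2 t * r)"
    then obtain d where "e = d + t" using supp_term2_mult by blast
    then show ?thesis using t(1) by (intro bexI[of _ t]) auto
  qed (rule step.IH)
qed (simp add: supp_def)

lemma mon2_in_monomial_ideal: "mon2 e \<in> ideal_gen (mon2 ` E) \<longleftrightarrow> (\<exists>t\<in>E. exp_dvd t e)"
proof
  assume "\<exists>t\<in>E. exp_dvd t e"
  then obtain t where t: "t \<in> E" "exp_dvd t e" by blast
  then have "mon2 e = mon2 (e - t) * mon2 t"
    by (simp add: term2_mult_term2 prod_eq_iff del: fst_diff snd_diff) (simp add: prod_eq_iff term2_def)
  then show "mon2 e \<in> ideal_gen (mon2 ` E)"
    using t(1) by (auto intro: ideal_gen_mult ideal_gen_base)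
qed (auto dest: monomial_ideal_supp)

lemma lead_mon_image: "lead_mon ` G = mon2 ` lead_exp ` G"
  by (simp add: image_image lead_mon_def)

text \<open>Membership of monomials in monomial ideals is divisibility by a generator; hence the equality of
  ideals in the definition becomes a condition on exponents.\<close>

lemma is_GB_iff:
  "is_GB G I \<longleftrightarrow> finite G \<and> G \<subseteq> I \<and> 0 \<notin> G \<and>
     (\<forall>f\<in>I. f \<noteq> 0 \<longrightarrow> (\<exists>g\<in>G. exp_dvd (lead_exp g) (lead_exp f)))"
proof -
  have lm: "{lead_mon f | f. f \<in> I \<and> f \<noteq> 0} = lead_mon ` (I - {0})" by auto
  have "ideal_gen (lead_mon ` G) = in_lex I \<longleftrightarrow>
      (\<forall>f\<in>I. f \<noteq> 0 \<longrightarrow> (\<exists>g\<in>G. exp_dvd (lead_exp g) (lead_exp f)))" if G: "G \<subseteq> I" "0 \<notin> G"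
  proof -
    have "ideal_gen (lead_mon ` G) \<subseteq> in_lex I"
      unfolding in_lex_def lm using G by (intro ideal_gen_mono) auto
    then have "ideal_gen (lead_mon ` G) = in_lex I \<longleftrightarrow> lead_mon ` (I - {0}) \<subseteq> ideal_gen (lead_mon ` G)"
      unfolding in_lex_def lm by (simp add: set_eq_subset ideal_gen_subset_iff)
    also have "\<dots> \<longleftrightarrow> (\<forall>f\<in>I. f \<noteq> 0 \<longrightarrow> (\<exists>g\<in>G. exp_dvd (lead_exp g) (lead_exp f)))"
      unfolding lead_mon_image image_subset_iff mon2_in_monomial_ideal by auto
    finally show ?thesis .
  qed
  then show ?thesis unfolding is_GB_def by blast
qed

lemma is_reduced_GB_iff:
  "is_reduced_GB G I \<longleftrightarrow> is_GB G I \<and> (\<forall>g\<in>G. lead_cf g = 1) \<and>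
     (\<forall>g\<in>G. \<forall>e\<in>supp g. \<forall>g'\<in>G - {g}. \<not> exp_dvd (lead_exp g') e)"
  unfolding is_reduced_GB_def lead_mon_image mon2_in_monomial_ideal by blast

text \<open>Uniqueness of reduced Groebner bases.  The leading exponents of a reduced basis are the minimal ones of
  the initial ideal, so \<open>g\<close> has a partner \<open>g'\<close> in the other basis with the same leading exponent.  Both
  being monic, the leading term of \<open>g - g'\<close>, if there is one, is a lower term of \<open>g\<close> or of \<open>g'\<close> that lies in
  the initial ideal, which reducedness excludes.\<close>

lemma reduced_GB_subset:
  assumes G: "is_reduced_GB G (ideal_gen S)" and G': "is_reduced_GB G' (ideal_gen S)"
  shows "G \<subseteq> G'"
proof
  note GD = G[unfolded is_reduced_GB_iff is_GB_iff] and G'D = G'[unfolded is_reduced_GB_iff is_GB_iff]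
  fix g assume g: "g \<in> G"
  then have g0: "g \<in> ideal_gen S" "g \<noteq> 0" using GD by blast+
  obtain g' where g': "g' \<in> G'" "exp_dvd (lead_exp g') (lead_exp g)"
    using G'D g0 by blast
  then have g'0: "g' \<in> ideal_gen S" "g' \<noteq> 0" using G'D by blast+
  obtain g'' where g'': "g'' \<in> G" "exp_dvd (lead_exp g'') (lead_exp g')"
    using GD g'0 by blast
  have "exp_dvd (lead_exp g'') (lead_exp g)" using g'(2) g''(2) by auto
  then have "g'' = g" using GD g g''(1) lead_exp_in_supp[OF g0(2)] by blast
  then have eq: "lead_exp g' = lead_exp g" using g'(2) g''(2) by (auto simp: prod_eq_iff)
  have "g - g' = 0"
  proof (rule ccontr)
    assume nz: "g - g' \<noteq> 0"
    define e where "e = lead_exp (g - g')"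
    have e: "e \<in> supp (g - g')" unfolding e_def by (rule lead_exp_in_supp[OF nz])
    have "g - g' \<in> ideal_gen S" using g0 g'0 by (intro ideal_gen_diff)
    then obtain h h' where h: "h \<in> G" "exp_dvd (lead_exp h) e" and h': "h' \<in> G'" "exp_dvd (lead_exp h') e"
      unfolding e_def using GD G'D nz by blast
    have "lead_cf g = 1" "lead_cf g' = 1" using GD G'D g g'(1) by blast+
    then have "coeff2 (g - g') (lead_exp g) = 0"
      by (simp add: lead_cf_def eq)
    then have ne: "e \<noteq> lead_exp g" using e by (auto simp: supp_iff_coeff2)
    from e have "coeff2 g e \<noteq> 0 \<or> coeff2 g' e \<noteq> 0" by (auto simp: supp_iff_coeff2)
    then consider "e \<in> supp g" | "e \<in> supp g'" unfolding supp_iff_coeff2 by blast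
    then show False
    proof cases
      case 1
      then have "h = g" using GD g h by blast
      then show False
        using 1 h(2) ne supp_le_lead_exp[OF 1] exp_dvd_imp_lex_le lex_le_antisym by blast
    next
      case 2
      then have "h' = g'" using G'D g'(1) h' by blast
      then show False
        using 2 h'(2) ne eq supp_le_lead_exp[OF 2] exp_dvd_imp_lex_le lex_le_antisym by metis
    qed
  qed
  then show "g \<in> G'" using g'(1) by simp
qed

lemma lead_cf_nonzero: "f \<noteq> 0 \<Longrightarrow> lead_cf f \<noteq> 0"
  using lead_exp_in_supp by (simp add: lead_cf_def supp_iff_coeff2)

lemma coeff2_term2_0_mult [simp]: "coeff2 (term2 c 0 * f) e = c * coeff2 f e"
  using coeff2_term2_mult_add[of c 0 f e] by simp

lemma supp_monic: "f \<noteq> 0 \<Longrightarrow> supp (monic f) = supp f"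
  using lead_cf_nonzero[of f] by (auto simp: supp_iff_coeff2 monic_def)

lemma monic_properties:
  assumes "f \<noteq> 0"
  shows "monic f \<noteq> 0" "lead_exp (monic f) = lead_exp f" "lead_cf (monic f) = 1"
proof -
  show "monic f \<noteq> 0" using assms supp_monic poly2_eq_0_iff by blast
  show *: "lead_exp (monic f) = lead_exp f" by (simp add: lead_exp_def supp_monic[OF assms])
  show "lead_cf (monic f) = 1"
    unfolding lead_cf_def * using lead_cf_nonzero[OF assms] by (simp add: monic_def lead_cf_def)
qed

text \<open>What the arguments on interreduction need of one reduction step: the term at \<open>e\<close> disappears and
  nothing above \<open>e\<close> changes.\<close>

lemma reduces_byE:
  assumes "reduces_by g f f'"
  obtains e where "exp_dvd (lead_exp g) e" "e \<in> supp f" "e \<notin> supp f'" "f' \<in> ideal_gen {f, g}"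
    "\<And>d. \<not> lex_le d e \<Longrightarrow> coeff2 f' d = coeff2 f d"
proof -
  obtain t where g: "g \<noteq> 0" and t: "lead_exp g + t \<in> supp f"
    and f': "f' = f - term2 (coeff2 f (lead_exp g + t) / lead_cf g) t * g"
    using assms unfolding reduces_by_def by blast
  let ?e = "lead_exp g + t"
  have le: "lex_le d ?e" if "d \<in> supp (term2 c t * g)" for c d
    using supp_term2_mult[OF that] supp_le_lead_exp lex_le_add by blast
  show ?thesis
  proof (rule that[of ?e])
    show "exp_dvd (lead_exp g) ?e" by simp
    show "?e \<notin> supp f'"
      using lead_cf_nonzero[OF g] by (simp add: f' supp_iff_coeff2 lead_cf_def)
    show "f' \<in> ideal_gen {f, g}"
      unfolding f' by (intro ideal_gen_diff ideal_gen_mult ideal_gen_base) auto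
    show "coeff2 f' d = coeff2 f d" if "\<not> lex_le d ?e" for d
      using le[of d] that unfolding f' supp_iff_coeff2 by auto
  qed (rule t)
qed

text \<open>If the leading term of \<open>f\<close> is cancelled, \<open>f\<close> was redundant, its leading monomial being a multiple of
  another one; otherwise the replacement has the same leading monomial.  Either way the leading
  monomials still generate the initial ideal.\<close>

lemma interreduction_step_is_GB:
  assumes step: "interreduction_step F F'" and GB: "is_GB F (ideal_gen S)"
    and monic: "\<forall>f\<in>F. lead_cf f = 1"
  shows "is_GB F' (ideal_gen S) \<and> (\<forall>f\<in>F'. lead_cf f = 1)"
proof -
  obtain f g f' where fg: "f \<in> F" "g \<in> F - {f}" and red: "reduces_by g f f'"
    and F': "F' = (F - {f}) \<union> (if f' = 0 then {} else {monic f'})"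
    using step unfolding interreduction_step_def by blast
  obtain e where e: "exp_dvd (lead_exp g) e" "e \<in> supp f" "e \<notin> supp f'" "f' \<in> ideal_gen {f, g}"
    and same: "\<And>d. \<not> lex_le d e \<Longrightarrow> coeff2 f' d = coeff2 f d"
    by (rule reduces_byE[OF red]) (rule that)
  note GBD = GB[unfolded is_GB_iff]
  have "ideal_gen {f, g} \<subseteq> ideal_gen S"
    using GBD fg by (auto simp: ideal_gen_subset_iff)
  then have f'I: "f' \<in> ideal_gen S" using e(4) by blast
  have f0: "f \<noteq> 0" using GBD fg by blast
  have lead: "\<exists>h\<in>F'. exp_dvd (lead_exp h) (lead_exp f)"
  proof (cases "e = lead_exp f")
    case True
    then show ?thesis using e(1) fg F' by blast
  next
    case False
    have nle: "\<not> lex_le (lead_exp f) e"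
      using False supp_le_lead_exp[OF e(2)] lex_le_antisym by blast
    then have in_supp: "lead_exp f \<in> supp f'"
      using same lead_exp_in_supp[OF f0] by (simp add: supp_iff_coeff2)
    then have f'0: "f' \<noteq> 0" by (auto simp: supp_def)
    have "lead_exp f' = lead_exp f"
    proof (rule lead_expI[OF in_supp])
      fix d assume d: "d \<in> supp f'"
      show "lex_le d (lead_exp f)"
      proof (cases "lex_le d e")
        case True
        then show ?thesis using supp_le_lead_exp[OF e(2)] by (auto simp: lex_le_def)
      next
        case False
        then have "d \<in> supp f" using d same by (simp add: supp_iff_coeff2)
        then show ?thesis by (rule supp_le_lead_exp)
      qed
    qed
    then have "lead_exp (monic f') = lead_exp f" using monic_properties(2)[OF f'0] by simp
    then show ?thesis using F' f'0 by (auto intro!: bexI[of _ "monic f'"])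
  qed
  have "\<exists>h\<in>F'. exp_dvd (lead_exp h) (lead_exp p)" if p: "p \<in> ideal_gen S" "p \<noteq> 0" for p
  proof -
    obtain h where h: "h \<in> F" "exp_dvd (lead_exp h) (lead_exp p)" using GBD p by blast
    show ?thesis
    proof (cases "h = f")
      case True
      then obtain h' where "h' \<in> F'" "exp_dvd (lead_exp h') (lead_exp h)" using lead by blast
      then show ?thesis using h(2) by (meson le_trans)
    next
      case False
      then show ?thesis using h F' by blast
    qed
  qed
  moreover have "monic f' \<in> ideal_gen S"
    unfolding monic_def by (rule ideal_gen_mult[OF f'I])
  ultimately show ?thesis
    unfolding is_GB_iff using GBD monic monic_properties[of f'] by (auto simp: F')
qed

lemma irreducible_GB_is_reduced:
  assumes GB: "is_GB G I" and monic: "\<forall>g\<in>G. lead_cf g = 1" and final: "\<nexists>G'. interreduction_step G G'"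
  shows "is_reduced_GB G I"
  unfolding is_reduced_GB_iff
proof (intro conjI GB monic ballI notI)
  fix f e g assume f: "f \<in> G" "e \<in> supp f" and g: "g \<in> G - {f}" "exp_dvd (lead_exp g) e"
  have "g \<noteq> 0" using GB g(1) by (auto simp: is_GB_iff)
  moreover have "lead_exp g + (e - lead_exp g) = e" using g(2) by (simp add: prod_eq_iff)
  ultimately have "reduces_by g f (f - term2 (coeff2 f e / lead_cf g) (e - lead_exp g) * g)"
    unfolding reduces_by_def using f(2) by (intro conjI exI[of _ "e - lead_exp g"]) auto
  then show False using final f(1) g(1) unfolding interreduction_step_def by blast
qed

definition lex_rel :: "((nat \<times> nat) \<times> (nat \<times> nat)) set" where
  "lex_rel = {(d, e). lex_le d e \<and> d \<noteq> e}"

lemma wf_lex_rel: "wf lex_rel"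
proof (rule wf_subset)
  show "lex_rel \<subseteq> less_than <*lex*> less_than"
    by (auto simp: lex_rel_def lex_le_def prod_eq_iff)
qed auto

text \<open>An element of the basis is measured by its set of exponents, and the basis by the multiset of these
  sets.  A reduction replaces an exponent by smaller ones, which is a descent in the multiset extension
  of the monomial order, and a step replaces one polynomial by at most one smaller polynomial, which is
  a descent in the second multiset extension.\<close>

definition interreduction_measure :: "rat poly poly set \<Rightarrow> (nat \<times> nat) multiset multiset" where
  "interreduction_measure F = image_mset (\<lambda>f. mset_set (supp f)) (mset_set F)"

lemma reduces_by_decreases:
  assumes "reduces_by g f f'"
  shows "(mset_set (supp f'), mset_set (supp f)) \<in> Multiset.mult lex_rel"
proof -
  obtain e where e: "exp_dvd (lead_exp g) e" "e \<in> supp f" "e \<notin> supp f'" "f' \<in> ideal_gen {f, g}"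
    and same: "\<And>d. \<not> lex_le d e \<Longrightarrow> coeff2 f' d = coeff2 f d"
    by (rule reduces_byE[OF assms]) (rule that)
  have split: "mset_set A = mset_set (A \<inter> B) + mset_set (A - B)" if "finite A" for A B :: "(nat \<times> nat) set"
    using that mset_set_Union[of "A \<inter> B" "A - B"] by (simp add: Int_Diff_Un Int_Diff_disjoint)
  have "(mset_set (supp f \<inter> supp f') + mset_set (supp f' - supp f),
      mset_set (supp f \<inter> supp f') + mset_set (supp f - supp f')) \<in> Multiset.mult lex_rel"
  proof (rule one_step_implies_mult)
    show "mset_set (supp f - supp f') \<noteq> {#}"
      using e(2,3) finite_supp[of f] by (auto simp: mset_set_empty_iff)
    show "\<forall>k\<in>#mset_set (supp f' - supp f). \<exists>j\<in>#mset_set (supp f - supp f'). (k, j) \<in> lex_rel"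
    proof
      fix k assume "k \<in># mset_set (supp f' - supp f)"
      then have k: "k \<in> supp f'" "k \<notin> supp f" using finite_supp by auto
      then have "lex_le k e" using same[of k] unfolding supp_iff_coeff2 by metis
      moreover have "k \<noteq> e" using k e by auto
      moreover have "e \<in># mset_set (supp f - supp f')" using e finite_supp by auto
      ultimately show "\<exists>j\<in>#mset_set (supp f - supp f'). (k, j) \<in> lex_rel"
        by (auto simp: lex_rel_def)
    qed
  qed
  then show ?thesis
    using split[OF finite_supp, of f "supp f'"] split[OF finite_supp, of f' "supp f"] by (simp add: Int_commute)
qed

lemma interreduction_step_decreases:
  assumes "finite F" "interreduction_step F F'"
  shows "(interreduction_measure F', interreduction_measure F) \<in> Multiset.mult (Multiset.mult lex_rel)"
proof -
  obtain f g f' where f: "f \<in> F" and red: "reduces_by g f f'"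
    and F': "F' = (F - {f}) \<union> (if f' = 0 then {} else {monic f'})"
    using assms(2) unfolding interreduction_step_def by blast
  let ?M = "interreduction_measure"
  have F: "?M F = ?M (F - {f}) + {#mset_set (supp f)#}"
    using assms(1) f by (simp add: interreduction_measure_def mset_set.remove)
  show ?thesis
  proof (cases "f' = 0 \<or> monic f' \<in> F - {f}")
    case True
    then have "F' = F - {f}" using F' by auto
    then show ?thesis
      unfolding F using one_step_implies_mult[of "{#mset_set (supp f)#}" "{#}"] by simp
  next
    case False
    then have "F' = insert (monic f') (F - {f})" using F' by auto
    then have "?M F' = ?M (F - {f}) + {#mset_set (supp f')#}"
      using False assms(1) supp_monic[of f'] by (simp add: interreduction_measure_def)
    then show ?thesis
      unfolding F using reduces_by_decreases[OF red] by (simp only:) (rule one_step_implies_mult, auto)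
  qed
qed

lemma interreduction_terminates:
  assumes "is_GB F (ideal_gen S)" "\<forall>f\<in>F. lead_cf f = 1"
  shows "\<exists>G. interreduces_to F G"
proof -
  have "wf (inv_image (Multiset.mult (Multiset.mult lex_rel)) interreduction_measure)"
    by (intro wf_inv_image wf_mult wf_lex_rel)
  then show ?thesis using assms
  proof (induction F rule: wf_induct_rule)
    case (less F)
    show ?case
    proof (cases "\<exists>F'. interreduction_step F F'")
      case False
      then show ?thesis unfolding interreduces_to_def by blast
    next
      case True
      then obtain F' where F': "interreduction_step F F'" by blast
      have "\<exists>G. interreduces_to F' G"
      proof (rule less.IH)
        show "(F', F) \<in> inv_image (Multiset.mult (Multiset.mult lex_rel)) interreduction_measure"
          using interreduction_step_decreases[OF _ F'] less.prems(1) by (simp add: is_GB_iff)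
      qed (use interreduction_step_is_GB[OF F' less.prems] in auto)
      then show ?thesis
        using F' unfolding interreduces_to_def by (meson converse_rtranclp_into_rtranclp)
    qed
  qed
qed

lemma interreduction_result:
  assumes "is_GB F (ideal_gen S)" "\<forall>f\<in>F. lead_cf f = 1" "interreduces_to F G"
  shows "is_reduced_GB G (ideal_gen S)"
proof -
  have steps: "interreduction_step\<^sup>*\<^sup>* F G" and final: "\<nexists>G'. interreduction_step G G'"
    using assms(3) by (auto simp: interreduces_to_def)
  from steps have "is_GB G (ideal_gen S) \<and> (\<forall>f\<in>G. lead_cf f = 1)"
  proof (induction rule: rtranclp_induct)
    case (step F' F'')
    then show ?case by (intro interreduction_step_is_GB) auto
  qed (use assms in auto)
  then show ?thesis using irreducible_GB_is_reduced final by blast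
qed

text \<open>Every terminating run of interreduction ends in a reduced Groebner basis, some run terminates, and there
  is only one reduced basis to end in.\<close>

theorem interreduction_yields_unique_reduced_GB:
  assumes "is_GB B (ideal_gen S)"
  defines "R \<equiv> THE G. is_reduced_GB G (ideal_gen S)"
  shows "is_reduced_GB R (ideal_gen S)" "interreduces_to (monic ` B) G \<longleftrightarrow> G = R"
proof -
  note BD = assms(1)[unfolded is_GB_iff]
  have "is_GB (monic ` B) (ideal_gen S)"
    unfolding is_GB_iff
  proof (intro conjI ballI impI)
    show "monic ` B \<subseteq> ideal_gen S"
      using BD by (auto simp: monic_def intro!: ideal_gen_mult)
    show "0 \<notin> monic ` B" using BD monic_properties(1) by (metis imageE)
    fix f assume "f \<in> ideal_gen S" "f \<noteq> 0"
    then obtain g where "g \<in> B" "exp_dvd (lead_exp g) (lead_exp f)" using BD by blast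
    then show "\<exists>g\<in>monic ` B. exp_dvd (lead_exp g) (lead_exp f)"
      using monic_properties(2)[of g] BD by (metis imageI)
  qed (use BD in simp)
  moreover have "\<forall>f\<in>monic ` B. lead_cf f = 1"
    by (metis BD imageE monic_properties(3))
  ultimately obtain G0 where G0: "interreduces_to (monic ` B) G0"
    and red: "\<And>G. interreduces_to (monic ` B) G \<Longrightarrow> is_reduced_GB G (ideal_gen S)"
    using interreduction_terminates interreduction_result by metis
  have "R = G" if "is_reduced_GB G (ideal_gen S)" for G
    unfolding R_def using that reduced_GB_subset by (intro the_equality) blast+
  then show "is_reduced_GB R (ideal_gen S)" "interreduces_to (monic ` B) G \<longleftrightarrow> G = R"
    using red G0 by metis+
qed

section \<open>Laurent polynomials and contraction of ideals\<close>

text \<open>The bound may exceed the degree because applying \<open>h\<close> can annihilate the leading coefficient.\<close>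

lemma poly_map_poly_bound:
  assumes "h 0 = (0 :: 'b::comm_ring_1)" "degree p \<le> n"
  shows "poly (map_poly h p) y = (\<Sum>i\<le>n. h (coeff p i) * y ^ i)"
proof -
  have "poly (map_poly h p) y = (\<Sum>i\<le>degree (map_poly h p). h (coeff p i) * y ^ i)"
    by (simp add: poly_altdef coeff_map_poly assms(1))
  also have "\<dots> = (\<Sum>i\<le>n. h (coeff p i) * y ^ i)"
  proof (rule sum.mono_neutral_left)
    show "{..degree (map_poly h p)} \<subseteq> {..n}"
      using degree_map_poly_le[of h p] assms(2) by auto
    show "\<forall>i\<in>{..n} - {..degree (map_poly h p)}. h (coeff p i) * y ^ i = 0"
      using coeff_eq_0[of "map_poly h p"] by (auto simp: coeff_map_poly assms(1) not_le)
  qed simp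
  finally show ?thesis .
qed

interpretation single_0: comm_ring_hom "Poly_Mapping.single (0 :: int \<times> int) :: rat \<Rightarrow> laurent"
  by unfold_locales (simp_all add: single_add mult_single)

definition laurent_of_x :: "rat poly \<Rightarrow> laurent" where
  "laurent_of_x a = poly (map_poly (Poly_Mapping.single 0) a) (lmon (0, 1))"

interpretation single_0_poly: map_poly_comm_ring_hom "Poly_Mapping.single (0 :: int \<times> int) :: rat \<Rightarrow> laurent" ..

interpretation laurent_of_x: comm_ring_hom laurent_of_x
  by unfold_locales
    (simp_all add: laurent_of_x_def single_0_poly.hom_add single_0_poly.hom_mult)

interpretation laurent_of_x_poly: map_poly_comm_ring_hom laurent_of_x ..

lemma lmon_mult: "lmon d * lmon e = lmon (d + e)"
  by (simp add: mult_single)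

lemma lmon_power: "lmon e ^ n = lmon (int n * fst e, int n * snd e)"
proof (induction n)
  case 0
  show ?case by (simp flip: zero_prod_def)
next
  case (Suc n)
  then show ?case by (cases e) (simp add: lmon_mult algebra_simps)
qed

text \<open>Presenting the embedding as an evaluation of polynomials makes it a ring homomorphism at once.\<close>

lemma to_laurent_eq: "to_laurent f = poly (map_poly laurent_of_x f) (lmon (1, 0))"
proof -
  have x: "laurent_of_x a = (\<Sum>i\<le>degree a. Poly_Mapping.single (0, int i) (coeff a i))" for a
    unfolding laurent_of_x_def
    by (subst poly_map_poly_bound[OF _ order_refl]) (simp_all add: lmon_power mult_single)
  show ?thesis
    unfolding to_laurent_def
    by (subst poly_map_poly_bound[OF _ order_refl])
      (simp_all add: lmon_power mult_single x sum_distrib_right)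
qed

interpretation to_laurent: comm_ring_hom to_laurent
  by unfold_locales
    (simp_all add: to_laurent_eq laurent_of_x_poly.hom_add laurent_of_x_poly.hom_mult)

lemma to_laurent_const: "to_laurent [:a:] = laurent_of_x a"
  using poly_map_poly_bound[of laurent_of_x "[:a:]" 0] by (simp add: to_laurent_eq)

lemma to_laurent_X: "to_laurent X = lmon (0, 1)"
  by (simp add: to_laurent_const laurent_of_x_def)

lemma to_laurent_Y: "to_laurent Y = lmon (1, 0)"
  by (simp add: to_laurent_eq)

lemma lookup_to_laurent: "Poly_Mapping.lookup (to_laurent f) (int j, int i) = coeff (coeff f j) i"
proof -
  have "Poly_Mapping.lookup (to_laurent f) (int j, int i)
      = (\<Sum>j'\<le>degree f. if j' = j then coeff (coeff f j) i else 0)"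
    unfolding to_laurent_def Poly_Mapping.lookup_sum
  proof (rule sum.cong[OF refl])
    fix j' assume "j' \<in> {..degree f}"
    have "(\<Sum>i'\<le>degree (coeff f j'). Poly_Mapping.lookup (Poly_Mapping.single (int j', int i') (coeff (coeff f j') i')) (int j, int i))
        = (\<Sum>i'\<le>degree (coeff f j'). if i' = i then (if j' = j then coeff (coeff f j) i else 0) else 0)"
      by (rule sum.cong) (auto simp: lookup_single when_def)
    also have "\<dots> = (if j' = j then coeff (coeff f j) i else 0)"
      by (auto simp: not_le coeff_eq_0)
    finally show "(\<Sum>i'\<le>degree (coeff f j'). Poly_Mapping.lookup (Poly_Mapping.single (int j', int i') (coeff (coeff f j') i')) (int j, int i))
        = (if j' = j then coeff (coeff f j) i else 0)" .
  qed
  also have "\<dots> = coeff (coeff f j) i"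
    by (auto simp: not_le coeff_eq_0)
  finally show ?thesis .
qed

lemma to_laurent_inject: "to_laurent f = to_laurent g \<Longrightarrow> f = g"
  by (metis lookup_to_laurent poly_eqI)

lemma lmon_XY: "lmon (int n, int n) = to_laurent ((X * Y) ^ n)"
  by (simp only: to_laurent.hom_mult to_laurent.hom_power to_laurent_X to_laurent_Y lmon_mult lmon_power)
    simp

text \<open>The monomial is taken with equal exponents so that it is a power of \<open>x y\<close>, the element that will be
  inverted in \<open>laurent_ideal_contraction\<close>.\<close>

lemma to_laurent_clear_denominators: "\<exists>n f. lmon (int n, int n) * p = to_laurent f"
proof (induction p rule: update_induct)
  case const
  show ?case by (rule exI[of _ 0], rule exI[of _ 0]) simp
next
  case (update p k c)
  obtain n f where f: "lmon (int n, int n) * p = to_laurent f"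
    using update.IH by blast
  obtain a b where k: "k = (a, b)" by force
  \<comment> \<open>Large enough to make both exponents of the new term nonnegative.\<close>
  define m where "m = nat \<bar>a\<bar> + nat \<bar>b\<bar>"
  have upd: "Poly_Mapping.update k c p = p + Poly_Mapping.single k c"
    using update.hyps(1)
    by (intro poly_mapping_eqI) (auto simp: lookup_update lookup_add lookup_single when_def in_keys_iff)
  have split: "lmon (int (n + m), int (n + m)) = lmon (int m, int m) * lmon (int n, int n)"
    by (simp add: lmon_mult add.commute)
  have "lmon (int (n + m), int (n + m)) * Poly_Mapping.single k c
      = to_laurent (monom (monom c (nat (int (n + m) + b))) (nat (int (n + m) + a)))"
  proof -
    have nn: "int (n + m) + a \<ge> 0" "int (n + m) + b \<ge> 0" by (auto simp: m_def)
    have "to_laurent (monom (monom c i) j) = Poly_Mapping.single (int j, int i) c" for i j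
    proof -
      have "monom (monom c i) j = [:[:c:]:] * X ^ i * Y ^ j"
        by (simp add: monom_altdef poly_const_pow)
      moreover have "to_laurent [:[:c:]:] = Poly_Mapping.single 0 c"
        unfolding to_laurent_const laurent_of_x_def
        by (subst poly_map_poly_bound[of _ _ 0]) simp_all
      ultimately show ?thesis
        by (simp only: to_laurent.hom_mult to_laurent.hom_power to_laurent_X to_laurent_Y lmon_power)
          (simp add: mult_single)
    qed
    then show ?thesis using nn by (simp add: mult_single k)
  qed
  moreover have "lmon (int (n + m), int (n + m)) * p = to_laurent ((X * Y) ^ m * f)"
    unfolding split mult.assoc f unfolding lmon_XY to_laurent.hom_mult ..
  ultimately show ?case
    unfolding upd distrib_left to_laurent.hom_add[symmetric] by (metis to_laurent.hom_add)
qed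

text \<open>Clearing denominators in a Laurent combination shows that \<open>(x y)\<^sup>n f\<close> lies in the polynomial ideal for
  some \<open>n\<close>; multiplying by the \<open>n\<close>th power of an inverse \<open>w\<close> of \<open>x y\<close> modulo the ideal removes the
  factor.\<close>

lemma laurent_ideal_contraction:
  assumes unit: "X * Y * w - 1 \<in> ideal_gen T" and f: "to_laurent f \<in> ideal_gen (to_laurent ` T)"
  shows "f \<in> ideal_gen T"
proof -
  have "\<exists>n. \<exists>g\<in>ideal_gen T. lmon (int n, int n) * p = to_laurent g"
    if "p \<in> ideal_gen (to_laurent ` T)" for p
    using that
  proof (induction rule: ideal_gen_induct)
    case zero
    show ?case by (rule exI[of _ 0], rule bexI[of _ 0]) (auto intro: ideal_gen_zero)
  next
    case (step r s b)
    obtain t where t: "t \<in> T" "s = to_laurent t" using step.hyps by blast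
    obtain n1 r' where r': "lmon (int n1, int n1) * r = to_laurent r'"
      using to_laurent_clear_denominators by blast
    obtain n2 g where g: "g \<in> ideal_gen T" "lmon (int n2, int n2) * b = to_laurent g"
      using step.IH by blast
    have "lmon (int (n1 + n2), int (n1 + n2)) * (r * s + b)
        = lmon (int n2, int n2) * (lmon (int n1, int n1) * r) * s
          + lmon (int n1, int n1) * (lmon (int n2, int n2) * b)"
    proof -
      have "lmon (int (n1 + n2), int (n1 + n2)) = lmon (int n1, int n1) * lmon (int n2, int n2)"
        by (simp add: lmon_mult)
      then show ?thesis by (simp only: algebra_simps)
    qed
    also have "\<dots> = to_laurent ((X * Y) ^ n2 * r' * t + (X * Y) ^ n1 * g)"
      unfolding r' g(2) t(2) unfolding lmon_XY to_laurent.hom_mult to_laurent.hom_add ..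
    finally show ?case
      using t(1) g(1) by (blast intro: ideal_gen_add ideal_gen_mult ideal_gen_base)
  qed
  from this[OF f] obtain n g where g: "g \<in> ideal_gen T" "to_laurent ((X * Y) ^ n * f) = to_laurent g"
    by (auto simp: lmon_XY to_laurent.hom_mult)
  then have "(X * Y) ^ n * f \<in> ideal_gen T"
    using to_laurent_inject by metis
  then have "w ^ n * ((X * Y) ^ n * f) \<in> ideal_gen T"
    by (rule ideal_gen_mult)
  moreover have "ideal_cong T ((X * Y * w) ^ n * f) (1 ^ n * f)"
    using unit by (intro ideal_cong_mult ideal_cong_power) (simp_all add: ideal_cong_def)
  moreover have "w ^ n * (z ^ n * f) = (z * w) ^ n * f" for z
    by (simp add: power_mult_distrib mult_ac)
  ultimately show ?thesis by (metis ideal_cong_mem mult_1 power_one)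
qed

section \<open>Fox calculus for the pretzel links\<close>

text \<open>The exponent of the image of a word under abelianization.\<close>

fun word_exponent :: "(nat \<Rightarrow> int \<times> int) \<Rightarrow> word \<Rightarrow> int \<times> int" where
  "word_exponent \<phi> [] = 0"
| "word_exponent \<phi> ((i, s) # w) = (if s then \<phi> i else - \<phi> i) + word_exponent \<phi> w"

abbreviation word_image :: "(nat \<Rightarrow> int \<times> int) \<Rightarrow> word \<Rightarrow> laurent" where
  "word_image \<phi> w \<equiv> lmon (word_exponent \<phi> w)"

lemma lmon_inverse [simp]: "lmon e * lmon (- e) = 1" "lmon (- e) * lmon e = 1"
  by (simp_all add: lmon_mult)

lemma word_exponent_append: "word_exponent \<phi> (v @ w) = word_exponent \<phi> v + word_exponent \<phi> w"
  by (induction \<phi> v rule: word_exponent.induct) (simp_all add: add.assoc)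

lemma word_image_append: "word_image \<phi> (v @ w) = word_image \<phi> v * word_image \<phi> w"
  by (simp add: word_exponent_append lmon_mult)

lemma word_inv_Cons: "word_inv ((i, s) # w) = word_inv w @ [(i, \<not> s)]"
  by (simp add: word_inv_def)

lemma word_inv_Nil [simp]: "word_inv [] = []"
  by (simp add: word_inv_def)

lemma word_inv_append: "word_inv (v @ w) = word_inv w @ word_inv v"
  by (simp add: word_inv_def)

lemma word_exponent_inv: "word_exponent \<phi> (word_inv w) = - word_exponent \<phi> w"
  by (induction w) (auto simp: word_inv_Cons word_exponent_append)

lemma word_pow_Suc: "word_pow w (Suc n) = w @ word_pow w n"
  by (simp add: word_pow_def)

lemma word_pow_0: "word_pow w 0 = []"
  by (simp add: word_pow_def)

lemma word_pow_commute: "word_pow w n @ w = w @ word_pow w n"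
  by (induction n) (simp_all add: word_pow_0 word_pow_Suc)

lemma word_inv_pow: "word_inv (word_pow w n) = word_pow (word_inv w) n"
  by (induction n) (simp_all add: word_pow_0 word_pow_Suc word_inv_append word_pow_commute)

lemma word_image_pow: "word_image \<phi> (word_pow w n) = word_image \<phi> w ^ n"
  by (induction n) (simp_all add: word_pow_0 word_pow_Suc word_image_append)

lemma fox_append: "fox \<phi> j (v @ w) = fox \<phi> j v + word_image \<phi> v * fox \<phi> j w"
  by (induction \<phi> j v rule: fox.induct) (simp_all add: algebra_simps lmon_mult)

lemma fox_inv: "fox \<phi> j (word_inv w) = - lmon (- word_exponent \<phi> w) * fox \<phi> j w"
proof (induction w)
  case (Cons l w)
  obtain i s where l: "l = (i, s)" by force
  have "p * lmon (\<phi> i) * lmon (- \<phi> i - word_exponent \<phi> w) = p * lmon (- word_exponent \<phi> w)" for p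
    by (simp add: lmon_mult mult.assoc)
  then show ?case
    using Cons by (cases s)
      (simp_all add: l word_inv_Cons fox_append word_exponent_inv algebra_simps lmon_mult
        flip: mult.assoc)
qed simp

lemma fox_pow: "fox \<phi> j (word_pow w n) = (\<Sum>i<n. word_image \<phi> w ^ i) * fox \<phi> j w"
proof (induction n)
  case (Suc n)
  have "(\<Sum>i<Suc n. word_image \<phi> w ^ i) = 1 + word_image \<phi> w * (\<Sum>i<n. word_image \<phi> w ^ i)"
    by (subst sum.lessThan_Suc_shift) (simp add: sum_distrib_left)
  then show ?case
    by (simp add: word_pow_Suc fox_append Suc algebra_simps)
qed (simp add: word_pow_0)

text \<open>Both relators are products of two conjugates, so this formula and the product rule compute all
  their Fox derivatives.\<close>

lemma fox_conjugate:
  "fox \<phi> j (w @ v @ word_inv w)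
     = (1 - word_image \<phi> v) * fox \<phi> j w + word_image \<phi> w * fox \<phi> j v"
proof -
  have "word_image \<phi> w * (word_image \<phi> v * lmon (- word_exponent \<phi> w)) = word_image \<phi> v"
    by (simp add: lmon_mult)
  then show ?thesis
    by (simp add: fox_append fox_inv algebra_simps)
qed

abbreviation (input) x :: laurent where "x \<equiv> lmon (0, 1)"
abbreviation (input) x' :: laurent where "x' \<equiv> lmon (0, - 1)"
abbreviation (input) y :: laurent where "y \<equiv> lmon (1, 0)"
abbreviation (input) y' :: laurent where "y' \<equiv> lmon (- 1, 0)"

lemma x_inverse: "x * x' = 1" and y_inverse: "y * y' = 1"
  by (simp_all add: lmon_mult flip: zero_prod_def)

text \<open>This form of the quotient, a power of \<open>x\<close> plus \<open>1 - x\<close> times a geometric sum, is the one in which \<open>A\<close>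
  appears as a Fox derivative; it also exhibits \<open>A(1) = 1\<close>.\<close>

lemma A_pol_eq:
  assumes "r \<ge> 1"
  shows "A_pol (2 * r - 1) = [:0, 1:] ^ (2 * r - 1) + (1 - [:0, 1:]) * (\<Sum>i<r. ([:0, 1:]\<^sup>2) ^ i)"
proof -
  let ?x = "[:0, 1:] :: rat poly"
  have "(1 + ?x) * (?x ^ (2 * r - 1) + (1 - ?x) * (\<Sum>i<r. (?x\<^sup>2) ^ i))
      = ?x ^ (2 * r - 1) + ?x ^ Suc (2 * r - 1) + (1 - ?x\<^sup>2) * (\<Sum>i<r. (?x\<^sup>2) ^ i)"
    by (simp only: algebra_simps power2_eq_square power_Suc)
  also have "(1 - ?x\<^sup>2) * (\<Sum>i<r. (?x\<^sup>2) ^ i) = 1 - ?x ^ (2 * r)"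
    by (simp only: one_diff_power_eq[symmetric] power_mult)
  also have "Suc (2 * r - 1) = 2 * r" using assms by simp
  finally have "(1 + ?x) * (?x ^ (2 * r - 1) + (1 - ?x) * (\<Sum>i<r. (?x\<^sup>2) ^ i)) = 1 + ?x ^ (2 * r - 1)"
    by simp
  moreover have "1 + ?x \<noteq> 0" by (simp add: one_pCons)
  ultimately have "(1 + ?x ^ (2 * r - 1)) div (1 + ?x) = ?x ^ (2 * r - 1) + (1 - ?x) * (\<Sum>i<r. (?x\<^sup>2) ^ i)"
    by (metis nonzero_mult_div_cancel_left)
  moreover have "monom 1 n = ?x ^ n" for n by (simp add: monom_altdef)
  ultimately show ?thesis unfolding A_pol_def by simp
qed

lemma G_pol_eq: "G_pol k = (\<Sum>i<k. (X * Y) ^ i)"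
proof -
  have "1 - X * Y \<noteq> 0" by (simp add: one_pCons)
  then show ?thesis
    unfolding G_pol_def one_diff_power_eq by (rule nonzero_mult_div_cancel_left)
qed

lemma diff_power_eq_product_sum:
  fixes a b :: "'a::comm_ring_1"
  shows "a ^ m - b ^ m = (a - b) * (\<Sum>i<m. a ^ (m - Suc i) * b ^ i)"
proof (cases m)
  case (Suc n)
  have "b ^ m - a ^ m = (b - a) * (\<Sum>i<m. a ^ (m - Suc i) * b ^ i)"
    unfolding Suc diff_power_eq_sum by (simp add: mult.commute)
  then show ?thesis by (simp add: algebra_simps)
qed simp

lemma H_pol_eq: "H_pol m = (\<Sum>i<m. X ^ (m - Suc i) * Y ^ i)"
proof -
  have "X - Y \<noteq> 0" by simp
  then show ?thesis
    unfolding H_pol_def diff_power_eq_product_sum[of X] by (rule nonzero_mult_div_cancel_left)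
qed


text \<open>The geometric sum on the right is the derivative of \<open>(a b)\<^sup>k\<close> with respect to \<open>a\<close>.\<close>

lemma to_laurent_G: "to_laurent (G_pol k) = (\<Sum>i<k. (y * x) ^ i)"
  unfolding G_pol_eq
  by (simp only: to_laurent.hom_mult to_laurent.hom_sum to_laurent.hom_power to_laurent_X to_laurent_Y mult.commute)

text \<open>The geometric sum on the right is the derivative of \<open>(a c^-1)^m\<close> with respect to \<open>a\<close>.\<close>

lemma to_laurent_H: "to_laurent (H_pol m) = x ^ (m - 1) * (\<Sum>i<m. (y * x') ^ i)"
proof -
  have "x ^ (m - Suc i) * y ^ i = x ^ (m - 1) * (y * x') ^ i" if "i < m" for i
  proof -
    have "m - 1 = (m - Suc i) + i" using that by simp
    then have "x ^ (m - 1) * (y * x') ^ i = x ^ (m - Suc i) * y ^ i * (x * x') ^ i"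
      by (simp add: power_add power_mult_distrib mult_ac)
    then show ?thesis by (simp add: x_inverse)
  qed
  then show ?thesis
    unfolding H_pol_eq to_laurent.hom_mult to_laurent.hom_sum to_laurent.hom_power to_laurent_X
      to_laurent_Y sum_distrib_left
    by (intro sum.cong refl) blast
qed

abbreviation (input) "even_geometric_sum n \<equiv> (\<Sum>i<n. (x\<^sup>2) ^ i)"

abbreviation (input) "gen_a \<equiv> [(0, True)] :: word"
abbreviation (input) "gen_b \<equiv> [(1, True)] :: word"
abbreviation (input) "gen_c \<equiv> [(2, True)] :: word"
abbreviation (input) "pretzel_fox \<equiv> fox pretzel_phi"
abbreviation (input) "pretzel_image \<equiv> word_image pretzel_phi"

text \<open>The last factor of the first relator is the inverse of \<open>(a c^-1)^m\<close>, as the word inverse of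
  \<open>a c^-1\<close> is \<open>c a^-1\<close>.\<close>

lemma pretzel_relators_as_conjugates:
  "pretzel_relators k r m ! 0 = (word_pow (gen_c @ gen_b) r @ word_inv gen_b @ word_inv (word_pow (gen_c @ gen_b) r))
     @ (word_pow (gen_a @ word_inv gen_c) m @ gen_c @ word_inv (word_pow (gen_a @ word_inv gen_c) m))"
  "pretzel_relators k r m ! 1 = (word_inv (word_pow (gen_a @ gen_b) k) @ gen_b @ word_inv (word_inv (word_pow (gen_a @ gen_b) k)))
     @ (word_pow (gen_c @ gen_b) (r - 1) @ word_inv gen_c @ word_inv (word_pow (gen_c @ gen_b) (r - 1)))"
proof -
  have inv_inv: "word_inv (word_inv w) = w" for w
    by (simp add: word_inv_def rev_map o_def case_prod_beta)
  show "pretzel_relators k r m ! 0 = (word_pow (gen_c @ gen_b) r @ word_inv gen_b @ word_inv (word_pow (gen_c @ gen_b) r))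
     @ (word_pow (gen_a @ word_inv gen_c) m @ gen_c @ word_inv (word_pow (gen_a @ word_inv gen_c) m))"
    unfolding word_inv_pow[of "gen_a @ word_inv gen_c"] word_inv_append inv_inv
    by (simp add: pretzel_relators_def Let_def)
  show "pretzel_relators k r m ! 1 = (word_inv (word_pow (gen_a @ gen_b) k) @ gen_b @ word_inv (word_inv (word_pow (gen_a @ gen_b) k)))
     @ (word_pow (gen_c @ gen_b) (r - 1) @ word_inv gen_c @ word_inv (word_pow (gen_c @ gen_b) (r - 1)))"
    unfolding inv_inv by (simp add: pretzel_relators_def Let_def)
qed

lemma letter_images:
  "pretzel_image gen_a = y" "pretzel_image gen_b = x" "pretzel_image gen_c = x" "pretzel_image (word_inv gen_b) = x'" "pretzel_image (word_inv gen_c) = x'"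
  "pretzel_image (gen_c @ gen_b) = x\<^sup>2" "pretzel_image (gen_a @ word_inv gen_c) = y * x'" "pretzel_image (gen_a @ gen_b) = y * x"
  by (simp_all add: pretzel_phi_def word_inv_def power2_eq_square lmon_mult flip: zero_prod_def)

lemma fox_letters:
  "pretzel_fox j gen_a = of_bool (j = 0)" "pretzel_fox j gen_b = of_bool (j = 1)" "pretzel_fox j gen_c = of_bool (j = 2)"
  "pretzel_fox j (word_inv gen_b) = - x' * of_bool (j = 1)" "pretzel_fox j (word_inv gen_c) = - x' * of_bool (j = 2)"
  "pretzel_fox j (gen_c @ gen_b) = of_bool (j = 2) + x * of_bool (j = 1)"
  "pretzel_fox j (gen_a @ word_inv gen_c) = of_bool (j = 0) - y * x' * of_bool (j = 2)"
  "pretzel_fox j (gen_a @ gen_b) = of_bool (j = 0) + y * of_bool (j = 1)"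
  by (auto simp: pretzel_phi_def word_inv_def)

lemma pretzel_image_conjugate: "pretzel_image (w @ v @ word_inv w) = pretzel_image v"
  by (simp add: word_exponent_append word_exponent_inv)

text \<open>With three generators the second elementary ideal is generated by the minors of size one.\<close>

lemma fox_matrix_minors:
  "{det (submatrix (fox_matrix pretzel_phi 3 (pretzel_relators k r m)) I J) | I J.
      I \<subseteq> {..<length (pretzel_relators k r m)} \<and> J \<subseteq> {..<3} \<and> card I = 3 - 2 \<and> card J = 3 - 2}
   = {pretzel_fox j (pretzel_relators k r m ! i) | i j. i < 2 \<and> j < 3}"
proof -
  let ?M = "fox_matrix pretzel_phi 3 (pretzel_relators k r m)"
  have len: "length (pretzel_relators k r m) = 2"
    by (simp add: pretzel_relators_def Let_def)
  have dim: "dim_row ?M = 2" "dim_col ?M = 3"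
    by (simp_all add: fox_matrix_def len)
  have minor: "det (submatrix ?M {i} {j}) = pretzel_fox j (pretzel_relators k r m ! i)" if "i < 2" "j < 3" for i j
  proof -
    have card: "card {i'. i' < dim_row ?M \<and> i' \<in> {i}} = 1" "card {j'. j' < dim_col ?M \<and> j' \<in> {j}} = 1"
    proof -
      have "{i'. i' < dim_row ?M \<and> i' \<in> {i}} = {i}" "{j'. j' < dim_col ?M \<and> j' \<in> {j}} = {j}"
        using that unfolding dim by auto
      then show "card {i'. i' < dim_row ?M \<and> i' \<in> {i}} = 1" "card {j'. j' < dim_col ?M \<and> j' \<in> {j}} = 1"
        by simp_all
    qed
    then have "submatrix ?M {i} {j} \<in> carrier_mat 1 1"
      by (intro carrier_matI) (simp_all add: dim_submatrix)
    moreover have "submatrix ?M {i} {j} $$ (0, 0) = ?M $$ (i, j)"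
      using card by (subst submatrix_index) (simp_all add: Least_equality)
    ultimately show ?thesis
      using that len by (simp add: det_single fox_matrix_def)
  qed
  show ?thesis
  proof (intro equalityI subsetI)
    fix p assume "p \<in> {det (submatrix ?M I J) | I J. I \<subseteq> {..<length (pretzel_relators k r m)} \<and>
      J \<subseteq> {..<3} \<and> card I = 3 - 2 \<and> card J = 3 - 2}"
    then obtain I J where IJ: "p = det (submatrix ?M I J)" "I \<subseteq> {..<2}" "J \<subseteq> {..<3}" "card I = 1" "card J = 1"
      unfolding len by auto
    then obtain i j where "I = {i}" "J = {j}" by (metis card_1_singletonE)
    then show "p \<in> {pretzel_fox j (pretzel_relators k r m ! i) | i j. i < 2 \<and> j < 3}"
      using IJ minor by auto
  next
    fix p assume "p \<in> {pretzel_fox j (pretzel_relators k r m ! i) | i j. i < 2 \<and> j < 3}"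
    then obtain i j where "p = det (submatrix ?M {i} {j})" "i < 2" "j < 3"
      using minor by auto
    then show "p \<in> {det (submatrix ?M I J) | I J. I \<subseteq> {..<length (pretzel_relators k r m)} \<and>
      J \<subseteq> {..<3} \<and> card I = 3 - 2 \<and> card J = 3 - 2}"
      unfolding len by (intro CollectI exI[of _ "{i}"] exI[of _ "{j}"]) auto
  qed
qed

context
  fixes k r m :: nat
  assumes r: "r \<ge> 1"
begin

abbreviation (input) "\<A> \<equiv> to_laurent [:A_pol (2 * r - 1):]"
abbreviation (input) "\<G> \<equiv> to_laurent (G_pol k)"
abbreviation (input) "meridian_geometric_sum \<equiv> (\<Sum>i<m. (y * x') ^ i)"

lemma to_laurent_A: "\<A> = x ^ (2 * r - 1) + (1 - x) * even_geometric_sum r"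
proof -
  have "[:A_pol (2 * r - 1):] = X ^ (2 * r - 1) + (1 - X) * (\<Sum>i<r. (X\<^sup>2) ^ i)"
  proof -
    interpret const_poly: comm_ring_hom "\<lambda>a :: rat poly. [:a:]"
      by unfold_locales (simp_all add: one_pCons)
    show ?thesis using r
      by (simp only: A_pol_eq[of r] const_poly.hom_add const_poly.hom_mult const_poly.hom_minus const_poly.hom_sum
          const_poly.hom_power const_poly.hom_one)
  qed
  then show ?thesis
    by (simp only: to_laurent.hom_add to_laurent.hom_mult to_laurent.hom_minus to_laurent.hom_sum
        to_laurent.hom_power to_laurent.hom_one to_laurent_X)
qed

text \<open>Three ways in which \<open>A\<close> shows up in the derivatives with respect to \<open>b\<close> and \<open>c\<close>.  They follow from
  \<open>x\<^bsup>2n\<^esup> = 1 - (1 - x\<^sup>2) (1 + x\<^sup>2 + \<dots> + x\<^bsup>2n-2\<^esup>)\<close>.\<close>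

lemma A_relation: "x * \<A> = 1 + (x - 1) * even_geometric_sum r" "\<A> = 1 + x * (x - 1) * even_geometric_sum (r - 1)"
  "\<A> = x ^ (2 * r - 2) - (x - 1) * even_geometric_sum (r - 1)"
proof -
  define S where "S n = even_geometric_sum n" for n
  have gp: "x ^ (2 * n) = 1 - (1 - x\<^sup>2) * S n" for n
    using one_diff_power_eq[of "x\<^sup>2" n] unfolding power_mult S_def by (simp only: algebra_simps)
  have A: "\<A> = x ^ (2 * r - 1) + (1 - x) * S r"
    unfolding S_def by (rule to_laurent_A)
  have "x * \<A> = x ^ Suc (2 * r - 1) + x * (1 - x) * S r"
    unfolding A by (simp add: algebra_simps)
  also have "Suc (2 * r - 1) = 2 * r" using r by simp
  finally show "x * \<A> = 1 + (x - 1) * even_geometric_sum r"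
    unfolding gp S_def[symmetric] by (simp add: algebra_simps power2_eq_square)
  obtain n where n: "r = Suc n" using r by (cases r) auto
  have "S r = S n + x ^ (2 * n)"
    by (simp only: S_def n sum.lessThan_Suc power_mult)
  moreover have "x ^ (2 * r - 1) = x * x ^ (2 * n)" by (simp add: n)
  ultimately have *: "\<A> = x ^ (2 * n) - (x - 1) * S n"
    unfolding A by (simp add: algebra_simps)
  then show "\<A> = x ^ (2 * r - 2) - (x - 1) * even_geometric_sum (r - 1)" by (simp add: n S_def)
  from * have "\<A> = 1 + x * (x - 1) * S n"
    unfolding gp by (simp add: algebra_simps power2_eq_square)
  then show "\<A> = 1 + x * (x - 1) * even_geometric_sum (r - 1)" by (simp add: n S_def)
qed

lemma fox_relator_0:
  "pretzel_fox j (pretzel_relators k r m ! 0)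
     = (1 - x') * even_geometric_sum r * (of_bool (j = 2) + x * of_bool (j = 1)) - x ^ (2 * r - 1) * of_bool (j = 1)
       + x' * ((1 - x) * meridian_geometric_sum * (of_bool (j = 0) - y * x' * of_bool (j = 2)) + (y * x') ^ m * of_bool (j = 2))"
proof -
  have "(x\<^sup>2) ^ r * x' = x ^ (2 * r - 1) * (x * x')"
  proof -
    have "(x\<^sup>2) ^ r = x * x ^ (2 * r - 1)"
      using r by (simp flip: power_mult power_Suc)
    then show ?thesis by (simp only: mult_ac)
  qed
  then show ?thesis
    unfolding pretzel_relators_as_conjugates fox_append[of _ _ "_ @ _ @ word_inv _"] pretzel_image_conjugate fox_conjugate fox_pow
      word_image_pow letter_images fox_letters x_inverse
    by (simp add: algebra_simps)
qed

lemma fox_relator_1: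
  "pretzel_fox j (pretzel_relators k r m ! 1)
     = (y' * x') ^ k * ((x - 1) * \<G> * (of_bool (j = 0) + y * of_bool (j = 1)) + of_bool (j = 1))
       + (x - 1) * even_geometric_sum (r - 1) * (of_bool (j = 2) + x * of_bool (j = 1)) - x ^ (2 * r - 2) * of_bool (j = 2)"
proof -
  let ?z = "word_pow (gen_a @ gen_b) k"
  have z: "lmon (- word_exponent pretzel_phi ?z) = (y' * x') ^ k"
  proof -
    have "pretzel_image ?z * (y' * x') ^ k = ((y * y') * (x * x')) ^ k"
      by (simp only: word_image_pow letter_images power_mult_distrib mult_ac)
    then have "pretzel_image ?z * (y' * x') ^ k = 1" by (simp only: x_inverse y_inverse) simp
    then have "lmon (- word_exponent pretzel_phi ?z) * (pretzel_image ?z * (y' * x') ^ k) = lmon (- word_exponent pretzel_phi ?z)"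
      by simp
    then show ?thesis by (simp only: lmon_inverse mult_1 flip: mult.assoc)
  qed
  then have z': "pretzel_image (word_inv ?z) = (y' * x') ^ k" by (simp only: word_exponent_inv)
  have 1: "x * ((1 - x') * p) = (x - 1) * p" for p
    using x_inverse by (simp only: algebra_simps flip: mult.assoc) (simp add: algebra_simps)
  have 2: "x * ((x\<^sup>2) ^ (r - 1) * (- x' * p)) = - (x ^ (2 * r - 2) * p)" for p
  proof -
    have "x * ((x\<^sup>2) ^ (r - 1) * (- x' * p)) = - ((x * x') * (x\<^sup>2) ^ (r - 1) * p)"
      by (simp only: mult_ac minus_mult_left[symmetric] minus_mult_right[symmetric])
    then show ?thesis by (simp only: x_inverse mult_1) (simp add: diff_mult_distrib2 flip: power_mult)
  qed
  show ?thesis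
    unfolding pretzel_relators_as_conjugates fox_append[of _ _ "_ @ _ @ word_inv _"] pretzel_image_conjugate fox_conjugate fox_pow
      fox_inv[of _ _ "word_pow _ _"] z z' word_image_pow letter_images fox_letters distrib_left[of x] mult.assoc 1 2
      to_laurent_G
    by (simp add: algebra_simps)
qed

text \<open>The entry of \<open>c\<close> in the first row and that of \<open>b\<close> in the second come from eliminating the powers of
  \<open>y x^-1\<close> and of \<open>y x\<close> in favour of the geometric sums.  Both rows agree with the fundamental identity
  \<open>\<partial>\<^sub>a (y - 1) + (\<partial>\<^sub>b + \<partial>\<^sub>c) (x - 1) = 0\<close>.\<close>

lemma fox_entries:
  "pretzel_fox 0 (pretzel_relators k r m ! 0) = x' * (1 - x) * meridian_geometric_sum"
  "pretzel_fox 1 (pretzel_relators k r m ! 0) = - \<A>"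
  "pretzel_fox 2 (pretzel_relators k r m ! 0) = \<A> + x' * (y - 1) * meridian_geometric_sum"
  "pretzel_fox 0 (pretzel_relators k r m ! 1) = (y' * x') ^ k * (x - 1) * \<G>"
  "pretzel_fox 1 (pretzel_relators k r m ! 1) = \<A> + (y' * x') ^ k * (1 - y) * \<G>"
  "pretzel_fox 2 (pretzel_relators k r m ! 1) = - \<A>"
proof -
  note A = A_relation to_laurent_A
  define S where "S n = even_geometric_sum n" for n
  define T where "T = meridian_geometric_sum"
  define U where "U = (y * x') ^ m"
  define Z where "Z = (y' * x') ^ k"
  define Z' where "Z' = (y * x) ^ k"
  define A where "A = \<A>"
  define G where "G = \<G>"
  have U: "U = 1 - (1 - y * x') * T"
    using one_diff_power_eq[of "y * x'" m] unfolding U_def[symmetric] T_def[symmetric]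
    by (simp add: algebra_simps)
  have Z': "Z' = 1 - (1 - y * x) * G"
    using one_diff_power_eq[of "y * x" k]
    unfolding Z'_def[symmetric] to_laurent_G[symmetric] G_def[symmetric]
    by (simp add: algebra_simps)
  have ZZ: "Z * Z' = 1"
  proof -
    have "Z * Z' = ((y * y') * (x * x')) ^ k" unfolding Z_def Z'_def by (simp only: power_mult_distrib mult_ac)
    then show ?thesis by (simp only: x_inverse y_inverse) simp
  qed
  note xx = x_inverse
  have A1: "x * A = 1 + (x - 1) * S r" and A2: "A = 1 + x * (x - 1) * S (r - 1)"
    and A3: "A = x ^ (2 * r - 2) - (x - 1) * S (r - 1)" and A4: "A = x ^ (2 * r - 1) + (1 - x) * S r"
    using A unfolding A_def S_def .
  note R = fox_relator_0[folded S_def T_def U_def] fox_relator_1[folded S_def G_def Z_def]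
  show "pretzel_fox 0 (pretzel_relators k r m ! 0) = x' * (1 - x) * meridian_geometric_sum"
    unfolding R by (simp add: T_def)
  show "pretzel_fox 2 (pretzel_relators k r m ! 1) = - \<A>"
    unfolding R A_def[symmetric] A3 by (simp add: algebra_simps)
  show "pretzel_fox 0 (pretzel_relators k r m ! 1) = (y' * x') ^ k * (x - 1) * \<G>"
    unfolding R by (simp add: Z_def G_def algebra_simps)
  have "pretzel_fox 1 (pretzel_relators k r m ! 0) = (x - x * x') * S r - x ^ (2 * r - 1)"
    unfolding R by (simp add: algebra_simps)
  also have "\<dots> = - A" unfolding A4 xx by (simp add: algebra_simps)
  finally show "pretzel_fox 1 (pretzel_relators k r m ! 0) = - \<A>" by (simp add: A_def)
  have "x' * (x * A) = A" using xx by (metis mult.assoc mult.commute mult_1)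
  then have A5: "A = x' + (x' * x - x') * S r" unfolding A1 by (simp add: algebra_simps)
  have "pretzel_fox 2 (pretzel_relators k r m ! 0) = (1 - x') * S r + x' * ((x * x' - x') * y * T + U)"
    unfolding R by (simp add: algebra_simps)
  also have "\<dots> = (1 - x') * S r + x' * (1 + y * T - T)"
    unfolding xx U by (simp add: algebra_simps)
  also have "\<dots> = A + x' * (y - 1) * T"
    unfolding A5 mult.commute[of x' x] xx by (simp add: algebra_simps)
  finally show "pretzel_fox 2 (pretzel_relators k r m ! 0) = \<A> + x' * (y - 1) * meridian_geometric_sum"
    by (simp only: A_def T_def)
  have "pretzel_fox 1 (pretzel_relators k r m ! 1) = Z * ((x - 1) * G * y + 1) + (x - 1) * S (r - 1) * x"
    unfolding R by (simp add: algebra_simps)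
  also have "Z * ((x - 1) * G * y + 1) = Z * Z' + Z * (1 - y) * G"
    unfolding Z' by (simp add: algebra_simps)
  also have "\<dots> + (x - 1) * S (r - 1) * x = A + Z * (1 - y) * G"
    unfolding ZZ A2 by (simp add: algebra_simps)
  finally show "pretzel_fox 1 (pretzel_relators k r m ! 1) = \<A> + (y' * x') ^ k * (1 - y) * \<G>"
    by (simp only: A_def Z_def G_def)
qed


text \<open>The entries are combinations of \<open>A\<close>, \<open>G\<close> and \<open>H\<close>.  Conversely the derivatives with respect to \<open>a\<close> are
  unit multiples of \<open>(1 - x) H\<close> and \<open>(1 - x) G\<close>, and \<open>1 - x\<close> can be cancelled modulo \<open>A\<close>.\<close>

lemma E2_eq: "E2 k r m = ideal_gen (to_laurent ` {[:A_pol (2 * r - 1):], G_pol k, H_pol m})"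
proof -
  let ?F = "{pretzel_fox j (pretzel_relators k r m ! i) | i j. i < 2 \<and> j < 3}"
  let ?T = "to_laurent ` {[:A_pol (2 * r - 1):], G_pol k, H_pol m}"
  let ?H = "to_laurent (H_pol m)"
  have H: "?H = x ^ (m - 1) * meridian_geometric_sum" by (rule to_laurent_H)
  have unit: "x' ^ n * x ^ n = 1" "(y' * x') ^ n * (y * x) ^ n = 1" for n
  proof -
    show "x' ^ n * x ^ n = 1" by (simp only: x_inverse mult.commute[of x'] power_one flip: power_mult_distrib)
    have "(y' * x') * (y * x) = (y * y') * (x * x')" by (simp only: mult_ac)
    then show "(y' * x') ^ n * (y * x) ^ n = 1"
      by (simp only: x_inverse y_inverse mult_1 power_one flip: power_mult_distrib)
  qed
  have T: "meridian_geometric_sum = x' ^ (m - 1) * ?H" unfolding H by (simp only: unit mult_1 flip: mult.assoc)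
  have gens: "\<A> \<in> ideal_gen ?T" "\<G> \<in> ideal_gen ?T" "meridian_geometric_sum \<in> ideal_gen ?T"
    unfolding T by (auto intro: ideal_gen_mult ideal_gen_base)
  have "?F \<subseteq> ideal_gen ?T"
  proof
    fix p assume "p \<in> ?F"
    then obtain i j where p: "p = pretzel_fox j (pretzel_relators k r m ! i)" "i < 2" "j < 3" by blast
    then have "(i = 0 \<or> i = 1) \<and> (j = 0 \<or> j = 1 \<or> j = 2)" by auto
    then show "p \<in> ideal_gen ?T"
      unfolding p(1) using gens
      by (elim conjE disjE) (simp_all only: fox_entries ideal_gen_add ideal_gen_mult ideal_gen_uminus)
  qed
  moreover have "?T \<subseteq> ideal_gen ?F"
  proof -
    have entry: "pretzel_fox j (pretzel_relators k r m ! i) \<in> ideal_gen ?F" if "i < 2" "j < 3" for i j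
      using that by (intro ideal_gen_base) blast
    have entries: "x' * (1 - x) * meridian_geometric_sum \<in> ideal_gen ?F" "(y' * x') ^ k * (x - 1) * \<G> \<in> ideal_gen ?F"
      using entry[of 0 0] entry[of 1 0] unfolding fox_entries by simp_all
    have A: "\<A> \<in> ideal_gen ?F"
      using ideal_gen_uminus[OF entry[of 0 1]] unfolding fox_entries by simp
    define w where "w = (\<Sum>i<2 * r - 1. x ^ i) - even_geometric_sum r"
    have one: "1 = \<A> + (1 - x) * w"
    proof -
      have "x ^ (2 * r - 1) = 1 - (1 - x) * (\<Sum>i<2 * r - 1. x ^ i)"
        unfolding one_diff_power_eq[symmetric] by simp
      then show ?thesis
        unfolding to_laurent_A w_def right_diff_distrib[of "1 - x"] by simp
    qed
    \<comment> \<open>Since \<open>A(1) = 1\<close>, the element \<open>1 - x\<close> is invertible modulo \<open>A\<close>.\<close>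
    have cancel: "p \<in> ideal_gen ?F" if "(1 - x) * p \<in> ideal_gen ?F" for p
    proof -
      have "p * \<A> + w * ((1 - x) * p) \<in> ideal_gen ?F"
        by (rule ideal_gen_add[OF ideal_gen_mult[OF A] ideal_gen_mult[OF that]])
      also have "p * \<A> + w * ((1 - x) * p) = p * (\<A> + (1 - x) * w)"
        by (simp only: distrib_left mult_ac)
      finally show ?thesis unfolding one[symmetric] by simp
    qed
    have "x * (x' * (1 - x) * meridian_geometric_sum) \<in> ideal_gen ?F"
      by (rule ideal_gen_mult[OF entries(1)])
    then have "(1 - x) * meridian_geometric_sum \<in> ideal_gen ?F"
      by (simp only: x_inverse mult_1 flip: mult.assoc)
    then have "meridian_geometric_sum \<in> ideal_gen ?F" by (rule cancel)
    then have H': "?H \<in> ideal_gen ?F" unfolding H by (rule ideal_gen_mult)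
    have "- ((y * x) ^ k) * ((y' * x') ^ k * (x - 1) * \<G>) \<in> ideal_gen ?F"
      by (rule ideal_gen_mult[OF entries(2)])
    also have "- q * (p * (x - 1) * g) = (p * q) * ((1 - x) * g)" for p q g
      by (simp add: algebra_simps)
    finally have "\<G> \<in> ideal_gen ?F" unfolding unit mult_1 by (rule cancel)
    then show ?thesis using A H' by simp
  qed
  ultimately show ?thesis
    unfolding E2_def elementary_ideal_def fox_matrix_minors by (rule ideal_gen_eqI)
qed

text \<open>The polynomial \<open>G = 1 + x y + \<dots> + (x y)\<^bsup>k-1\<^esup>\<close> provides the inverse of \<open>x y\<close> that the contraction needs.\<close>

lemma E2_poly_eq:
  assumes k: "k \<ge> 1"
  shows "E2_poly k r m = ideal_gen {[:A_pol (2 * r - 1):], G_pol k, H_pol m}"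
proof -
  let ?T = "{[:A_pol (2 * r - 1):], G_pol k, H_pol m}"
  define z where "z = X * Y"
  \<comment> \<open>The inverse of \<open>x y\<close> modulo \<open>G\<close>.\<close>
  define w where "w = - (\<Sum>i<k - 1. z ^ i)"
  have "G_pol k = 1 + z * (\<Sum>i<k - 1. z ^ i)"
  proof -
    obtain n where n: "k = Suc n" using k by (cases k) auto
    show ?thesis
      unfolding G_pol_eq z_def[symmetric] n
      by (simp add: sum.lessThan_Suc_shift sum_distrib_left del: sum.lessThan_Suc)
  qed
  then have "z * w - 1 = - G_pol k" by (simp add: w_def)
  then have "X * Y * w - 1 \<in> ideal_gen ?T"
    unfolding z_def[symmetric] by (simp add: ideal_gen_uminus ideal_gen_base)
  then have "f \<in> E2_poly k r m \<Longrightarrow> f \<in> ideal_gen ?T" for f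
    unfolding E2_poly_def E2_eq using laurent_ideal_contraction by blast
  moreover have "f \<in> ideal_gen ?T \<Longrightarrow> f \<in> E2_poly k r m" for f
  proof -
    assume "f \<in> ideal_gen ?T"
    then have "to_laurent f \<in> ideal_gen (to_laurent ` ?T)"
      by (induction rule: ideal_gen_induct)
        (auto simp: to_laurent.hom_add to_laurent.hom_mult ideal_gen_zero
          intro!: ideal_gen_add ideal_gen_mult intro: ideal_gen_base)
    then show ?thesis by (simp add: E2_poly_def E2_eq)
  qed
  ultimately show ?thesis by blast
qed

end

hide_const (open) x x' y y' gen_a gen_b gen_c pretzel_fox pretzel_image even_geometric_sum \<A> \<G> meridian_geometric_sum

section \<open>Cyclotomic polynomials\<close>

interpretation of_rat_poly: map_poly_inj_idom_hom "of_rat :: rat \<Rightarrow> complex" ..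

definition cyclotomic_complex :: "nat \<Rightarrow> complex poly" where
  "cyclotomic_complex n =
     (\<Prod>j \<in> {j. j < n \<and> coprime j n}. [:- cis (2 * pi * real j / real n), 1:])"

lemma prod_linear_factors:
  fixes a :: "'b \<Rightarrow> 'a::idom"
  assumes "finite A"
  shows "lead_coeff (\<Prod>j\<in>A. [:- a j, 1:]) = 1" "degree (\<Prod>j\<in>A. [:- a j, 1:]) = card A"
proof -
  show "lead_coeff (\<Prod>j\<in>A. [:- a j, 1:]) = 1"
    by (simp add: lead_coeff_prod)
  show "degree (\<Prod>j\<in>A. [:- a j, 1:]) = card A"
    by (subst degree_prod_eq_sum_degree) auto
qed

lemma unity_polynomial:
  assumes "n > 0"
  shows "monom 1 n - 1 \<noteq> (0 :: 'a::idom poly)" "lead_coeff (monom 1 n - 1 :: 'a::idom poly) = 1"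
    "degree (monom 1 n - 1 :: 'a::idom poly) = n"
proof -
  have deg: "degree (monom 1 n - 1 :: 'a poly) = n"
    using degree_add_eq_left[of "- 1 :: 'a poly" "monom 1 n"] assms by (simp add: degree_monom_eq)
  then show "degree (monom 1 n - 1 :: 'a poly) = n" .
  have "coeff (monom 1 n - 1 :: 'a poly) n = 1"
    using assms by (cases n) simp_all
  then show lc: "lead_coeff (monom 1 n - 1 :: 'a poly) = 1"
    unfolding deg .
  show "monom 1 n - 1 \<noteq> (0 :: 'a poly)"
    using \<open>coeff (monom 1 n - 1 :: 'a poly) n = 1\<close> by (metis coeff_0 zero_neq_one)
qed

lemma unity_polynomial_factors:
  assumes n: "n > 0"
  shows "(monom 1 n - 1 :: complex poly) = (\<Prod>j<n. [:- cis (2 * pi * real j / real n), 1:])"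
proof (rule poly_eqI_degree_lead_coeff[where n = n and A = "{z::complex. z ^ n = 1}"])
  note bij = bij_betw_roots_unity[OF n]
  show "n \<le> card {z::complex. z ^ n = 1}"
    using bij_betw_same_card[OF bij] by simp
  show "coeff (monom 1 n - 1 :: complex poly) n = coeff (\<Prod>j<n. [:- cis (2 * pi * real j / real n), 1:]) n"
    using prod_linear_factors[of "{..<n}" "\<lambda>j. cis (2 * pi * real j / real n)"]
      unity_polynomial[OF n, where 'a = complex] by simp
  show "poly (monom 1 n - 1) z = poly (\<Prod>j<n. [:- cis (2 * pi * real j / real n), 1:]) z"
    if "z \<in> {z. z ^ n = 1}" for z :: complex
  proof -
    from that bij obtain j where "j < n" "z = cis (2 * pi * real j / real n)"
      unfolding bij_betw_def by fast
    then show ?thesis using that by (auto simp: poly_monom poly_prod)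
  qed
  show "degree (\<Prod>j<n. [:- cis (2 * pi * real j / real n), 1:]) \<le> n"
    by (subst prod_linear_factors(2)) auto
qed (use unity_polynomial(3)[OF n, where 'a = complex] in simp)

text \<open>Sort the \<open>n\<close>th roots of unity by their order: \<open>j\<close> contributes to \<open>d = n / gcd(j, n)\<close>.\<close>

lemma prod_cyclotomic_complex:
  assumes n: "n > 0"
  shows "(\<Prod>d | d dvd n. cyclotomic_complex d) = monom 1 n - 1"
proof -
  let ?f = "\<lambda>j n. [:- cis (2 * pi * real j / real n), 1:]"
  have inner: "(\<Prod>j | j \<in> {..<n} \<and> n div gcd j n = d. ?f j n) = cyclotomic_complex d" if d: "d dvd n" for d
  proof -
    obtain c where c: "n = d * c" using d by blast
    have pos: "d > 0" "c > 0" using c n by auto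
    have "(\<Prod>j \<in> {j. j < d \<and> coprime j d}. ?f j d) = (\<Prod>j | j \<in> {..<n} \<and> n div gcd j n = d. ?f j n)"
    proof (rule prod.reindex_bij_witness[where j = "\<lambda>j. j * c" and i = "\<lambda>j. j div c"])
      fix j assume "j \<in> {j. j < d \<and> coprime j d}"
      then show "j * c \<in> {j. j \<in> {..<n} \<and> n div gcd j n = d}" "j * c div c = j" "?f (j * c) n = ?f j d"
        using pos c by (auto simp: gcd_mult_distrib_nat[symmetric] mult_ac)
    next
      fix j assume j: "j \<in> {j. j \<in> {..<n} \<and> n div gcd j n = d}"
      have "gcd j n * d = n" using j dvd_mult_div_cancel[of "gcd j n" n] by auto
      then have g: "gcd j n = c" using c pos by (simp add: mult.commute)
      then have "c dvd j" by (metis gcd_dvd1)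
      then obtain i where i: "j = i * c" by (metis dvd_def mult.commute)
      have "gcd i d * c = c" using g i c by (metis gcd_mult_distrib_nat mult.commute)
      then show "j div c * c = j" "j div c \<in> {j. j < d \<and> coprime j d}"
        using i j pos c by (auto simp: coprime_iff_gcd_eq_1)
    qed
    then show ?thesis by (simp add: cyclotomic_complex_def)
  qed
  have "(\<Prod>d | d dvd n. cyclotomic_complex d) = (\<Prod>d | d dvd n. \<Prod>j | j \<in> {..<n} \<and> n div gcd j n = d. ?f j n)"
    using inner by simp
  also have "\<dots> = (\<Prod>j<n. ?f j n)"
    by (rule prod.group) (use n in \<open>auto simp: div_dvd_iff_mult\<close>)
  finally show ?thesis using unity_polynomial_factors[OF n] by simp
qed

lemma of_rat_unity_polynomial: "map_poly of_rat (monom 1 n - 1) = (monom 1 n - 1 :: complex poly)"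
  by (simp add: of_rat_poly.hom_minus map_poly_monom)

text \<open>By induction, \<open>x\<^sup>n - 1\<close> divided by the product of the factors for the proper divisors of \<open>n\<close> is a
  quotient of rational polynomials, and division commutes with extension of the field.\<close>

lemma cyclotomic_complex_rational:
  assumes "n > 0"
  shows "\<exists>p. map_poly of_rat p = cyclotomic_complex n"
  using assms
proof (induction n rule: less_induct)
  case (less n)
  have "\<forall>d\<in>{d. d dvd n \<and> d \<noteq> n}. \<exists>p. map_poly of_rat p = cyclotomic_complex d"
  proof
    fix d assume "d \<in> {d. d dvd n \<and> d \<noteq> n}"
    then have "d < n" "d > 0"
      using less.prems by (auto dest: dvd_imp_le simp: le_neq_implies_less intro: dvd_pos_nat)
    then show "\<exists>p. map_poly of_rat p = cyclotomic_complex d" by (rule less.IH)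
  qed
  then obtain p where p: "\<And>d. d dvd n \<Longrightarrow> d \<noteq> n \<Longrightarrow> map_poly of_rat (p d) = cyclotomic_complex d"
    by (metis (mono_tags, lifting) mem_Collect_eq)
  define Q where "Q = (\<Prod>d | d dvd n \<and> d \<noteq> n. p d)"
  have Q: "map_poly of_rat Q = (\<Prod>d | d dvd n \<and> d \<noteq> n. cyclotomic_complex d)"
    unfolding Q_def of_rat_poly.hom_prod using p by simp
  have "{d. d dvd n} = insert n {d. d dvd n \<and> d \<noteq> n}" by auto
  then have "(\<Prod>d | d dvd n. cyclotomic_complex d) = cyclotomic_complex n * map_poly of_rat Q"
    using less.prems finite_divisors_nat[of n] unfolding Q by (simp add: finite_subset[of _ "{d. d dvd n}"])
  then have "cyclotomic_complex n * map_poly of_rat Q = monom 1 n - 1"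
    using prod_cyclotomic_complex[OF less.prems] by simp
  moreover have "map_poly of_rat Q \<noteq> (0 :: complex poly)"
    using calculation unity_polynomial(1)[OF less.prems, where 'a = complex] by auto
  ultimately have "cyclotomic_complex n = (monom 1 n - 1) div map_poly of_rat Q"
    by (metis nonzero_mult_div_cancel_right)
  also have "(monom 1 n - 1 :: complex poly) = map_poly of_rat (monom 1 n - 1 :: rat poly)"
    by (rule of_rat_unity_polynomial[symmetric])
  also have "\<dots> div map_poly of_rat Q = map_poly of_rat ((monom 1 n - 1) div Q)"
    by (rule of_rat_hom.map_poly_div[symmetric])
  finally show ?case by metis
qed

lemma of_rat_cyclotomic:
  assumes "n > 0"
  shows "map_poly of_rat (cyclotomic n) = cyclotomic_complex n"
proof -
  obtain p where p: "map_poly of_rat p = cyclotomic_complex n"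
    using cyclotomic_complex_rational[OF assms] by blast
  have "cyclotomic n = p"
    unfolding cyclotomic_def cyclotomic_complex_def[symmetric]
  proof (rule the_equality)
    fix p' assume "map_poly of_rat p' = cyclotomic_complex n"
    then show "p' = p" using p of_rat_poly.eq_iff by metis
  qed (rule p)
  then show ?thesis using p by simp
qed

lemma prod_cyclotomic:
  assumes "n > 0"
  shows "(\<Prod>d | d dvd n. cyclotomic d) = monom 1 n - 1"
proof -
  have "map_poly of_rat (\<Prod>d | d dvd n. cyclotomic d) = (\<Prod>d | d dvd n. map_poly of_rat (cyclotomic d) :: complex poly)"
    by (rule of_rat_poly.hom_prod)
  also have "\<dots> = (\<Prod>d | d dvd n. cyclotomic_complex d)"
    using assms by (intro prod.cong refl of_rat_cyclotomic) (metis dvd_pos_nat mem_Collect_eq)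
  also have "\<dots> = map_poly of_rat (monom 1 n - 1)"
    unfolding prod_cyclotomic_complex[OF assms]
    by (rule of_rat_unity_polynomial[symmetric])
  finally show ?thesis by (simp only: of_rat_poly.eq_iff)
qed

lemma cyclotomic_dvd_unity_polynomial: "n > 0 \<Longrightarrow> cyclotomic n dvd monom 1 n - 1"
  unfolding prod_cyclotomic[symmetric] by (rule dvd_prodI) auto

lemma lead_coeff_cyclotomic: "n > 0 \<Longrightarrow> lead_coeff (cyclotomic n) = 1"
proof -
  assume n: "n > 0"
  have "of_rat (lead_coeff (cyclotomic n)) = lead_coeff (cyclotomic_complex n)"
    unfolding of_rat_cyclotomic[OF n, symmetric] by (rule of_rat_hom.hom_lead_coeff[symmetric])
  also have "\<dots> = 1"
    unfolding cyclotomic_complex_def by (rule prod_linear_factors) auto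
  finally show ?thesis by simp
qed

lemma degree_cyclotomic_pos:
  assumes "n > 1"
  shows "degree (cyclotomic n) > 0"
proof -
  have "degree (cyclotomic n) = degree (cyclotomic_complex n)"
    using assms by (subst of_rat_cyclotomic[symmetric]) auto
  also have "\<dots> = card {j. j < n \<and> coprime j n}"
    unfolding cyclotomic_complex_def by (rule prod_linear_factors) auto
  also have "\<dots> > 0"
  proof -
    have "1 \<in> {j. j < n \<and> coprime j n}" using assms by simp
    then show ?thesis unfolding card_gt_0_iff by fastforce
  qed
  finally show ?thesis .
qed

lemma cyclotomic_root_order:
  fixes z :: complex
  assumes n: "n > 0" and z: "poly (map_poly of_rat (cyclotomic n)) z = 0" and l: "z ^ l = 1"
  shows "n dvd l"
proof -
  obtain j where j: "j < n" "coprime j n" "z = cis (2 * pi * real j / real n)"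
    using z unfolding of_rat_cyclotomic[OF n] cyclotomic_complex_def
    by (auto simp: poly_prod)
  have "z ^ l = cis (2 * pi * real ((j * l) mod n) / real n)"
  proof -
    have "real (j * l) = real n * real (j * l div n) + real (j * l mod n)"
      by (metis mult_div_mod_eq of_nat_add of_nat_mult)
    moreover have "real l * (2 * pi * real j / real n) = 2 * pi * real (j * l) / real n"
      by simp
    ultimately have "real l * (2 * pi * real j / real n)
        = 2 * pi * real (j * l div n) + 2 * pi * real ((j * l) mod n) / real n"
      using n by (simp only: distrib_left add_divide_distrib) simp
    then have "z ^ l = cis (2 * pi * real (j * l div n)) * cis (2 * pi * real ((j * l) mod n) / real n)"
      unfolding j(3) DeMoivre by (simp only: cis_mult)
    then show ?thesis by simp
  qed
  then have "cis (2 * pi * real ((j * l) mod n) / real n) = cis (2 * pi * real 0 / real n)"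
    using l by simp
  moreover have "(j * l) mod n \<in> {..<n}" "0 \<in> {..<n}" using n by auto
  moreover have "inj_on (\<lambda>k. cis (2 * pi * real k / real n)) {..<n}"
    using bij_betw_roots_unity[OF n] by (rule bij_betw_imp_inj_on)
  ultimately have "(j * l) mod n = 0" by (meson inj_on_def)
  then show ?thesis using j(2) by (metis coprime_commute coprime_dvd_mult_right_iff dvd_eq_mod_eq_0)
qed

text \<open>A nonconstant common divisor would have a complex root, a primitive \<open>n\<close>th root of unity whose \<open>l\<close>th
  power is 1.\<close>

lemma coprime_cyclotomic_unity_polynomial:
  assumes n: "n > 0" and "\<not> n dvd l"
  shows "coprime (cyclotomic n) (monom 1 l - 1)"
proof (rule coprimeI)
  fix c assume c: "c dvd cyclotomic n" "c dvd monom 1 l - 1"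
  have "c \<noteq> 0" using c(1) lead_coeff_cyclotomic[OF n] by auto
  moreover have "degree c = 0"
  proof (rule ccontr)
    assume "degree c \<noteq> 0"
    then have "degree (map_poly of_rat c :: complex poly) \<noteq> 0" by simp
    then obtain z :: complex where z: "poly (map_poly of_rat c) z = 0"
      using fundamental_theorem_of_algebra constant_degree by metis
    have "map_poly of_rat c dvd (map_poly of_rat (cyclotomic n) :: complex poly)"
      using c(1) by (rule of_rat_poly.hom_dvd)
    then have "poly (map_poly of_rat (cyclotomic n)) z = 0"
      using z by (auto elim!: dvdE)
    moreover have "map_poly of_rat c dvd (map_poly of_rat (monom 1 l - 1) :: complex poly)"
      using c(2) by (rule of_rat_poly.hom_dvd)
    then obtain k where "monom 1 l - 1 = map_poly of_rat c * (k :: complex poly)"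
      unfolding of_rat_unity_polynomial by (elim dvdE)
    then have "poly (monom 1 l - 1) z = 0"
      using z by simp
    then have "z ^ l = 1" by (simp add: poly_monom)
    ultimately show False using cyclotomic_root_order[OF n] assms(2) by blast
  qed
  ultimately show "is_unit c" by (simp add: is_unit_iff_degree)
qed

lemma coprime_cyclotomic:
  assumes "n > 0" "n' > 0" "n \<noteq> n'"
  shows "coprime (cyclotomic n) (cyclotomic n')"
proof -
  consider "\<not> n dvd n'" | "\<not> n' dvd n" using assms(3) dvd_antisym by blast
  then show ?thesis
  proof cases
    case 1
    show ?thesis
      by (rule coprime_divisors[OF dvd_refl cyclotomic_dvd_unity_polynomial[OF assms(2)]
          coprime_cyclotomic_unity_polynomial[OF assms(1) 1]])
  next
    case 2
    show ?thesis
      by (rule coprime_divisors[OF cyclotomic_dvd_unity_polynomial[OF assms(1)] dvd_refl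
          coprime_cyclotomic_unity_polynomial[OF assms(2) 2, unfolded coprime_commute[of "cyclotomic n'"]]])
  qed
qed

text \<open>For odd \<open>q\<close> the divisors of \<open>2 q\<close> are those of \<open>q\<close> and their doubles, so this is the factorization of
  \<open>x\<^bsup>2q\<^esup> - 1\<close> divided by that of \<open>x\<^sup>q - 1\<close>.\<close>

lemma prod_cyclotomic_even:
  assumes q: "odd q"
  shows "(\<Prod>d | d dvd q. cyclotomic (2 * d)) = 1 + monom 1 q"
proof -
  have pos: "q > 0" using q by (auto intro: Nat.gr0I)
  have split: "{d. d dvd 2 * q} = {d. d dvd q} \<union> (*) 2 ` {d. d dvd q}"
  proof (intro equalityI subsetI)
    fix d assume d: "d \<in> {d. d dvd 2 * q}"
    show "d \<in> {d. d dvd q} \<union> (*) 2 ` {d. d dvd q}"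
    proof (cases "even d")
      case True
      then obtain c where "d = 2 * c" by blast
      then show ?thesis using d by simp
    next
      case False
      then have "coprime d 2" by simp
      then show ?thesis using d coprime_dvd_mult_right_iff[of d 2 q] by simp
    qed
  qed auto
  have "(\<Prod>d | d dvd 2 * q. cyclotomic d)
      = (\<Prod>d | d dvd q. cyclotomic d) * (\<Prod>d \<in> (*) 2 ` {d. d dvd q}. cyclotomic d)"
    unfolding split using q pos by (intro prod.union_disjoint) auto
  also have "(\<Prod>d \<in> (*) 2 ` {d. d dvd q}. cyclotomic d) = (\<Prod>d | d dvd q. cyclotomic (2 * d))"
    by (subst prod.reindex) (auto simp: inj_on_def)
  finally have "(monom 1 (2 * q) - 1 :: rat poly) = (monom 1 q - 1) * (\<Prod>d | d dvd q. cyclotomic (2 * d))"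
    using prod_cyclotomic[of "2 * q"] prod_cyclotomic[of q] pos by simp
  moreover have "(monom 1 (2 * q) - 1 :: rat poly) = (monom 1 q - 1) * (1 + monom 1 q)"
    by (simp add: algebra_simps mult_monom flip: mult_2)
  ultimately have "(monom 1 q - 1) * (\<Prod>d | d dvd q. cyclotomic (2 * d)) = (monom 1 q - 1) * (1 + monom 1 q :: rat poly)"
    by metis
  then show ?thesis
    using unity_polynomial(1)[OF pos, where 'a = rat] by (metis mult_left_cancel)
qed

lemma cyclotomic_2: "cyclotomic 2 = 1 + monom 1 1"
proof -
  have "{d. d dvd (1::nat)} = {1}" by auto
  then show ?thesis using prod_cyclotomic_even[of 1] by simp
qed

text \<open>The factor for \<open>\<delta> = 1\<close> of the previous product is the denominator \<open>1 + x\<close> of \<open>A\<close>.\<close>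

lemma A_pol_eq_prod:
  assumes q: "odd q"
  shows "A_pol q = (\<Prod>\<delta> | \<delta> > 1 \<and> \<delta> dvd q. cyclotomic (2 * \<delta>))"
proof -
  have pos: "q > 0" using q by (auto intro: Nat.gr0I)
  have "{d. d dvd q} = insert 1 {d. d > 1 \<and> d dvd q}"
  proof (intro equalityI subsetI)
    fix d assume d: "d \<in> {d. d dvd q}"
    then have "d \<noteq> 0" using pos by (metis dvd_0_left_iff mem_Collect_eq not_gr_zero)
    then show "d \<in> insert 1 {d. d > 1 \<and> d dvd q}" using d by auto
  qed auto
  moreover have "finite {d. d > 1 \<and> d dvd q}" using pos by auto
  ultimately have "(\<Prod>d | d dvd q. cyclotomic (2 * d))
      = (1 + monom 1 1) * (\<Prod>\<delta> | \<delta> > 1 \<and> \<delta> dvd q. cyclotomic (2 * \<delta>))"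
    using cyclotomic_2 by simp
  moreover have "cyclotomic 2 \<noteq> 0" using lead_coeff_cyclotomic[of 2] by auto
  ultimately show ?thesis
    unfolding A_pol_def prod_cyclotomic_even[OF q, symmetric] cyclotomic_2 by simp
qed

section \<open>The gcd of the two y-polynomials modulo a cyclotomic polynomial\<close>

text \<open>The variable \<open>x\<close> inside the coefficient ring.\<close>

abbreviation (input) xp :: "rat poly" where "xp \<equiv> [:0, 1:]"

lemma ideal_gen_pair: "f \<in> ideal_gen {[:P:], p} \<longleftrightarrow> dvd_mod P p f"
proof -
  have "f \<in> ideal_gen {[:P:], p} \<longleftrightarrow> (\<exists>h. f - h * p \<in> ideal_gen {[:P:]})"
    unfolding insert_commute[of "[:P:]"] by (rule ideal_gen_insert)
  moreover have "g \<in> ideal_gen {[:P:]} \<longleftrightarrow> [:P:] dvd g" for g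
  proof
    assume "g \<in> ideal_gen {[:P:]}"
    then show "[:P:] dvd g"
      by (induction rule: ideal_gen_induct) (auto simp del: mult_pCons_right intro!: dvd_add)
  qed (auto intro: ideal_gen_dvd)
  ultimately show ?thesis
    unfolding dvd_mod_def eq_mod_def by (simp add: mult.commute)
qed

lemma coprime_bezout:
  fixes P c :: "rat poly"
  assumes "coprime P c"
  obtains s t where "s * P + t * c = 1"
  using bezout_coefficients_fst_snd[of P c] assms by (metis coprime_iff_gcd_eq_1)

text \<open>Modulo \<open>P\<close>, a polynomial coprime to \<open>P\<close> is a unit.\<close>

lemma ideal_cancel_const:
  fixes f :: "rat poly poly"
  assumes P: "[:P:] \<in> T" and c: "coprime P c" and f: "[:c:] * f \<in> ideal_gen T"
  shows "f \<in> ideal_gen T"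
proof -
  obtain s t where st: "s * P + t * c = 1" using coprime_bezout[OF c] .
  have "[:s:] * f * [:P:] + [:t:] * ([:c:] * f) \<in> ideal_gen T"
    using P f by (intro ideal_gen_add ideal_gen_mult[OF f] ideal_gen_mult[OF ideal_gen_base])
  also have "[:s:] * f * [:P:] + [:t:] * ([:c:] * f) = [:s * P + t * c:] * f"
    by (simp add: algebra_simps smult_add_left)
  finally show ?thesis by (simp add: st)
qed

lemma synthetic_div_expand:
  fixes f :: "rat poly poly"
  shows "f = (Y - [:r:]) * synthetic_div f r + [:poly f r:]"
  using synthetic_div_correct'[of r f] by simp

text \<open>Reduce \<open>K\<close> modulo \<open>y - r\<close>: the constant \<open>K(r)\<close> times \<open>f\<close> lies in the ideal.  Thus a linear factor can be
  cancelled whenever the ideal contains some \<open>K\<close> whose value at its root is a unit.\<close>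

lemma ideal_cancel_linear:
  fixes f :: "rat poly poly"
  assumes P: "[:P:] \<in> T" and f: "(Y - [:r:]) * f \<in> ideal_gen T" and K: "K \<in> ideal_gen T"
    and c: "coprime P (poly K r)"
  shows "f \<in> ideal_gen T"
proof (rule ideal_cancel_const[OF P c])
  have "[:poly K r:] * f = f * K - synthetic_div K r * ((Y - [:r:]) * f)"
    by (subst (2) synthetic_div_expand[of K r]) (simp only: algebra_simps)
  also have "\<dots> \<in> ideal_gen T"
    by (rule ideal_gen_diff[OF ideal_gen_mult[OF K] ideal_gen_mult[OF f]])
  finally show "[:poly K r:] * f \<in> ideal_gen T" .
qed

text \<open>A linear polynomial that is monic in \<open>y\<close> has content 1, so Gauss's lemma applies.\<close>

lemma const_dvd_linear_mult:
  fixes f :: "rat poly poly"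
  assumes "[:P:] dvd (Y - [:r:]) * f"
  shows "[:P:] dvd f"
proof -
  have "content (Y - [:r:]) dvd coeff (Y - [:r:]) 1" by (rule content_dvd_coeff)
  then have "is_unit (content (Y - [:r:]))" by simp
  moreover have "P dvd content (Y - [:r:]) * content f"
    using assms unfolding const_poly_dvd_iff_dvd_content content_mult .
  ultimately show ?thesis
    unfolding const_poly_dvd_iff_dvd_content using dvd_mult_unit_iff' by blast
qed

lemma ideal_pair_divide_linear:
  assumes "(Y - [:r:]) * f \<in> ideal_gen {[:P:], (Y - [:r:]) * p}"
  shows "f \<in> ideal_gen {[:P:], p}"
proof -
  obtain h where "[:P:] dvd (Y - [:r:]) * f - (Y - [:r:]) * p * h"
    using assms unfolding ideal_gen_pair dvd_mod_def eq_mod_def by blast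
  then have "[:P:] dvd (Y - [:r:]) * (f - p * h)"
    by (simp only: algebra_simps)
  then show ?thesis
    unfolding ideal_gen_pair dvd_mod_def eq_mod_def using const_dvd_linear_mult by blast
qed

lemma synthetic_div_monic:
  fixes f :: "rat poly poly"
  assumes "lead_coeff f = 1" "degree f > 0"
  shows "lead_coeff (synthetic_div f r) = 1" "degree (synthetic_div f r) = degree f - 1"
proof -
  show deg: "degree (synthetic_div f r) = degree f - 1" by (rule degree_synthetic_div)
  have "coeff f (degree f) = coeff ((Y - [:r:]) * synthetic_div f r + [:poly f r:]) (degree f)"
    using synthetic_div_expand[of f r] by simp
  also have "\<dots> = coeff (synthetic_div f r) (degree f - 1) - r * coeff (synthetic_div f r) (degree f)"
    using assms(2) by (cases "degree f") (simp_all add: algebra_simps)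
  also have "coeff (synthetic_div f r) (degree f) = 0"
    using deg assms(2) by (intro coeff_eq_0) simp
  finally show "lead_coeff (synthetic_div f r) = 1" using assms(1) deg by simp
qed

text \<open>Write \<open>f\<close> as \<open>p s\<close> modulo \<open>P\<close> with the coefficients of \<open>s\<close> reduced modulo \<open>P\<close>.  Since \<open>p\<close> is monic,
  the leading coefficient of \<open>p s\<close> is that of \<open>s\<close>, and \<open>f\<close> has no term in that degree.\<close>

lemma degree_less_multiple_vanishes:
  fixes p f :: "rat poly poly"
  assumes p: "lead_coeff p = 1" and f: "f \<in> ideal_gen {[:P:], p}" and deg: "degree f < degree p"
  shows "[:P:] dvd f"
proof -
  obtain s where s: "[:P:] dvd f - p * s"
    using f unfolding ideal_gen_pair dvd_mod_def eq_mod_def by blast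
  define s' where "s' = map_poly (\<lambda>c. c mod P) s"
  have cs': "coeff s' i = coeff s i mod P" for i by (simp add: s'_def coeff_map_poly)
  have ss': "[:P:] dvd s - s'" unfolding const_poly_dvd_iff by (simp add: cs' minus_mod_eq_mult_div)
  have "[:P:] dvd (f - p * s) + p * (s - s')" by (rule dvd_add[OF s dvd_mult[OF ss']])
  then have fs': "[:P:] dvd f - p * s'" by (simp add: algebra_simps)
  have "s' = 0"
  proof (rule ccontr)
    assume "s' \<noteq> 0"
    let ?n = "degree p + degree s'"
    have "coeff (f - p * s') ?n = - lead_coeff s'"
      using deg p coeff_eq_0[of f ?n] by (simp add: coeff_mult_degree_sum)
    moreover have "P dvd coeff (f - p * s') ?n" using fs' unfolding const_poly_dvd_iff by blast
    ultimately have "P dvd lead_coeff s'" by simp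
    then have "lead_coeff s' = 0" unfolding cs' by (simp add: dvd_mod_iff dvd_eq_mod_eq_0)
    then show False using \<open>s' \<noteq> 0\<close> by simp
  qed
  then show ?thesis using fs' by simp
qed

lemma reduce_coefficients:
  fixes p :: "rat poly poly"
  assumes p: "lead_coeff p = 1" and P: "degree P > 0"
  obtains p' where "lead_coeff p' = 1" "degree p' = degree p" "\<And>i. degree (coeff p' i) < degree P"
    "[:P:] dvd p - p'"
proof -
  define p' where "p' = map_poly (\<lambda>c. c mod P) p"
  have cp': "coeff p' i = coeff p i mod P" for i by (simp add: p'_def coeff_map_poly)
  have lead: "coeff p' (degree p) = 1" using p P by (simp add: cp' mod_poly_less)
  have deg: "degree p' = degree p"
  proof (rule antisym)
    show "degree p' \<le> degree p" unfolding p'_def by (rule degree_map_poly_le)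
    show "degree p \<le> degree p'" using lead by (intro le_degree) simp
  qed
  show ?thesis
  proof (rule that[of p'])
    show "degree (coeff p' i) < degree P" for i
      using degree_mod_less[of P "coeff p i"] P unfolding cp' by fastforce
    show "[:P:] dvd p - p'" unfolding const_poly_dvd_iff by (simp add: cp' minus_mod_eq_mult_div)
  qed (use lead deg in auto)
qed

lemma reduced_dvd_imp_zero:
  fixes f :: "rat poly poly"
  assumes "[:P:] dvd f" "\<And>i. degree (coeff f i) < degree P"
  shows "f = 0"
proof (rule poly_eqI)
  fix i
  have "P dvd coeff f i" using assms(1) unfolding const_poly_dvd_iff by blast
  then show "coeff f i = coeff 0 i"
    using assms(2)[of i] dvd_imp_degree_le[of P "coeff f i"] by (cases "coeff f i = 0") auto
qed

text \<open>Two monic polynomials that divide each other modulo \<open>P\<close> have equal degrees, so their difference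
  vanishes modulo \<open>P\<close>; being reduced, it is zero.\<close>

lemma monic_generator_unique:
  fixes p p' :: "rat poly poly"
  assumes P: "degree P > 0" and p: "lead_coeff p = 1" "\<And>i. degree (coeff p i) < degree P"
    and p': "lead_coeff p' = 1" "\<And>i. degree (coeff p' i) < degree P"
    and dvd: "p' \<in> ideal_gen {[:P:], p}" "p \<in> ideal_gen {[:P:], p'}"
  shows "p = p'"
proof -
  have le: "degree a \<le> degree b" if "lead_coeff a = 1" "lead_coeff b = 1" "b \<in> ideal_gen {[:P:], a}" for a b :: "rat poly poly"
  proof (rule ccontr)
    assume "\<not> degree a \<le> degree b"
    then have "[:P:] dvd b" using degree_less_multiple_vanishes[OF that(1,3)] by simp
    then have "P dvd lead_coeff b" unfolding const_poly_dvd_iff by blast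
    then have "P dvd 1" using that(2) by simp
    then show False using P by (auto simp: poly_dvd_1)
  qed
  then have deg: "degree p = degree p'" using p(1) p'(1) dvd by (meson antisym)
  have "[:P:] dvd p - p'"
  proof (cases "p = p'")
    case False
    have "degree (p - p') < degree p"
    proof (rule ccontr)
      assume "\<not> degree (p - p') < degree p"
      then have "degree (p - p') = degree p" using degree_diff_le[of p "degree p" p'] deg by simp
      moreover have "coeff (p - p') (degree p) = 0" using p(1) p'(1) deg by simp
      ultimately have "lead_coeff (p - p') = 0" by metis
      then have "p - p' = 0" unfolding leading_coeff_0_iff .
      then show False using False by simp
    qed
    moreover have "p - p' \<in> ideal_gen {[:P:], p}"
      by (rule ideal_gen_diff[OF ideal_gen_base dvd(1)]) simp
    ultimately show ?thesis using degree_less_multiple_vanishes[OF p(1)] by blast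
  qed simp
  moreover have "degree (coeff (p - p') i) < degree P" for i
    unfolding coeff_diff using degree_diff_less[OF p(2) p'(2)] .
  ultimately have "p - p' = 0" by (rule reduced_dvd_imp_zero)
  then show ?thesis by simp
qed


text \<open>Comaximality: if \<open>s P + t Q = 1\<close> then \<open>f = s P f + t Q f\<close>, and \<open>P f\<close> lies in \<open>\<langle>P Q, T\<rangle>\<close> as soon as \<open>f\<close>
  lies in \<open>\<langle>Q, T\<rangle>\<close>.\<close>

lemma ideal_const_prod:
  fixes P :: "'b \<Rightarrow> rat poly"
  assumes "finite D" "\<And>i j. i \<in> D \<Longrightarrow> j \<in> D \<Longrightarrow> i \<noteq> j \<Longrightarrow> coprime (P i) (P j)"
    and "\<And>i. i \<in> D \<Longrightarrow> f \<in> ideal_gen (insert [:P i:] T)"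
  shows "f \<in> ideal_gen (insert [:\<Prod>i\<in>D. P i:] T)"
  using assms
proof (induction D rule: finite_induct)
  case empty
  have "1 \<in> ideal_gen (insert [:1:] T)" by (intro ideal_gen_base) (simp add: one_pCons)
  then show ?case by (simp add: ideal_gen_one)
next
  case (insert i D)
  define Q where "Q = (\<Prod>i\<in>D. P i)"
  have step: "[:a:] * f \<in> ideal_gen (insert [:P i * Q:] T)"
    if f: "f \<in> ideal_gen (insert [:b:] T)" and ab: "P i * Q = a * b" for a b
  proof -
    obtain r where r: "f - r * [:b:] \<in> ideal_gen T"
      using f unfolding ideal_gen_insert by blast
    have "[:a:] * f - r * [:P i * Q:] = [:a:] * (f - r * [:b:])"
      unfolding ab by (simp add: algebra_simps)
    also have "\<dots> \<in> ideal_gen T" by (rule ideal_gen_mult[OF r])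
    finally show ?thesis unfolding ideal_gen_insert by blast
  qed
  have "coprime (P i) Q"
    unfolding Q_def using insert.hyps insert.prems(1) by (intro prod_coprime_right) auto
  then obtain s t where st: "s * P i + t * Q = 1" by (rule coprime_bezout)
  have "[:P i:] * f \<in> ideal_gen (insert [:P i * Q:] T)"
  proof (rule step[OF _ refl])
    show "f \<in> ideal_gen (insert [:Q:] T)"
      unfolding Q_def by (rule insert.IH) (use insert.prems in auto)
  qed
  moreover have "[:Q:] * f \<in> ideal_gen (insert [:P i * Q:] T)"
    by (rule step[where a = Q and b = "P i"]) (use insert.prems(2)[of i] in \<open>simp_all add: mult.commute\<close>)
  ultimately have "[:s:] * ([:P i:] * f) + [:t:] * ([:Q:] * f) \<in> ideal_gen (insert [:P i * Q:] T)"
    by (rule ideal_gen_add[OF ideal_gen_mult ideal_gen_mult])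
  also have "[:s:] * ([:P i:] * f) + [:t:] * ([:Q:] * f) = [:s * P i + t * Q:] * f"
    by (simp add: smult_add_left mult.commute)
  finally have "f \<in> ideal_gen (insert [:P i * Q:] T)" by (simp add: st)
  then show ?case using insert.hyps by (simp add: Q_def)
qed

lemma monom_eq_power: "monom 1 n = xp ^ n"
  by (simp add: monom_altdef)

lemma X_power: "X ^ n = [:xp ^ n:]"
  by (simp add: poly_const_pow)

lemma XY_geometric: "(X * Y - 1) * G_pol k = (X * Y) ^ k - 1" "(X - Y) * H_pol m = X ^ m - Y ^ m"
  by (simp_all only: G_pol_eq H_pol_eq power_diff_1_eq[of "X * Y"] diff_power_eq_product_sum[of X])

lemma coprime_cong_mod:
  fixes c d p :: "rat poly"
  assumes "coprime p c" "p dvd c - d"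
  shows "coprime p d"
proof (rule coprimeI)
  fix w assume "w dvd p" "w dvd d"
  then have "w dvd (c - d) + d" using assms(2) by (intro dvd_add) (rule dvd_trans)
  then have "w dvd c" by simp
  with \<open>w dvd p\<close> show "is_unit w" using assms(1) by (metis coprime_common_divisor)
qed

lemma dvd_of_dvd_diff: "p dvd b \<Longrightarrow> p dvd b - c \<Longrightarrow> p dvd (c :: rat poly)"
  using dvd_diff[of p b "b - c"] by simp

lemma coprime_of_nat: "n \<ge> 1 \<Longrightarrow> coprime (p :: rat poly) (of_nat n)"
proof -
  assume "n \<ge> 1"
  then have "is_unit (of_nat n :: rat poly)"
    by (simp add: of_nat_poly is_unit_const_poly_iff is_unit_right_imp_coprime)
  then show ?thesis by (rule is_unit_right_imp_coprime)
qed

context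
  fixes \<delta> :: nat
  assumes \<delta>: "\<delta> > 1"
begin

abbreviation (input) "P \<equiv> cyclotomic (2 * \<delta>)"

lemma P_dvd_power: "2 * \<delta> dvd l \<Longrightarrow> P dvd xp ^ l - 1"
proof -
  assume "2 * \<delta> dvd l"
  then obtain c where c: "l = 2 * \<delta> * c" by blast
  have "P dvd xp ^ (2 * \<delta>) - 1"
    using cyclotomic_dvd_unity_polynomial[of "2 * \<delta>"] \<delta> by (simp add: monom_eq_power)
  also have "xp ^ (2 * \<delta>) - 1 dvd (xp ^ (2 * \<delta>)) ^ c - 1"
    using power_diff_1_eq[of "xp ^ (2 * \<delta>)" c] by simp
  finally show ?thesis by (simp only: c power_mult)
qed

lemma P_coprime_power: "\<not> 2 * \<delta> dvd l \<Longrightarrow> coprime P (xp ^ l - 1)"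
  unfolding monom_eq_power[symmetric] using \<delta> by (intro coprime_cyclotomic_unity_polynomial) auto

lemma P_coprime_X: "coprime P xp"
proof (rule coprimeI)
  fix c assume c: "c dvd P" "c dvd xp"
  then have "c dvd xp ^ (2 * \<delta>) - 1" by (intro dvd_trans[OF c(1) P_dvd_power]) simp
  moreover have "xp dvd xp ^ (2 * \<delta>)" using \<delta> by (intro dvd_power) simp
  then have "c dvd xp ^ (2 * \<delta>)" by (rule dvd_trans[OF c(2)])
  ultimately show "is_unit c" using dvd_diff[of c "xp ^ (2 * \<delta>)" "xp ^ (2 * \<delta>) - 1"] by (metis diff_diff_eq2 diff_add_cancel add_diff_cancel_left')
qed

lemma ideal_cong_X_power:
  assumes T: "[:P:] \<in> ideal_gen T" and dvd: "2 * \<delta> dvd l"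
  shows "ideal_cong T (X ^ l) 1"
proof -
  obtain c where c: "xp ^ l - 1 = P * c" using P_dvd_power[OF dvd] by blast
  have "X ^ l - 1 = [:xp ^ l - 1:]" by (simp add: X_power one_pCons)
  also have "\<dots> = [:c:] * [:P:]" by (simp add: c mult.commute)
  finally show ?thesis
    unfolding ideal_cong_def using ideal_gen_mult[OF T] by metis
qed

text \<open>The inverse of \<open>x\<close> modulo \<open>\<Phi>\<close>.\<close>

abbreviation (input) "a \<equiv> xp ^ (2 * \<delta> - 1)"

lemma P_dvd_inverse: "P dvd xp * a - 1"
proof -
  have "xp * a = xp ^ (2 * \<delta>)" using \<delta> by (simp only: flip: power_Suc) simp
  then show ?thesis using P_dvd_power[of "2 * \<delta>"] by simp
qed

lemma P_dvd_inverse_power: "P dvd (xp * a) ^ n - 1"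
  unfolding power_diff_1_eq by (rule dvd_mult2[OF P_dvd_inverse])

text \<open>The order \<open>2\<delta>\<close> of \<open>x\<close> exceeds 2.\<close>

lemma x_inverse_distinct: "coprime P (a - xp)"
proof -
  have "\<not> 2 * \<delta> dvd 2" using \<delta> by (auto dest: dvd_imp_le)
  then have "coprime P (xp ^ 2 - 1)" by (rule P_coprime_power)
  moreover have "P dvd (xp ^ 2 - 1) - (- (xp * (a - xp)))"
  proof -
    have "(xp ^ 2 - 1) - (- (xp * (a - xp))) = xp * a - 1"
      by (simp only: algebra_simps power2_eq_square)
    then show ?thesis using P_dvd_inverse by metis
  qed
  ultimately have "coprime P (- (xp * (a - xp)))" by (rule coprime_cong_mod)
  then show ?thesis by (simp only: coprime_minus_right_iff coprime_mult_right_iff)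
qed

context
  fixes k m :: nat
  assumes k: "k \<ge> 1" and m: "m \<ge> 1"
begin

abbreviation (input) "\<gamma> \<equiv> gcd m k"
abbreviation (input) "J \<equiv> {[:P:], G_pol k, H_pol m}"

lemma generator_relations: "ideal_cong J ((X * Y) ^ k) 1" "ideal_cong J (X ^ m) (Y ^ m)"
  unfolding ideal_cong_def XY_geometric[symmetric]
  by (rule ideal_gen_mult[OF ideal_gen_base], simp)+


context
  fixes u v :: nat
  assumes uv: "u * m = v * k + \<gamma>"
begin

abbreviation (input) "e \<equiv> u * m + v * k"
abbreviation (input) "F \<equiv> Y ^ \<gamma> - X ^ e"
abbreviation (input) "k' \<equiv> k div \<gamma>"
abbreviation (input) "m' \<equiv> m div \<gamma>"
abbreviation (input) "l \<equiv> k' * m"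

text \<open>With \<open>u\<close> and \<open>v\<close> natural numbers such that \<open>u m = v k + g\<close>, the exponent \<open>e = u m + v k\<close> is natural too
  and no negative powers of \<open>x\<close> or \<open>y\<close> enter the computations.  The exponents of \<open>x\<close> that have to vanish modulo
  \<open>2\<delta>\<close> are then twice a multiple of \<open>l = lcm(k, m)\<close>, or twice \<open>u m\<close> or \<open>v k\<close>.\<close>

lemma exponent_arithmetic:
  "\<gamma> > 0" "k = \<gamma> * k'" "m = \<gamma> * m'" "lcm k m = l" "u * m' = v * k' + 1"
  "k + e * k' = 2 * (u * l)" "e * m' = m + 2 * (v * l)" "\<gamma> + e = 2 * (u * m)" "e = \<gamma> + 2 * (v * k)"
proof -
  show \<gamma>: "\<gamma> > 0" using m by simp
  show kk: "k = \<gamma> * k'" and mm: "m = \<gamma> * m'" by simp_all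
  show "lcm k m = l" by (simp add: lcm_nat_def gcd.commute dvd_div_mult)
  have "\<gamma> * (u * m') = \<gamma> * (v * k' + 1)" using uv kk mm by (metis add_mult_distrib2 mult.left_commute nat_mult_1_right)
  then show "u * m' = v * k' + 1" using \<gamma> by (metis mult_cancel1 less_numeral_extra(3))
  show "\<gamma> + e = 2 * (u * m)" "e = \<gamma> + 2 * (v * k)" using uv by simp_all
  have "k + e * k' = (\<gamma> + e) * k'" using kk by (simp add: algebra_simps)
  also have "\<dots> = 2 * (u * l)" using \<open>\<gamma> + e = 2 * (u * m)\<close> by simp
  finally show "k + e * k' = 2 * (u * l)" .
  have "e * m' = \<gamma> * m' + 2 * (v * (k * m'))" using \<open>e = \<gamma> + 2 * (v * k)\<close> by (metis add_mult_distrib mult.assoc)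
  also have "k * m' = l" using kk mm by (metis mult.assoc mult.commute)
  finally show "e * m' = m + 2 * (v * l)" using mm by simp
qed

text \<open>Compute \<open>x\<^sup>e = x\<^bsup>um\<^esup> x\<^bsup>vk\<^esup> = y\<^bsup>um\<^esup> x\<^bsup>vk\<^esup> = (x y)\<^bsup>vk\<^esup> y\<^sup>g = y\<^sup>g\<close>.\<close>

lemma Y_power_cong: "ideal_cong J (Y ^ \<gamma>) (X ^ e)"
proof (rule ideal_cong_sym)
  have 1: "(X ^ m) ^ u * X ^ (v * k) = X ^ e"
    by (simp only: power_add mult.commute[of u] flip: power_mult)
  have 2: "(Y ^ m) ^ u * X ^ (v * k) = ((X * Y) ^ k) ^ v * Y ^ \<gamma>"
  proof -
    have "(Y ^ m) ^ u = Y ^ (v * k) * Y ^ \<gamma>"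
      by (simp only: mult.commute[of m] uv power_add flip: power_mult)
    moreover have "((X * Y) ^ k) ^ v = X ^ (v * k) * Y ^ (v * k)"
      by (simp only: power_mult_distrib mult.commute[of v] flip: power_mult)
    ultimately show ?thesis by (simp only: mult_ac)
  qed
  have "ideal_cong J ((X ^ m) ^ u * X ^ (v * k)) ((Y ^ m) ^ u * X ^ (v * k))"
    by (intro ideal_cong_mult ideal_cong_power generator_relations ideal_cong_refl)
  moreover have "ideal_cong J (((X * Y) ^ k) ^ v * Y ^ \<gamma>) (1 ^ v * Y ^ \<gamma>)"
    by (intro ideal_cong_mult ideal_cong_power generator_relations ideal_cong_refl)
  ultimately have "ideal_cong J (X ^ e) (1 ^ v * Y ^ \<gamma>)"
    unfolding 1 2 by (rule ideal_cong_trans)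
  then show "ideal_cong J (X ^ e) (Y ^ \<gamma>)" unfolding power_one mult_1 .
qed

text \<open>Conversely, \<open>y\<^sup>g = x\<^sup>e\<close> determines \<open>(x y)\<^sup>k\<close> and \<open>y\<^sup>m\<close> up to powers of \<open>x\<^bsup>2l\<^esup>\<close>.\<close>

lemma powers_cong:
  assumes "ideal_cong T (Y ^ \<gamma>) (X ^ e)"
  shows "ideal_cong T ((X * Y) ^ k) (X ^ (2 * (u * l)))" "ideal_cong T (Y ^ m) (X ^ m * X ^ (2 * (v * l)))"
proof -
  note ar = exponent_arithmetic
  have "ideal_cong T (X ^ k * (Y ^ \<gamma>) ^ k') (X ^ k * (X ^ e) ^ k')"
    by (intro ideal_cong_mult ideal_cong_power assms ideal_cong_refl)
  moreover have "X ^ k * (Y ^ \<gamma>) ^ k' = (X * Y) ^ k"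
    by (simp only: power_mult_distrib flip: power_mult ar(2))
  moreover have "X ^ k * (X ^ e) ^ k' = X ^ (2 * (u * l))"
    by (simp only: flip: power_mult power_add ar(6))
  ultimately show "ideal_cong T ((X * Y) ^ k) (X ^ (2 * (u * l)))" by (simp only:)
  have "ideal_cong T ((Y ^ \<gamma>) ^ m') ((X ^ e) ^ m')"
    by (intro ideal_cong_power assms)
  moreover have "(X ^ e) ^ m' = X ^ m * X ^ (2 * (v * l))"
    by (simp only: flip: power_mult power_add ar(7))
  ultimately show "ideal_cong T (Y ^ m) (X ^ m * X ^ (2 * (v * l)))"
    by (simp only: flip: power_mult ar(3))
qed

text \<open>Combining both directions gives \<open>x\<^bsup>2ul\<^esup> = x\<^bsup>2vl\<^esup> = 1\<close>.  As \<open>u m/g - v k/g = 1\<close>, this yields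
  \<open>x\<^bsup>2l\<^esup> = 1\<close>, although \<open>x\<^bsup>2l\<^esup> - 1\<close> is a unit modulo \<open>\<Phi>\<close>.\<close>

lemma no_common_root:
  assumes "\<not> \<delta> dvd lcm k m"
  shows "1 \<in> ideal_gen J"
proof -
  note ar = exponent_arithmetic
  have P: "[:P:] \<in> ideal_gen J" by (intro ideal_gen_base) simp
  note c = powers_cong[OF Y_power_cong]
  have ul: "ideal_cong J (X ^ (2 * (u * l))) 1"
    by (rule ideal_cong_trans[OF ideal_cong_sym[OF c(1)] generator_relations(1)])
  have vl: "ideal_cong J (X ^ (2 * (v * l))) 1"
  proof -
    \<comment> \<open>The inverse of \<open>x\<^sup>m\<close> modulo \<open>\<Phi>\<close>.\<close>
    let ?w = "X ^ ((2 * \<delta> - 1) * m)"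
    have w: "ideal_cong J (?w * X ^ m) 1"
    proof -
      have "?w * X ^ m = X ^ (2 * \<delta> * m)"
        using \<delta> by (simp only: flip: power_add) (simp add: algebra_simps)
      then show ?thesis using ideal_cong_X_power[OF P, of "2 * \<delta> * m"] by simp
    qed
    have "ideal_cong J (X ^ m * X ^ (2 * (v * l))) (X ^ m)"
      by (rule ideal_cong_sym[OF ideal_cong_trans[OF generator_relations(2) c(2)]])
    then have "ideal_cong J (?w * (X ^ m * X ^ (2 * (v * l)))) (?w * X ^ m)"
      by (intro ideal_cong_mult ideal_cong_refl)
    then have "ideal_cong J (?w * X ^ m * X ^ (2 * (v * l))) 1"
      unfolding mult.assoc[symmetric] using w by (rule ideal_cong_trans)
    moreover have "ideal_cong J (?w * X ^ m * X ^ (2 * (v * l))) (1 * X ^ (2 * (v * l)))"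
      using w by (intro ideal_cong_mult ideal_cong_refl)
    ultimately show ?thesis
      unfolding mult_1 by (rule ideal_cong_trans[OF ideal_cong_sym, rotated])
  qed
  have "2 * (u * l) * m' = 2 * l * (u * m')" by simp
  also have "\<dots> = 2 * (v * l) * k' + 2 * l" unfolding ar(5) by (simp add: algebra_simps)
  finally have eq: "(X ^ (2 * (u * l))) ^ m' = (X ^ (2 * (v * l))) ^ k' * X ^ (2 * l)"
    by (simp only: flip: power_mult power_add)
  have "ideal_cong J ((X ^ (2 * (v * l))) ^ k' * X ^ (2 * l)) (1 ^ k' * X ^ (2 * l))"
    by (intro ideal_cong_mult ideal_cong_power vl ideal_cong_refl)
  moreover have "ideal_cong J ((X ^ (2 * (u * l))) ^ m') (1 ^ m')"
    by (intro ideal_cong_power ul)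
  ultimately have "ideal_cong J (X ^ (2 * l)) 1"
    unfolding eq power_one mult_1 by (rule ideal_cong_trans[OF ideal_cong_sym])
  then have "X ^ (2 * l) - 1 \<in> ideal_gen J" unfolding ideal_cong_def .
  also have "X ^ (2 * l) - 1 = [:xp ^ (2 * l) - 1:] * 1"
    by (simp add: X_power one_pCons)
  finally have mem: "[:xp ^ (2 * l) - 1:] * 1 \<in> ideal_gen J" .
  have cop: "coprime P (xp ^ (2 * l) - 1)"
    by (rule P_coprime_power) (use assms ar(4) in simp)
  show ?thesis by (rule ideal_cancel_const[OF _ cop mem]) simp
qed

lemma F_monic: "lead_coeff F = 1" "degree F = \<gamma>"
proof -
  have \<gamma>: "\<gamma> > 0" by (rule exponent_arithmetic)
  have F: "F = monom 1 \<gamma> - [:xp ^ e:]" by (simp add: monom_altdef X_power)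
  show deg: "degree F = \<gamma>"
    unfolding F unfolding diff_conv_add_uminus using \<gamma> by (subst degree_add_eq_left) (simp_all add: degree_monom_eq)
  show "lead_coeff F = 1"
    unfolding deg unfolding F using \<gamma> by (cases \<gamma>) simp_all
qed

lemma poly_F: "poly F r = r ^ \<gamma> - xp ^ e"
  by (simp add: poly_power)

text \<open>The value is the derivative \<open>m x\<^bsup>m-1\<^esup>\<close>: the root \<open>x\<close> of \<open>y\<^sup>m - x\<^sup>m\<close> is simple.\<close>

lemma H_at_x: "coprime P (poly (H_pol m) xp)"
proof -
  have "xp ^ (m - Suc i) * xp ^ i = xp ^ (m - 1)" if "i < m" for i
    using that by (simp only: flip: power_add) simp
  then have "poly (H_pol m) xp = (\<Sum>i<m. xp ^ (m - 1))"
    unfolding H_pol_eq by (simp add: poly_sum poly_power)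
  then have "poly (H_pol m) xp = of_nat m * xp ^ (m - 1)" by simp
  then show ?thesis
    using coprime_of_nat[OF m] P_coprime_X by simp
qed

text \<open>The value is \<open>k\<close> modulo \<open>\<Phi>\<close>: the root \<open>1/x\<close> of \<open>(x y)\<^sup>k - 1\<close> is simple.\<close>

lemma G_at_inverse: "coprime P (poly (G_pol k) a)"
proof (rule coprime_cong_mod[OF coprime_of_nat[OF k]])
  have "of_nat k - poly (G_pol k) a = - (\<Sum>i<k. (xp * a) ^ i - 1)"
    unfolding G_pol_eq by (simp add: poly_sum poly_power sum_subtractf)
  also have "P dvd \<dots>"
    unfolding dvd_minus_iff by (intro dvd_sum P_dvd_inverse_power)
  finally show "P dvd of_nat k - poly (G_pol k) a" .
qed

context
  assumes dvd_l: "\<delta> dvd lcm k m"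
begin

text \<open>From \<open>u m/g - v k/g = 1\<close>, both \<open>k\<close> and \<open>m\<close> are combinations of the given multiple and of \<open>lcm(k, m)\<close>.\<close>

lemma dvd_k_iff: "\<delta> dvd v * k \<longleftrightarrow> \<delta> dvd k" and dvd_m_iff: "\<delta> dvd u * m \<longleftrightarrow> \<delta> dvd m"
proof -
  note ar = exponent_arithmetic
  have d: "\<delta> dvd k' * m" using dvd_l ar(4) by simp
  have km: "k * m' = k' * m" using ar(2,3) by (metis mult.assoc mult.commute)
  show "\<delta> dvd v * k \<longleftrightarrow> \<delta> dvd k"
  proof
    assume "\<delta> dvd v * k"
    then have "\<delta> dvd k' * (v * k)" "\<delta> dvd u * (k * m')" using d km by auto
    moreover have "u * (k * m') = k' * (v * k) + k"
      using arg_cong[OF ar(5), of "\<lambda>n. k * n"] by (simp only: algebra_simps)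
    ultimately show "\<delta> dvd k" by (metis dvd_add_right_iff)
  qed simp
  show "\<delta> dvd u * m \<longleftrightarrow> \<delta> dvd m"
  proof
    assume "\<delta> dvd u * m"
    then have "\<delta> dvd m' * (u * m)" "\<delta> dvd v * (k' * m)" using d by auto
    moreover have "m' * (u * m) = v * (k' * m) + m"
      using arg_cong[OF ar(5), of "\<lambda>n. n * m"] by (simp only: algebra_simps)
    ultimately show "\<delta> dvd m" by (metis dvd_add_right_iff)
  qed simp
qed

text \<open>The value is \<open>- x\<^sup>g (x\<^bsup>2vk\<^esup> - 1)\<close>.\<close>

lemma F_at_x: "\<delta> dvd k \<Longrightarrow> P dvd poly F xp" "\<not> \<delta> dvd k \<Longrightarrow> coprime P (poly F xp)"
proof -
  have eq: "poly F xp = - (xp ^ \<gamma> * (xp ^ (2 * (v * k)) - 1))"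
  proof -
    have "xp ^ e = xp ^ \<gamma> * xp ^ (2 * (v * k))" by (simp only: exponent_arithmetic(9) power_add)
    then show ?thesis by (simp only: poly_F right_diff_distrib mult_1_right minus_diff_eq)
  qed
  show "P dvd poly F xp" if "\<delta> dvd k"
    unfolding eq dvd_minus_iff by (rule dvd_mult[OF P_dvd_power]) (use that in simp)
  show "coprime P (poly F xp)" if "\<not> \<delta> dvd k"
  proof -
    have "coprime P (xp ^ (2 * (v * k)) - 1)"
      using that dvd_k_iff by (intro P_coprime_power) simp
    moreover have "coprime P (xp ^ \<gamma>)" using P_coprime_X by simp
    ultimately show ?thesis
      unfolding eq coprime_minus_right_iff coprime_mult_right_iff by blast
  qed
qed

text \<open>Multiplied by the unit \<open>x\<^sup>g\<close>, the value becomes \<open>1 - x\<^bsup>2um\<^esup>\<close> modulo \<open>\<Phi>\<close>.\<close>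

lemma F_at_inverse: "\<delta> dvd m \<Longrightarrow> P dvd poly F a" "\<not> \<delta> dvd m \<Longrightarrow> coprime P (poly F a)"
proof -
  have "- (xp ^ (2 * (u * m)) - 1) - xp ^ \<gamma> * poly F a = - ((xp * a) ^ \<gamma> - 1)"
    unfolding poly_F exponent_arithmetic(8)[symmetric]
    by (simp only: algebra_simps power_add power_mult_distrib)
  then have cong: "P dvd - (xp ^ (2 * (u * m)) - 1) - xp ^ \<gamma> * poly F a"
    using P_dvd_inverse_power[of \<gamma>] by (metis dvd_minus_iff)
  have X: "coprime P (xp ^ \<gamma>)" using P_coprime_X by simp
  show "P dvd poly F a" if "\<delta> dvd m"
  proof -
    have "P dvd - (xp ^ (2 * (u * m)) - 1)"
      unfolding dvd_minus_iff using that by (intro P_dvd_power) simp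
    then have "P dvd xp ^ \<gamma> * poly F a" using cong by (rule dvd_of_dvd_diff)
    then show ?thesis using X by (simp only: coprime_dvd_mult_right_iff)
  qed
  show "coprime P (poly F a)" if "\<not> \<delta> dvd m"
  proof -
    have "coprime P (- (xp ^ (2 * (u * m)) - 1))"
      unfolding coprime_minus_right_iff using that dvd_m_iff by (intro P_coprime_power) simp
    then have "coprime P (xp ^ \<gamma> * poly F a)" using cong by (rule coprime_cong_mod)
    then show ?thesis unfolding coprime_mult_right_iff by blast
  qed
qed

lemma multiples_of_F:
  "(Y - [:xp:]) * H_pol m \<in> ideal_gen {[:P:], F}" "(Y - [:a:]) * G_pol k \<in> ideal_gen {[:P:], F}"
proof -
  let ?T = "{[:P:], F}"
  have P: "[:P:] \<in> ideal_gen ?T" by (intro ideal_gen_base) simp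
  have "ideal_cong ?T (Y ^ \<gamma>) (X ^ e)"
    unfolding ideal_cong_def by (intro ideal_gen_base) simp
  note c = powers_cong[OF this]
  have dvd: "\<delta> dvd l" using dvd_l exponent_arithmetic(4) by simp
  have ul: "ideal_cong ?T (X ^ (2 * (u * l))) 1" and vl: "ideal_cong ?T (X ^ (2 * (v * l))) 1"
    using dvd by (auto intro!: ideal_cong_X_power[OF P] simp: mult_dvd_mono)
  have "ideal_cong ?T (X ^ m * X ^ (2 * (v * l))) (X ^ m * 1)"
    by (intro ideal_cong_mult ideal_cong_refl vl)
  then have "ideal_cong ?T (Y ^ m) (X ^ m)"
    unfolding mult_1_right by (rule ideal_cong_trans[OF c(2)])
  then have "- ((X - Y) * H_pol m) \<in> ideal_gen ?T"
    unfolding XY_geometric ideal_cong_def by (simp only: minus_diff_eq)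
  moreover have "- ((X - Y) * q) = (Y - [:xp:]) * q" for q
    by (simp only: minus_mult_left minus_diff_eq)
  ultimately show "(Y - [:xp:]) * H_pol m \<in> ideal_gen ?T" by metis
  have "(X * Y - 1) * G_pol k \<in> ideal_gen ?T"
    using ideal_cong_trans[OF c(1) ul] unfolding XY_geometric ideal_cong_def .
  then have 1: "[:a:] * ((X * Y - 1) * G_pol k) \<in> ideal_gen ?T" by (rule ideal_gen_mult)
  obtain w where w: "xp * a - 1 = P * w" using P_dvd_inverse by blast
  have 2: "Y * G_pol k * [:w:] * [:P:] \<in> ideal_gen ?T" by (rule ideal_gen_mult[OF P])
  have "[:w:] * [:P:] = [:a:] * X - 1"
  proof -
    have "[:w:] * [:P:] = [:xp * a - 1:]" unfolding w by (simp add: mult.commute)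
    also have "\<dots> = [:a:] * X - 1" by (simp add: one_pCons mult.commute)
    finally show ?thesis .
  qed
  then have 3: "Y * G_pol k * [:w:] * [:P:] = Y * G_pol k * ([:a:] * X - 1)" by (simp only: mult.assoc)
  have "s * ((x * y - 1) * q) - y * q * (s * x - 1) = (y - s) * q" for s x y q :: "rat poly poly"
    by (simp add: algebra_simps)
  then show "(Y - [:a:]) * G_pol k \<in> ideal_gen ?T"
    using ideal_gen_diff[OF 1 2] unfolding 3 by metis
qed

text \<open>The polynomial \<open>F = y\<^sup>g - x\<^sup>e\<close> lies in \<open>\<langle>\<Phi>, G, H\<rangle>\<close>, and \<open>(y - x) H\<close> and \<open>(y - 1/x) G\<close> are multiples of
  it modulo \<open>\<Phi>\<close>.  If \<open>x\<close> is a root of \<open>F\<close>, divide \<open>F\<close> by \<open>y - x\<close>: the quotient divides \<open>H\<close>, and it still lies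
  in the ideal because \<open>H(x)\<close> is a unit.  If \<open>x\<close> is not a root, then \<open>F(x)\<close> is a unit and \<open>F\<close> itself divides
  \<open>H\<close>.  The same argument with \<open>1/x\<close> and \<open>G\<close>, applied to the polynomial obtained, gives the generator.\<close>

lemma common_root_generator_exists:
  "\<exists>p. lead_coeff p = 1 \<and> degree p = \<gamma> - of_bool (\<delta> dvd k) - of_bool (\<delta> dvd m) \<and> p \<in> ideal_gen J \<and>
     G_pol k \<in> ideal_gen {[:P:], p} \<and> H_pol m \<in> ideal_gen {[:P:], p}"
proof -
  have PT: "[:P:] \<in> {[:P:], w}" for w by simp
  have PJ: "[:P:] \<in> J" "G_pol k \<in> ideal_gen J" "H_pol m \<in> ideal_gen J" by (auto intro: ideal_gen_base)
  have FJ: "F \<in> ideal_gen J" using Y_power_cong unfolding ideal_cong_def .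
  have \<gamma>: "\<gamma> > 0" by (rule exponent_arithmetic)
  have split: "p \<in> ideal_gen {[:P:], (Y - [:r:]) * synthetic_div p r}"
    "(Y - [:r:]) * synthetic_div p r \<in> ideal_gen (insert p (insert [:P:] T))" if "P dvd poly p r" for p r T
  proof -
    have P: "[:poly p r:] \<in> ideal_gen (insert [:P:] S)" for S
      using that by (intro ideal_gen_dvd[of "[:P:]"]) (auto simp: const_poly_dvd)
    show "p \<in> ideal_gen {[:P:], (Y - [:r:]) * synthetic_div p r}"
      by (subst synthetic_div_expand[of p r]) (rule ideal_gen_add[OF ideal_gen_base P], simp)
    have "(Y - [:r:]) * synthetic_div p r = p - [:poly p r:]"
      using synthetic_div_expand[of p r] by (metis add_diff_cancel_right')
    also have "\<dots> \<in> ideal_gen (insert p (insert [:P:] T))"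
      using P[of "insert p T"] by (intro ideal_gen_diff[OF ideal_gen_base]) (simp_all add: insert_commute)
    finally show "(Y - [:r:]) * synthetic_div p r \<in> ideal_gen (insert p (insert [:P:] T))" .
  qed
  have mono: "f \<in> ideal_gen {[:P:], w}" if "f \<in> ideal_gen {[:P:], p}" "p \<in> ideal_gen {[:P:], w}" for f p w
  proof -
    have "ideal_gen {[:P:], p} \<subseteq> ideal_gen {[:P:], w}"
      unfolding ideal_gen_subset_iff using that(2) ideal_gen_base[OF PT] by simp
    then show ?thesis using that(1) by blast
  qed
  have mult: "(Y - [:r:]) * w \<in> ideal_gen {[:P:], w}" for r w
    by (intro ideal_gen_mult ideal_gen_base) simp
  have inJ: "w \<in> ideal_gen J" if "w \<in> ideal_gen (insert p (insert [:P:] J))" "p \<in> ideal_gen J" for w p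
  proof -
    have "ideal_gen (insert p (insert [:P:] J)) \<subseteq> ideal_gen J"
      unfolding ideal_gen_subset_iff using that(2) by (auto intro: ideal_gen_base)
    then show ?thesis using that(1) by blast
  qed
  \<comment> \<open>First the root \<open>x\<close>: \<open>F1\<close> is \<open>F\<close> or the quotient of \<open>F\<close> by \<open>y - x\<close>, and its value at \<open>1/x\<close> is zero or a
      unit in the same cases as that of \<open>F\<close>.\<close>
  obtain F1 where F1: "lead_coeff F1 = 1" "degree F1 = \<gamma> - of_bool (\<delta> dvd k)" "F1 \<in> ideal_gen J"
    "H_pol m \<in> ideal_gen {[:P:], F1}" "(Y - [:a:]) * G_pol k \<in> ideal_gen {[:P:], F1}"
    "\<delta> dvd m \<Longrightarrow> P dvd poly F1 a" "\<not> \<delta> dvd m \<Longrightarrow> coprime P (poly F1 a)"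
  proof (cases "\<delta> dvd k")
    case False
    show ?thesis
    proof (rule that[of F])
      show "H_pol m \<in> ideal_gen {[:P:], F}"
        by (rule ideal_cancel_linear[OF PT multiples_of_F(1) ideal_gen_base F_at_x(2)[OF False]]) simp
    qed (use False F_monic FJ multiples_of_F(2) F_at_inverse in simp_all)
  next
    case True
    define F1 where "F1 = synthetic_div F xp"
    note s = split[OF F_at_x(1)[OF True], folded F1_def]
    have lin: "poly ((Y - [:r:]) * w + [:c:]) s = (s - r) * poly w s + c" for r s c :: "rat poly" and w
      by (simp add: algebra_simps)
    have "poly F a = (a - xp) * poly F1 a + poly F xp"
      unfolding F1_def lin[symmetric] by (subst (1) synthetic_div_expand[of F xp]) (rule refl)
    then have eq: "poly F a - (a - xp) * poly F1 a = poly F xp" by (simp only: add_diff_cancel_left')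
    then have cong: "P dvd poly F a - (a - xp) * poly F1 a"
      using F_at_x(1)[OF True] by (simp only:)
    show ?thesis
    proof (rule that[of F1])
      show "lead_coeff F1 = 1" "degree F1 = \<gamma> - of_bool (\<delta> dvd k)"
        unfolding F1_def using synthetic_div_monic[OF F_monic(1), of xp] F_monic(2) \<gamma> True by simp_all
      show "H_pol m \<in> ideal_gen {[:P:], F1}"
        by (rule ideal_pair_divide_linear[OF mono[OF multiples_of_F(1) s(1)]])
      show "F1 \<in> ideal_gen J"
        by (rule ideal_cancel_linear[OF PJ(1) inJ[OF s(2) FJ] PJ(3) H_at_x])
      show "(Y - [:a:]) * G_pol k \<in> ideal_gen {[:P:], F1}"
        by (rule mono[OF multiples_of_F(2) mono[OF s(1) mult]])
      show "P dvd poly F1 a" if "\<delta> dvd m"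
      proof -
        have "P dvd (a - xp) * poly F1 a"
          by (rule dvd_of_dvd_diff[OF F_at_inverse(1)[OF that] cong])
        then show ?thesis using x_inverse_distinct by (simp only: coprime_dvd_mult_right_iff)
      qed
      show "coprime P (poly F1 a)" if "\<not> \<delta> dvd m"
        using coprime_cong_mod[OF F_at_inverse(2)[OF that] cong] unfolding coprime_mult_right_iff by blast
    qed
  qed
  show ?thesis
  proof (cases "\<delta> dvd m")
    case False
    have "G_pol k \<in> ideal_gen {[:P:], F1}"
      by (rule ideal_cancel_linear[OF PT F1(5) ideal_gen_base F1(7)[OF False]]) simp
    then show ?thesis using F1 False by (intro exI[of _ F1]) simp
  next
    case True
    define p where "p = synthetic_div F1 a"
    note s = split[OF F1(6)[OF True], folded p_def]
    \<comment> \<open>If both divisions take place, \<open>\<delta>\<close> divides \<open>g\<close>, so \<open>g > 1\<close>.\<close>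
    have "degree F1 > 0"
    proof (cases "\<delta> dvd k")
      case dk: True
      then have "\<delta> dvd \<gamma>" using True by simp
      then have "\<gamma> > 1" using \<gamma> \<delta> dvd_imp_le[of \<delta> \<gamma>] by simp
      then show ?thesis using F1(2) dk by simp
    qed (use F1(2) \<gamma> in simp)
    then have "lead_coeff p = 1" "degree p = \<gamma> - of_bool (\<delta> dvd k) - of_bool (\<delta> dvd m)"
      unfolding p_def using synthetic_div_monic[OF F1(1), of a] F1(2) True by simp_all
    moreover have "p \<in> ideal_gen J"
      by (rule ideal_cancel_linear[OF PJ(1) inJ[OF s(2) F1(3)] PJ(2) G_at_inverse])
    moreover have "G_pol k \<in> ideal_gen {[:P:], p}"
      by (rule ideal_pair_divide_linear[OF mono[OF F1(5) s(1)]])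
    moreover have "H_pol m \<in> ideal_gen {[:P:], p}"
      by (rule mono[OF F1(4) mono[OF s(1) mult]])
    ultimately show ?thesis by blast
  qed
qed

end

end

end

end


hide_const (open) P \<gamma> J e F k' m' l a

section \<open>The staircase of the elementary ideal and the basis B\<close>

abbreviation (input) "cyc \<delta> \<equiv> cyclotomic (2 * \<delta>)"

lemma ideal_gen_pair_cong:
  assumes "[:P:] dvd p - p'"
  shows "ideal_gen {[:P:], p} = ideal_gen {[:P:], p'}"
proof (rule ideal_gen_eqI)
  have "p - p' \<in> ideal_gen {[:P:], w}" for w
    by (rule ideal_gen_dvd[OF _ assms]) simp
  note diff = this
  have "p' + (p - p') \<in> ideal_gen {[:P:], p'}" "p - (p - p') \<in> ideal_gen {[:P:], p}"
    by (rule ideal_gen_add[OF ideal_gen_base diff] ideal_gen_diff[OF ideal_gen_base diff], simp)+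
  then have "p \<in> ideal_gen {[:P:], p'}" "p' \<in> ideal_gen {[:P:], p}" by simp_all
  then show "{[:P:], p} \<subseteq> ideal_gen {[:P:], p'}" "{[:P:], p'} \<subseteq> ideal_gen {[:P:], p}"
    by (auto intro: ideal_gen_base)
qed

text \<open>Bezout coefficients of opposite signs, to stay in the natural numbers.\<close>

lemma nat_bezout:
  assumes "m \<ge> (1::nat)"
  obtains u v where "u * m = v * k + gcd m k"
  using bezout_nat[of m k] assms by (metis mult.commute not_one_le_zero)

text \<open>A monic \<open>p\<close> with \<open>\<langle>\<Phi>, p\<rangle> = \<langle>\<Phi>, G, H\<rangle>\<close> is a greatest common divisor modulo \<open>\<Phi>\<close>, and with reduced coefficients
  it is the only one.\<close>

lemma p_pol_properties:
  assumes k: "k \<ge> 1" and m: "m \<ge> 1" and \<delta>: "\<delta> > 1"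
  shows "lead_coeff (p_pol k m \<delta>) = 1"
    and "ideal_gen {[:cyc \<delta>:], p_pol k m \<delta>} = ideal_gen {[:cyc \<delta>:], G_pol k, H_pol m}"
    and "d_deg k m \<delta> = (if \<delta> dvd lcm k m then gcd m k - of_bool (\<delta> dvd k) - of_bool (\<delta> dvd m) else 0)"
proof -
  let ?P = "cyc \<delta>"
  let ?J = "{[:?P:], G_pol k, H_pol m}"
  let ?d = "if \<delta> dvd lcm k m then gcd m k - of_bool (\<delta> dvd k) - of_bool (\<delta> dvd m) else 0"
  have P: "degree ?P > 0" using \<delta> by (intro degree_cyclotomic_pos) simp
  obtain u v where uv: "u * m = v * k + gcd m k" by (rule nat_bezout[OF m])
  obtain p0 where p0: "lead_coeff p0 = 1" "degree p0 = ?d" "p0 \<in> ideal_gen ?J"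
    "G_pol k \<in> ideal_gen {[:?P:], p0}" "H_pol m \<in> ideal_gen {[:?P:], p0}"
  proof (cases "\<delta> dvd lcm k m")
    case True
    show ?thesis
      using common_root_generator_exists[OF \<delta> k m uv True] True that by auto
  next
    case False
    have "1 \<in> ideal_gen {[:?P:], 1}" by (intro ideal_gen_base) simp
    then show ?thesis
      using no_common_root[OF \<delta> k m uv False] False by (intro that[of 1]) (auto intro: ideal_gen_one)
  qed
  obtain p1 where p1: "lead_coeff p1 = 1" "degree p1 = degree p0" "\<And>i. degree (coeff p1 i) < degree ?P"
    "[:?P:] dvd p0 - p1"
    using reduce_coefficients[OF p0(1) P] by metis
  have eq: "ideal_gen {[:?P:], p1} = ideal_gen ?J"
    unfolding ideal_gen_pair_cong[OF p1(4), symmetric]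
    by (rule ideal_gen_eqI) (use p0 in \<open>auto intro: ideal_gen_base\<close>)
  have below: "ideal_gen ?J \<subseteq> ideal_gen {[:?P:], f}" if "dvd_mod ?P f (G_pol k)" "dvd_mod ?P f (H_pol m)" for f
    unfolding ideal_gen_subset_iff using that by (auto simp flip: ideal_gen_pair intro: ideal_gen_base)
  have p1J: "p1 \<in> ideal_gen ?J" unfolding eq[symmetric] by (intro ideal_gen_base) simp
  have GH: "dvd_mod ?P p1 (G_pol k)" "dvd_mod ?P p1 (H_pol m)"
    unfolding ideal_gen_pair[symmetric] eq by (auto intro: ideal_gen_base)
  have "p_pol k m \<delta> = p1"
    unfolding p_pol_def Let_def
  proof (rule the_equality)
    show "lead_coeff p1 = 1 \<and> (\<forall>i. degree (coeff p1 i) < degree ?P) \<and>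
       dvd_mod ?P p1 (G_pol k) \<and> dvd_mod ?P p1 (H_pol m) \<and>
       (\<forall>f. dvd_mod ?P f (G_pol k) \<and> dvd_mod ?P f (H_pol m) \<longrightarrow> dvd_mod ?P f p1)"
      using p1 GH below p1J by (auto simp flip: ideal_gen_pair)
    fix p assume p: "lead_coeff p = 1 \<and> (\<forall>i. degree (coeff p i) < degree ?P) \<and>
       dvd_mod ?P p (G_pol k) \<and> dvd_mod ?P p (H_pol m) \<and>
       (\<forall>f. dvd_mod ?P f (G_pol k) \<and> dvd_mod ?P f (H_pol m) \<longrightarrow> dvd_mod ?P f p)"
    show "p = p1"
    proof (rule monic_generator_unique[OF P])
      show "p1 \<in> ideal_gen {[:?P:], p}" using p p1J below by blast
      show "p \<in> ideal_gen {[:?P:], p1}" unfolding ideal_gen_pair using p GH by blast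
    qed (use p p1 in auto)
  qed
  then show "lead_coeff (p_pol k m \<delta>) = 1" "ideal_gen {[:?P:], p_pol k m \<delta>} = ideal_gen ?J"
    "d_deg k m \<delta> = ?d"
    using p1(1,2) p0(2) eq by (simp_all add: d_deg_def)
qed

lemma prod_dvd_of_coprime:
  fixes P :: "'b \<Rightarrow> rat poly"
  assumes "finite D" "\<And>i j. i \<in> D \<Longrightarrow> j \<in> D \<Longrightarrow> i \<noteq> j \<Longrightarrow> coprime (P i) (P j)"
    and "\<And>i. i \<in> D \<Longrightarrow> P i dvd c"
  shows "(\<Prod>i\<in>D. P i) dvd c"
  using assms
proof (induction D rule: finite_induct)
  case (insert i D)
  have "coprime (P i) (\<Prod>i\<in>D. P i)"
    using insert.hyps insert.prems(1) by (intro prod_coprime_right) auto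
  moreover have "P i dvd c" "(\<Prod>i\<in>D. P i) dvd c"
    using insert by auto
  ultimately show ?case using insert.hyps by (simp add: divides_mult)
qed simp

text \<open>The moduli are constant in \<open>y\<close>, so Bezout identities between polynomials in \<open>x\<close> suffice.\<close>

lemma chinese_remainder_const:
  fixes P :: "'b \<Rightarrow> rat poly" and t :: "'b \<Rightarrow> rat poly poly"
  assumes "finite D" "\<And>i j. i \<in> D \<Longrightarrow> j \<in> D \<Longrightarrow> i \<noteq> j \<Longrightarrow> coprime (P i) (P j)"
  shows "\<exists>f. \<forall>i\<in>D. [:P i:] dvd f - t i"
  using assms
proof (induction D rule: finite_induct)
  case (insert i D)
  obtain f where f: "\<And>j. j \<in> D \<Longrightarrow> [:P j:] dvd f - t j"
    using insert by auto
  define M where "M = (\<Prod>j\<in>D. P j)"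
  have "coprime (P i) M"
    unfolding M_def using insert.hyps insert.prems(1) by (intro prod_coprime_right) auto
  then obtain a b where ab: "a * P i + b * M = 1" by (rule coprime_bezout)
  define f' where "f' = f + [:b * M:] * (t i - f)"
  have "f' - t i = [:a * P i:] * (f - t i)"
  proof -
    have "a * P i = 1 - b * M" using ab by (simp add: eq_diff_eq)
    then have "[:a * P i:] = 1 - [:b * M:]" by (simp add: one_pCons)
    moreover have "f + w * (t i - f) - t i = (1 - w) * (f - t i)" for w
      by (simp add: algebra_simps)
    ultimately show ?thesis unfolding f'_def by metis
  qed
  also have "[:P i:] dvd \<dots>" by (intro dvd_mult2) (simp add: const_poly_dvd)
  finally have "[:P i:] dvd f' - t i" .
  moreover have "[:P j:] dvd f' - t j" if "j \<in> D" for j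
  proof -
    have "P j dvd M" unfolding M_def using insert.hyps(1) that by (rule dvd_prodI)
    then have "[:P j:] dvd [:b * M:] * (t i - f)" by (intro dvd_mult2) (simp add: const_poly_dvd)
    then have "[:P j:] dvd (f - t j) + [:b * M:] * (t i - f)" using f[OF that] by (rule dvd_add[rotated])
    then show ?thesis by (simp add: f'_def algebra_simps)
  qed
  ultimately show ?case by blast
qed simp

context
  fixes k m q :: nat
  assumes k: "k \<ge> 1" and m: "m \<ge> 1" and q: "odd q"
begin

abbreviation (input) "g \<equiv> gcd m k"
abbreviation (input) "D \<equiv> D_set k m q"
abbreviation (input) "S \<equiv> S_set k m q"
abbreviation (input) "d \<equiv> d_deg k m"
abbreviation (input) "p \<equiv> p_pol k m"
abbreviation (input) "\<Psi> \<equiv> Pi_pol k m q"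
abbreviation (input) "gens \<equiv> {[:A_pol q:], G_pol k, H_pol m}"

lemma finite_D: "finite D"
  using q by (intro finite_subset[of D "{\<delta>. \<delta> dvd q}"]) (auto simp: D_set_def intro!: finite_divisors_nat Nat.gr0I)

lemma D_set_properties: "\<delta> \<in> D \<Longrightarrow> \<delta> > 1" "\<delta> \<in> D \<Longrightarrow> d \<delta> > 0" "\<delta> \<in> D \<Longrightarrow> \<delta> dvd lcm k m"
  using p_pol_properties(3)[OF k m, of \<delta>] by (auto simp: D_set_def split: if_splits)

lemma coprime_D: "i \<in> D \<Longrightarrow> j \<in> D \<Longrightarrow> i \<noteq> j \<Longrightarrow> coprime (cyc i) (cyc j)"
  using D_set_properties(1) by (intro coprime_cyclotomic) force+

text \<open>Indices \<open>\<delta>\<close> with \<open>d\<^sub>\<delta> = 0\<close> impose no condition, since the corresponding ideal is the whole ring.\<close>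

lemma membership_criterion:
  "f \<in> ideal_gen gens \<longleftrightarrow> (\<forall>\<delta>\<in>D. f \<in> ideal_gen {[:cyc \<delta>:], p \<delta>})"
proof
  let ?D = "{\<delta>. \<delta> > 1 \<and> \<delta> dvd q}"
  have finite: "finite ?D"
    using q by (intro finite_subset[of ?D "{\<delta>. \<delta> dvd q}"]) (auto intro!: finite_divisors_nat Nat.gr0I)
  assume f: "f \<in> ideal_gen gens"
  show "\<forall>\<delta>\<in>D. f \<in> ideal_gen {[:cyc \<delta>:], p \<delta>}"
  proof
    fix \<delta> assume "\<delta> \<in> D"
    then have \<delta>: "\<delta> \<in> ?D" by (simp add: D_set_def)
    then have "cyc \<delta> dvd A_pol q"
      unfolding A_pol_eq_prod[OF q] using finite by (intro dvd_prodI)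
    then have "[:A_pol q:] \<in> ideal_gen {[:cyc \<delta>:], G_pol k, H_pol m}"
      by (intro ideal_gen_dvd[of "[:cyc \<delta>:]"]) (simp_all add: const_poly_dvd)
    then have "ideal_gen gens \<subseteq> ideal_gen {[:cyc \<delta>:], G_pol k, H_pol m}"
      unfolding ideal_gen_subset_iff by (auto intro: ideal_gen_base)
    then show "f \<in> ideal_gen {[:cyc \<delta>:], p \<delta>}"
      using f \<delta> by (auto simp: p_pol_properties(2)[OF k m])
  qed
next
  let ?D = "{\<delta>. \<delta> > 1 \<and> \<delta> dvd q}"
  have finite: "finite ?D"
    using q by (intro finite_subset[of ?D "{\<delta>. \<delta> dvd q}"]) (auto intro!: finite_divisors_nat Nat.gr0I)
  assume f: "\<forall>\<delta>\<in>D. f \<in> ideal_gen {[:cyc \<delta>:], p \<delta>}"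
  have "f \<in> ideal_gen {[:\<Prod>\<delta>\<in>?D. cyc \<delta>:], G_pol k, H_pol m}"
  proof (rule ideal_const_prod[OF finite])
    show "coprime (cyc i) (cyc j)" if "i \<in> ?D" "j \<in> ?D" "i \<noteq> j" for i j
      using that by (intro coprime_cyclotomic) force+
    show "f \<in> ideal_gen {[:cyc \<delta>:], G_pol k, H_pol m}" if \<delta>: "\<delta> \<in> ?D" for \<delta>
    proof (cases "\<delta> \<in> D")
      case True
      then show ?thesis using f \<delta> by (auto simp: p_pol_properties(2)[OF k m])
    next
      case False
      then have "degree (p \<delta>) = 0" using \<delta> by (simp add: D_set_def d_deg_def)
      then obtain c where "p \<delta> = [:c:]" by (rule degree_eq_zeroE)
      then have "p \<delta> = 1" using p_pol_properties(1)[OF k m, of \<delta>] \<delta> by (simp add: one_pCons)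
      then have "1 \<in> ideal_gen {[:cyc \<delta>:], p \<delta>}" by (intro ideal_gen_base) simp
      moreover have "\<delta> > 1" using \<delta> by simp
      ultimately have "1 \<in> ideal_gen {[:cyc \<delta>:], G_pol k, H_pol m}"
        by (simp only: p_pol_properties(2)[OF k m])
      then show ?thesis by (rule ideal_gen_one)
    qed
  qed
  then show "f \<in> ideal_gen gens" unfolding A_pol_eq_prod[OF q] .
qed

lemma Pi_nonzero: "\<Psi> n \<noteq> 0"
proof -
  have "cyc \<delta> \<noteq> 0" if "\<delta> \<in> D" for \<delta>
    using lead_coeff_cyclotomic[of "2 * \<delta>"] D_set_properties(1)[OF that] by auto
  then show ?thesis unfolding Pi_pol_def using finite_D by (auto simp: prod_zero_iff)
qed

lemma cyc_dvd_Pi: "\<delta> \<in> D \<Longrightarrow> d \<delta> > n \<Longrightarrow> cyc \<delta> dvd \<Psi> n"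
  unfolding Pi_pol_def using finite_D by (intro dvd_prodI) auto

lemma Pi_dvdI: "(\<And>\<delta>. \<delta> \<in> D \<Longrightarrow> d \<delta> > n \<Longrightarrow> cyc \<delta> dvd c) \<Longrightarrow> \<Psi> n dvd c"
  unfolding Pi_pol_def using finite_D coprime_D by (intro prod_dvd_of_coprime) auto

lemma degree_cases: "\<delta> \<in> D \<Longrightarrow> d \<delta> \<in> {g, g - 1, g - 2}"
  using p_pol_properties(3)[OF k m, of \<delta>] D_set_properties[of \<delta>] by (auto simp: of_bool_def)

lemma Pi_g: "\<Psi> g = 1"
proof -
  have "{\<delta> \<in> D. d \<delta> > g} = {}" using degree_cases by fastforce
  then show ?thesis by (simp only: Pi_pol_def prod.empty)
qed

text \<open>Between consecutive elements of \<open>S\<close> the set of \<open>\<delta>\<close> with \<open>d\<^sub>\<delta> > n\<close> does not change; take for \<open>j\<close> the largest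
  element of \<open>S\<close> that is at most \<open>n\<close>.\<close>

lemma Pi_constant_between: "\<exists>j\<in>S. j \<le> n \<and> \<Psi> j = \<Psi> n"
proof -
  have finite: "finite {j\<in>S. j \<le> n}" by simp
  have ne: "{j\<in>S. j \<le> n} \<noteq> {}" by (auto simp: S_set_def)
  define j where "j = Max {j\<in>S. j \<le> n}"
  have j: "j \<in> S" "j \<le> n" using Max_in[OF finite ne] by (auto simp: j_def)
  have max: "i \<le> j" if "i \<in> S" "i \<le> n" for i using Max_ge[OF finite, of i] that by (simp add: j_def)
  have "{\<delta> \<in> D. d \<delta> > j} = {\<delta> \<in> D. d \<delta> > n}"
  proof (intro Collect_cong conj_cong refl)
    fix \<delta> assume "\<delta> \<in> D"
    then have "d \<delta> \<in> S" by (simp add: S_set_def)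
    then show "d \<delta> > j \<longleftrightarrow> d \<delta> > n" using max[of "d \<delta>"] j(2) by (cases "d \<delta> \<le> n") auto
  qed
  then have "\<Psi> j = \<Psi> n" by (simp only: Pi_pol_def)
  then show ?thesis using j by blast
qed

text \<open>If \<open>d\<^sub>\<delta>\<close> exceeds the degree of \<open>f\<close>, then \<open>f\<close>, a multiple of the monic \<open>p\<^sub>\<delta>\<close> modulo \<open>\<Phi>\<^bsub>2\<delta>\<^esub>\<close>, is zero modulo
  \<open>\<Phi>\<^bsub>2\<delta>\<^esub>\<close>.\<close>

lemma Pi_dvd_lead_coeff:
  assumes f: "f \<in> ideal_gen gens"
  shows "\<Psi> (degree f) dvd lead_coeff f"
proof (rule Pi_dvdI)
  fix \<delta> assume \<delta>: "\<delta> \<in> D" "d \<delta> > degree f"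
  then have "[:cyc \<delta>:] dvd f"
    using f D_set_properties(1)[OF \<delta>(1)] p_pol_properties(1)[OF k m]
    by (intro degree_less_multiple_vanishes[of "p \<delta>"]) (auto simp: membership_criterion d_deg_def)
  then show "cyc \<delta> dvd lead_coeff f" unfolding const_poly_dvd_iff by blast
qed

lemma lead_exp_staircase:
  assumes f: "f \<in> ideal_gen gens" "f \<noteq> 0"
  shows "\<exists>j\<in>S. exp_dvd (j, degree (\<Psi> j)) (lead_exp f)"
proof -
  obtain j where j: "j \<in> S" "j \<le> degree f" "\<Psi> j = \<Psi> (degree f)"
    using Pi_constant_between by blast
  have "degree (\<Psi> j) \<le> degree (lead_coeff f)"
    unfolding j(3) using Pi_dvd_lead_coeff[OF f(1)] f(2) by (intro dvd_imp_degree_le) auto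
  then show ?thesis using j by (auto simp: lead_exp_eq[OF f(2)])
qed

lemma Pi_zero_in_ideal: "[:\<Psi> 0:] \<in> ideal_gen gens"
  unfolding membership_criterion
proof
  fix \<delta> assume "\<delta> \<in> D"
  then show "[:\<Psi> 0:] \<in> ideal_gen {[:cyc \<delta>:], p \<delta>}"
    using cyc_dvd_Pi[of \<delta> 0] D_set_properties(2)
    by (intro ideal_gen_dvd[of "[:cyc \<delta>:]"]) (auto simp: const_poly_dvd)
qed

text \<open>The Chinese remainder theorem gives a polynomial with the required residues; its coefficients are
  then reduced modulo \<open>M = \<Pi>\<^sub>0 / \<Pi>\<^sub>j\<close>.  All prescribed residues are monic of degree \<open>j\<close>, which forces the reduced
  coefficients above \<open>j\<close> to vanish and the one at \<open>j\<close> to be 1.\<close>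

lemma Q_properties:
  assumes j: "j \<in> S - {0, g}"
  defines "Q \<equiv> Q_pol k m q j"
  shows "degree Q = j" "lead_coeff Q = 1"
    "\<And>\<delta>. \<delta> \<in> D \<Longrightarrow> d \<delta> \<le> j \<Longrightarrow> [:cyc \<delta>:] dvd Q - Y ^ (j - d \<delta>) * p \<delta>"
proof -
  let ?E = "{\<delta> \<in> D. d \<delta> \<le> j}"
  let ?t = "\<lambda>\<delta>. Y ^ (j - d \<delta>) * p \<delta>"
  define M where "M = (\<Prod>\<delta>\<in>?E. cyc \<delta>)"
  have finE: "finite ?E" using finite_D by simp
  have copE: "i \<in> ?E \<Longrightarrow> j \<in> ?E \<Longrightarrow> i \<noteq> j \<Longrightarrow> coprime (cyc i) (cyc j)" for i j
    using coprime_D by auto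
  have M_dvd: "M dvd c" if "\<And>\<delta>. \<delta> \<in> ?E \<Longrightarrow> cyc \<delta> dvd c" for c
    unfolding M_def using finE copE that by (rule prod_dvd_of_coprime)
  have dvd_M: "cyc \<delta> dvd M" if "\<delta> \<in> ?E" for \<delta>
    unfolding M_def using finE that by (rule dvd_prodI)
  have "\<Psi> 0 = \<Psi> j * M"
  proof -
    have "{\<delta> \<in> D. d \<delta> > 0} = {\<delta> \<in> D. d \<delta> > j} \<union> ?E" using D_set_properties(2) by force
    then show ?thesis
      unfolding Pi_pol_def M_def using finite_D by (simp only:) (rule prod.union_disjoint, auto)
  qed
  then have M: "\<Psi> 0 div \<Psi> j = M" using Pi_nonzero by simp
  have degM: "degree M > 0"
  proof -
    obtain \<delta> where \<delta>: "\<delta> \<in> D" "d \<delta> = j" using j by (auto simp: S_set_def)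
    have "M \<noteq> 0"
      using \<open>\<Psi> 0 = \<Psi> j * M\<close> Pi_nonzero[of 0] by auto
    then have "degree (cyc \<delta>) \<le> degree M" using dvd_M[of \<delta>] \<delta> by (intro dvd_imp_degree_le) auto
    moreover have "degree (cyc \<delta>) > 0" using D_set_properties(1)[OF \<delta>(1)] by (intro degree_cyclotomic_pos) simp
    ultimately show ?thesis by simp
  qed
  have t: "degree (?t \<delta>) = j" "coeff (?t \<delta>) j = 1" if "\<delta> \<in> ?E" for \<delta>
  proof -
    have lead: "lead_coeff (p \<delta>) = 1" and "degree (p \<delta>) = d \<delta>"
      using that D_set_properties(1) p_pol_properties(1)[OF k m] by (auto simp: d_deg_def)
    moreover have "p \<delta> \<noteq> 0" using lead by auto
    ultimately show deg: "degree (?t \<delta>) = j"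
      using that by (simp add: degree_mult_eq degree_power_eq)
    have "lead_coeff (?t \<delta>) = 1" using lead by (simp add: lead_coeff_mult lead_coeff_power)
    then show "coeff (?t \<delta>) j = 1" unfolding deg .
  qed
  have "\<exists>f. \<forall>\<delta>\<in>?E. [:cyc \<delta>:] dvd f - ?t \<delta>"
    by (rule chinese_remainder_const[OF finE copE])
  then obtain f where f: "\<And>\<delta>. \<delta> \<in> ?E \<Longrightarrow> [:cyc \<delta>:] dvd f - ?t \<delta>" by blast
  define f' where "f' = map_poly (\<lambda>c. c mod M) f"
  have cf': "coeff f' i = coeff f i mod M" for i by (simp add: f'_def coeff_map_poly)
  have deg_cf': "degree (coeff f' i) < degree M" for i
    using degree_mod_less[of M "coeff f i"] degM unfolding cf' by fastforce
  have f': "[:cyc \<delta>:] dvd f' - ?t \<delta>" if "\<delta> \<in> ?E" for \<delta>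
  proof -
    have "cyc \<delta> dvd coeff f i mod M - coeff f i" for i
      using dvd_trans[OF dvd_M[OF that] dvd_minus_mod[of M "coeff f i"]] by (metis dvd_minus_iff minus_diff_eq)
    then have "[:cyc \<delta>:] dvd f' - f" unfolding const_poly_dvd_iff coeff_diff cf' by blast
    then have "[:cyc \<delta>:] dvd (f' - f) + (f - ?t \<delta>)" using f[OF that] by (rule dvd_add)
    then show ?thesis by simp
  qed
  have lc: "coeff f' j = 1"
  proof -
    have "M dvd coeff f' j - 1"
    proof (rule M_dvd)
      fix \<delta> assume \<delta>: "\<delta> \<in> ?E"
      have "cyc \<delta> dvd coeff (f' - ?t \<delta>) j" using f'[OF \<delta>] unfolding const_poly_dvd_iff by blast
      then show "cyc \<delta> dvd coeff f' j - 1" using t(2)[OF \<delta>] by simp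
    qed
    moreover have "degree (coeff f' j - 1) < degree M"
      using deg_cf' degM by (intro degree_diff_less) auto
    ultimately have "coeff f' j - 1 = 0"
      using dvd_imp_degree_le[of M "coeff f' j - 1"] by (cases "coeff f' j - 1 = 0") auto
    then show ?thesis by simp
  qed
  have deg: "degree f' = j"
  proof (rule antisym)
    show "degree f' \<le> j"
    proof (rule degree_le, intro allI impI)
      fix i assume i: "i > j"
      have "M dvd coeff f' i"
      proof (rule M_dvd)
        fix \<delta> assume \<delta>: "\<delta> \<in> ?E"
        have "cyc \<delta> dvd coeff (f' - ?t \<delta>) i" using f'[OF \<delta>] unfolding const_poly_dvd_iff by blast
        moreover have "coeff (?t \<delta>) i = 0" using t(1)[OF \<delta>] i by (intro coeff_eq_0) simp
        ultimately show "cyc \<delta> dvd coeff f' i" by simp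
      qed
      then show "coeff f' i = 0"
        using deg_cf'[of i] dvd_imp_degree_le[of M "coeff f' i"] by (cases "coeff f' i = 0") auto
    qed
    show "j \<le> degree f'" using lc by (intro le_degree) simp
  qed
  have "Q = f'"
    unfolding Q_def Q_pol_def M
  proof (rule the_equality)
    show "degree f' = j \<and> lead_coeff f' = 1 \<and> (\<forall>i. degree (coeff f' i) < degree M) \<and>
      (\<forall>\<delta>\<in>D. d \<delta> \<le> j \<longrightarrow> eq_mod (cyc \<delta>) f' (?t \<delta>))"
      using deg lc deg_cf' f' by (simp add: eq_mod_def)
    fix Q' assume Q': "degree Q' = j \<and> lead_coeff Q' = 1 \<and> (\<forall>i. degree (coeff Q' i) < degree M) \<and>
      (\<forall>\<delta>\<in>D. d \<delta> \<le> j \<longrightarrow> eq_mod (cyc \<delta>) Q' (?t \<delta>))"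
    have "Q' - f' = 0"
    proof (rule reduced_dvd_imp_zero)
      show "[:M:] dvd Q' - f'"
        unfolding const_poly_dvd_iff
      proof (intro allI M_dvd)
        fix i \<delta> assume \<delta>: "\<delta> \<in> ?E"
        then have "[:cyc \<delta>:] dvd (Q' - ?t \<delta>) - (f' - ?t \<delta>)"
          using Q' by (intro dvd_diff[OF _ f'[OF \<delta>]]) (auto simp: eq_mod_def)
        then show "cyc \<delta> dvd coeff (Q' - f') i" unfolding const_poly_dvd_iff by simp
      qed
      show "degree (coeff (Q' - f') i) < degree M" for i
        unfolding coeff_diff using Q' deg_cf' by (intro degree_diff_less) auto
    qed
    then show "Q' = f'" by simp
  qed
  then show "degree Q = j" "lead_coeff Q = 1"
    "\<And>\<delta>. \<delta> \<in> D \<Longrightarrow> d \<delta> \<le> j \<Longrightarrow> [:cyc \<delta>:] dvd Q - Y ^ (j - d \<delta>) * p \<delta>"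
    using deg lc f' by auto
qed

lemma Pi_Q_in_ideal:
  assumes j: "j \<in> S - {0, g}"
  shows "[:\<Psi> j:] * Q_pol k m q j \<in> ideal_gen gens"
  unfolding membership_criterion
proof
  fix \<delta> assume \<delta>: "\<delta> \<in> D"
  let ?T = "{[:cyc \<delta>:], p \<delta>}"
  show "[:\<Psi> j:] * Q_pol k m q j \<in> ideal_gen ?T"
  proof (cases "d \<delta> \<le> j")
    case True
    have "Q_pol k m q j - Y ^ (j - d \<delta>) * p \<delta> \<in> ideal_gen ?T"
      using Q_properties(3)[OF j \<delta> True] by (intro ideal_gen_dvd[of "[:cyc \<delta>:]"]) auto
    moreover have "Y ^ (j - d \<delta>) * p \<delta> \<in> ideal_gen ?T"
      by (rule ideal_gen_mult[OF ideal_gen_base]) simp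
    ultimately have "Q_pol k m q j \<in> ideal_gen ?T"
      using ideal_cong_mem[of ?T] unfolding ideal_cong_def by blast
    then show ?thesis by (rule ideal_gen_mult)
  next
    case False
    then have "[:cyc \<delta>:] dvd [:\<Psi> j:] * Q_pol k m q j"
      using cyc_dvd_Pi[OF \<delta>, of j] by (intro dvd_mult2) (simp add: const_poly_dvd)
    then show ?thesis by (intro ideal_gen_dvd[of "[:cyc \<delta>:]"]) auto
  qed
qed

text \<open>Modulo \<open>\<Phi>\<^bsub>2\<delta>\<^esub>\<close> the order of \<open>x\<close> divides \<open>2\<delta>\<close>.\<close>

lemma x_powers_cong:
  assumes \<delta>: "\<delta> > 1" and "[int i = int j] (mod (2 * int \<delta>))"
  shows "cyc \<delta> dvd monom 1 i - monom 1 j"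
proof -
  have *: "cyc \<delta> dvd monom 1 j - monom 1 i" if ij: "i \<le> j" "[int i = int j] (mod (2 * int \<delta>))" for i j :: nat
  proof -
    have "2 * int \<delta> dvd int j - int i"
      using ij(2) by (metis cong_iff_dvd_diff cong_sym)
    then have "int (2 * \<delta>) dvd int (j - i)" using ij(1) by (simp add: of_nat_diff)
    then have "2 * \<delta> dvd j - i" by (simp only: int_dvd_int_iff)
    then have "cyc \<delta> dvd xp ^ (j - i) - 1" by (rule P_dvd_power[OF \<delta>])
    then have "cyc \<delta> dvd xp ^ i * (xp ^ (j - i) - 1)" by (rule dvd_mult)
    also have "xp ^ i * (xp ^ (j - i) - 1) = xp ^ j - xp ^ i"
      using ij(1) by (simp only: right_diff_distrib mult_1_right flip: power_add) simp
    finally show ?thesis by (simp only: monom_altdef smult_1_left)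
  qed
  show ?thesis
  proof (cases "i \<le> j")
    case True
    then show ?thesis using *[OF True assms(2)] by (metis dvd_minus_iff minus_diff_eq)
  next
    case False
    then show ?thesis using *[of j i] assms(2) by (simp add: cong_sym)
  qed
qed

context
  fixes u v e :: int
  assumes uv: "u * int m + v * int k = int g" and D: "D \<noteq> {}"
    and e_def: "e = u * int m - v * int k"
begin

abbreviation (input) "h \<equiv> h_pol k m q e"

lemma degree_Pi_zero: "degree (\<Psi> 0) > 0"
proof -
  obtain \<delta> where \<delta>: "\<delta> \<in> D" using D by blast
  have "degree (cyc \<delta>) \<le> degree (\<Psi> 0)"
    using cyc_dvd_Pi[OF \<delta> D_set_properties(2)[OF \<delta>]] Pi_nonzero by (rule dvd_imp_degree_le)
  moreover have "degree (cyc \<delta>) > 0" using D_set_properties(1)[OF \<delta>] by (intro degree_cyclotomic_pos) simp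
  ultimately show ?thesis by simp
qed

lemma h_properties:
  "degree h < degree (\<Psi> 0)" "[h * monom 1 (nat (- e)) = monom 1 (nat e)] (mod \<Psi> 0)"
proof -
  have "coprime (cyc \<delta>) (monom 1 n)" if "\<delta> \<in> D" for \<delta> n
    using P_coprime_X[OF D_set_properties(1)[OF that]] by (simp add: monom_altdef)
  then have cop: "coprime (\<Psi> 0) (monom 1 n)" for n
    unfolding Pi_pol_def by (intro prod_coprime_left) auto
  obtain s t where st: "s * \<Psi> 0 + t * monom 1 (nat (- e)) = 1"
    using coprime_bezout[OF cop] by metis
  let ?h = "(t * monom 1 (nat e)) mod \<Psi> 0"
  have "\<exists>!h. degree h < degree (\<Psi> 0) \<and> [h * monom 1 (nat (- e)) = monom 1 (nat e)] (mod \<Psi> 0)"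
  proof (rule ex1I[of _ ?h])
    have "[?h * monom 1 (nat (- e)) = t * monom 1 (nat e) * monom 1 (nat (- e))] (mod \<Psi> 0)"
      by (simp add: cong_def mod_simps)
    also have "t * monom 1 (nat e) * monom 1 (nat (- e)) = (1 - s * \<Psi> 0) * monom 1 (nat e)"
      unfolding st[symmetric] by (simp only: add_diff_cancel_left' mult_ac)
    also have "[\<dots> = monom 1 (nat e)] (mod \<Psi> 0)"
      by (simp add: cong_iff_dvd_diff algebra_simps)
    finally show "degree ?h < degree (\<Psi> 0) \<and> [?h * monom 1 (nat (- e)) = monom 1 (nat e)] (mod \<Psi> 0)"
      using degree_mod_less[of "\<Psi> 0" "t * monom 1 (nat e)"] Pi_nonzero degree_Pi_zero by auto
    fix h assume h: "degree h < degree (\<Psi> 0) \<and> [h * monom 1 (nat (- e)) = monom 1 (nat e)] (mod \<Psi> 0)"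
    have "[h * monom 1 (nat (- e)) = ?h * monom 1 (nat (- e))] (mod \<Psi> 0)"
      using h \<open>_ \<and> [?h * _ = _] (mod _)\<close> by (meson cong_sym cong_trans)
    then have "\<Psi> 0 dvd (h - ?h) * monom 1 (nat (- e))"
      by (simp add: cong_iff_dvd_diff left_diff_distrib)
    then have "\<Psi> 0 dvd h - ?h" using cop by (simp add: coprime_dvd_mult_left_iff)
    moreover have "degree (h - ?h) < degree (\<Psi> 0)"
      using h \<open>_ \<and> [?h * _ = _] (mod _)\<close> by (intro degree_diff_less) auto
    ultimately have "h - ?h = 0"
      using dvd_imp_degree_le[of "\<Psi> 0" "h - ?h"] by (cases "h - ?h = 0") auto
    then show "h = ?h" by simp
  qed
  from theI'[OF this] show "degree h < degree (\<Psi> 0)" "[h * monom 1 (nat (- e)) = monom 1 (nat e)] (mod \<Psi> 0)"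
    unfolding h_pol_def by blast+
qed

text \<open>The integer exponent \<open>e\<close> of the statement and the natural exponent \<open>e'\<close> of \<open>Y_power_cong\<close> come from
  different Bezout coefficients.  They differ by twice a common multiple of \<open>k\<close> and \<open>m\<close>, hence by a multiple of
  \<open>2\<delta>\<close> for every \<open>\<delta>\<close> in \<open>D\<close>, so that \<open>h = x\<^bsup>e'\<^esup>\<close> modulo \<open>\<Phi>\<^bsub>2\<delta>\<^esub>\<close>.\<close>

lemma Y_power_minus_h_in_ideal: "Y ^ g - [:h:] \<in> ideal_gen gens"
  unfolding membership_criterion
proof
  fix \<delta> assume \<delta>: "\<delta> \<in> D"
  note \<delta>1 = D_set_properties(1)[OF \<delta>]
  obtain u' v' where uv': "u' * m = v' * k + g" by (rule nat_bezout[OF m])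
  define e' where "e' = u' * m + v' * k"
  have "[int e' = e] (mod (2 * int \<delta>))"
  proof -
    have "int (u' * m) = int (v' * k + g)" using uv' by (simp only:)
    then have eq: "(int u' - u) * int m = (int v' + v) * int k"
      using uv by (simp add: algebra_simps)
    then have "int e' - e = 2 * ((int u' - u) * int m)"
      by (simp add: e'_def e_def algebra_simps)
    moreover have "int (lcm k m) dvd (int u' - u) * int m"
      unfolding lcm_int_int_eq[symmetric]
    proof (rule lcm_least)
      show "int k dvd (int u' - u) * int m" unfolding eq by simp
    qed simp
    then have "int \<delta> dvd (int u' - u) * int m"
      using D_set_properties(3)[OF \<delta>] by (meson dvd_trans int_dvd_int_iff)
    ultimately show ?thesis by (simp add: cong_iff_dvd_diff)
  qed
  then have "[int (e' + nat (- e)) = int (nat e)] (mod (2 * int \<delta>))"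
    by (cases "e \<ge> 0") (simp_all add: cong_iff_dvd_diff)
  then have "cyc \<delta> dvd monom 1 (e' + nat (- e)) - monom 1 (nat e)"
    by (rule x_powers_cong[OF \<delta>1])
  moreover have "cyc \<delta> dvd h * monom 1 (nat (- e)) - monom 1 (nat e)"
    using h_properties(2) cyc_dvd_Pi[OF \<delta> D_set_properties(2)[OF \<delta>]] unfolding cong_iff_dvd_diff by (rule dvd_trans[rotated])
  ultimately have "cyc \<delta> dvd (monom 1 (e' + nat (- e)) - monom 1 (nat e)) - (h * monom 1 (nat (- e)) - monom 1 (nat e))"
    by (rule dvd_diff)
  also have "\<dots> = (monom 1 e' - h) * monom 1 (nat (- e))"
    by (simp add: algebra_simps mult_monom)
  finally have "cyc \<delta> dvd monom 1 e' - h"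
    using P_coprime_X[OF \<delta>1] by (simp add: monom_altdef coprime_dvd_mult_left_iff)
  then have "[:cyc \<delta>:] dvd [:monom 1 e' - h:]" by (simp add: const_poly_dvd)
  then have "[:monom 1 e' - h:] \<in> ideal_gen {[:cyc \<delta>:], p \<delta>}"
    by (intro ideal_gen_dvd[of "[:cyc \<delta>:]"]) auto
  moreover have "Y ^ g - X ^ e' \<in> ideal_gen {[:cyc \<delta>:], p \<delta>}"
    unfolding p_pol_properties(2)[OF k m \<delta>1] e'_def
    using Y_power_cong[OF \<delta>1 k m uv'] unfolding ideal_cong_def .
  ultimately have "(Y ^ g - X ^ e') + [:monom 1 e' - h:] \<in> ideal_gen {[:cyc \<delta>:], p \<delta>}"
    by (rule ideal_gen_add[rotated])
  also have "(Y ^ g - X ^ e') + [:monom 1 e' - h:] = Y ^ g - [:h:]"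
    by (simp add: poly_const_pow monom_altdef)
  finally show "Y ^ g - [:h:] \<in> ideal_gen {[:cyc \<delta>:], p \<delta>}" .
qed

abbreviation (input) "B \<equiv> B_set k m q e"

text \<open>The elements of \<open>B\<close> indexed by \<open>S\<close>, so that the element with index \<open>j\<close> has leading exponent \<open>(j, deg \<Pi>\<^sub>j)\<close>.\<close>

definition basis_element :: "nat \<Rightarrow> rat poly poly" where
  "basis_element j = (if j = 0 then [:\<Psi> 0:] else if j = g then Y ^ g - [:h:] else [:\<Psi> j:] * Q_pol k m q j)"

lemma g_pos: "g > 0" using m by simp

lemma B_eq: "B = basis_element ` S"
proof -
  have "S = {0, g} \<union> (S - {0, g})" by (auto simp: S_set_def)
  then have "basis_element ` S = basis_element ` {0, g} \<union> basis_element ` (S - {0, g})"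
    by (metis image_Un)
  also have "basis_element ` {0, g} = {[:\<Psi> 0:], Y ^ g - [:h:]}"
    using g_pos by (simp add: basis_element_def insert_commute)
  also have "basis_element ` (S - {0, g}) = {[:\<Psi> j:] * Q_pol k m q j | j. j \<in> S - {0, g}}"
    by (auto simp: basis_element_def image_iff)
  finally show ?thesis by (simp add: B_set_def)
qed

lemma basis_element_in_ideal: "j \<in> S \<Longrightarrow> basis_element j \<in> ideal_gen gens"
  using Pi_zero_in_ideal Y_power_minus_h_in_ideal Pi_Q_in_ideal[of j] by (auto simp: basis_element_def)

lemma basis_element_lead:
  assumes j: "j \<in> S"
  shows "basis_element j \<noteq> 0" "lead_exp (basis_element j) = (j, degree (\<Psi> j))"
proof -
  have "degree (basis_element j) = j \<and> lead_coeff (basis_element j) = \<Psi> j"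
  proof -
    consider "j = 0" | "j = g" "j \<noteq> 0" | "j \<in> S - {0, g}" using j by blast
    then show ?thesis
    proof cases
      case 1
      then show ?thesis by (simp add: basis_element_def)
    next
      case 2
      have "Y ^ g - [:h:] = monom 1 g + [:- h:]" by (simp add: monom_altdef)
      moreover have "degree (monom 1 g + [:- h:]) = g"
        using g_pos by (subst degree_add_eq_left) (simp_all add: degree_monom_eq)
      moreover have "coeff (monom 1 g + [:- h:]) g = 1"
        using g_pos by (cases g) simp_all
      ultimately show ?thesis using 2 Pi_g m by (simp add: basis_element_def)
    next
      case 3
      have "Q_pol k m q j \<noteq> 0" using Q_properties(2)[OF 3] by auto
      then show ?thesis
        using 3 Q_properties(1,2)[OF 3] Pi_nonzero[of j] by (simp add: basis_element_def)
    qed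
  qed
  then have lead: "degree (basis_element j) = j" "lead_coeff (basis_element j) = \<Psi> j"
    by blast+
  then show nonzero: "basis_element j \<noteq> 0" using Pi_nonzero[of j] by auto
  show "lead_exp (basis_element j) = (j, degree (\<Psi> j))"
    unfolding lead_exp_eq[OF nonzero] lead(2) by (simp only: lead(1))
qed

lemma finite_S: "finite S"
  using finite_D by (simp add: S_set_def)

lemma B_is_GB: "is_GB B (ideal_gen gens)"
  unfolding is_GB_iff B_eq
proof (intro conjI ballI impI)
  show "0 \<notin> basis_element ` S" using basis_element_lead(1) by (metis imageE)
  show "basis_element ` S \<subseteq> ideal_gen gens" using basis_element_in_ideal by blast
  show "finite (basis_element ` S)" using finite_S by simp
  fix f assume "f \<in> ideal_gen gens" "f \<noteq> 0"
  then obtain j where j: "j \<in> S" "exp_dvd (j, degree (\<Psi> j)) (lead_exp f)"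
    using lead_exp_staircase by blast
  show "\<exists>b\<in>basis_element ` S. exp_dvd (lead_exp b) (lead_exp f)"
    using j by (intro bexI[of _ "basis_element j"]) (simp_all add: basis_element_lead(2))
qed

lemma mon2_eq: "mon2 (j, i) = X ^ i * Y ^ j"
  by (simp add: term2_def monom_altdef poly_const_pow)

lemma in_lex_eq: "in_lex (ideal_gen gens) = ideal_gen {X ^ degree (\<Psi> j) * Y ^ j | j. j \<in> S}"
proof -
  have "in_lex (ideal_gen gens) = ideal_gen (lead_mon ` B)"
    using B_is_GB by (simp add: is_GB_def)
  also have "lead_mon ` B = (\<lambda>j. mon2 (j, degree (\<Psi> j))) ` S"
    unfolding B_eq image_image by (rule image_cong) (simp_all add: lead_mon_def basis_element_lead(2))
  also have "\<dots> = {X ^ degree (\<Psi> j) * Y ^ j | j. j \<in> S}"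
    unfolding mon2_eq by (rule Setcompr_eq_image[symmetric])
  finally show ?thesis .
qed

text \<open>The degrees \<open>d\<^sub>\<delta>\<close> lie in \<open>{g, g - 1, g - 2}\<close>, so \<open>S\<close> has at most four elements.\<close>

lemma card_B: "card B \<le> 4"
proof -
  have "S \<subseteq> {0, g, g - 1, g - 2}" unfolding S_set_def using degree_cases by blast
  then have "card S \<le> card {0, g, g - 1, g - 2}" by (rule card_mono[rotated]) simp
  also have "\<dots> \<le> 4" by (simp add: card_insert_if)
  finally show ?thesis unfolding B_eq using card_image_le[OF finite_S, of basis_element] by simp
qed

text \<open>If \<open>\<Pi>\<^sub>j = 1\<close> for some \<open>j < g\<close>, the leading monomial \<open>y\<^sup>g\<close> is a multiple of the leading monomial \<open>y\<^sup>j\<close>.\<close>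

lemma redundant_power_element:
  assumes j: "j \<in> S" "j < g" "\<Psi> j = 1"
  shows "basis_element g \<in> B" "is_GB (B - {basis_element g}) (ideal_gen gens)"
proof -
  have gS: "g \<in> S" by (simp add: S_set_def)
  then show "basis_element g \<in> B" unfolding B_eq by blast
  note GB = B_is_GB[unfolded is_GB_iff]
  note lead_g = basis_element_lead(2)[OF gS] and lead_j = basis_element_lead(2)[OF j(1)]
  have ne: "basis_element j \<noteq> basis_element g" using lead_g lead_j j(2) by auto
  have "\<exists>b\<in>B - {basis_element g}. exp_dvd (lead_exp b) (lead_exp f)"
    if f: "f \<in> ideal_gen gens" "f \<noteq> 0" for f
  proof -
    obtain b where b: "b \<in> B" "exp_dvd (lead_exp b) (lead_exp f)" using GB f by blast
    show ?thesis
    proof (cases "b = basis_element g")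
      case True
      then have "exp_dvd (lead_exp (basis_element j)) (lead_exp f)"
        using b(2) lead_g lead_j j(2,3) by simp
      then show ?thesis using ne j(1) unfolding B_eq by blast
    qed (use b in blast)
  qed
  then show "is_GB (B - {basis_element g}) (ideal_gen gens)"
    unfolding is_GB_iff using GB by blast
qed

end

end

hide_const (open) g D S d p \<Psi> gens h B

lemma groebner_basis_of_elementary_ideal:
  assumes "k \<ge> 1" "m \<ge> 1" "r \<ge> 2" "u * int m + v * int k = int (gcd m k)"
    "D_set k m (2 * r - 1) \<noteq> {}"
  defines "e \<equiv> u * int m - v * int k" and "I \<equiv> E2_poly k r m"
  shows "I = ideal_gen {[:A_pol (2 * r - 1):], G_pol k, H_pol m}"
    "is_GB (B_set k m (2 * r - 1) e) I"
    "in_lex I = ideal_gen {X ^ degree (Pi_pol k m (2 * r - 1) j) * Y ^ j | j. j \<in> S_set k m (2 * r - 1)}"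
    "is_reduced_GB (AG2 k r m) I"
    "interreduces_to (monic ` B_set k m (2 * r - 1) e) G \<longleftrightarrow> G = AG2 k r m"
    "card (B_set k m (2 * r - 1) e) \<le> 4"
proof -
  have odd: "odd (2 * r - 1)" using assms(3) by simp
  show I: "I = ideal_gen {[:A_pol (2 * r - 1):], G_pol k, H_pol m}"
    unfolding I_def using assms(1,3) by (intro E2_poly_eq) auto
  note ctx = assms(1,2) odd assms(4,5) e_def[THEN meta_eq_to_obj_eq]
  show GB: "is_GB (B_set k m (2 * r - 1) e) I"
    unfolding I by (rule B_is_GB[OF ctx])
  show "in_lex I = ideal_gen {X ^ degree (Pi_pol k m (2 * r - 1) j) * Y ^ j | j. j \<in> S_set k m (2 * r - 1)}"
    unfolding I by (rule in_lex_eq[OF ctx])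
  show "is_reduced_GB (AG2 k r m) I"
    "interreduces_to (monic ` B_set k m (2 * r - 1) e) G \<longleftrightarrow> G = AG2 k r m"
    unfolding AG2_def I_def[symmetric] using GB unfolding I
    by (rule interreduction_yields_unique_reduced_GB)+
  show "card (B_set k m (2 * r - 1) e) \<le> 4" by (rule card_B[OF ctx])
qed

text \<open>Here \<open>g = 3\<close>, and \<open>\<delta> = 3\<close> divides both \<open>k\<close> and \<open>m\<close>, so that \<open>d\<^sub>3 = 3 - 1 - 1\<close>.\<close>

lemma redundant_example:
  "D_set 3 3 3 = {3}" "Pi_pol 3 3 3 1 = 1" "1 \<in> S_set 3 3 3"
proof -
  have deg: "d_deg 3 3 3 = 1" using p_pol_properties(3)[of 3 3 3] by simp
  have "\<delta> = 3" if "\<delta> > 1" "\<delta> dvd 3" for \<delta> :: nat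
  proof -
    have "\<delta> \<le> 3" using that(2) by (rule dvd_imp_le) simp
    then have "\<delta> = 2 \<or> \<delta> = 3" using that(1) by linarith
    then show ?thesis using that(2) by auto
  qed
  then show D: "D_set 3 3 3 = {3}" using deg by (auto simp: D_set_def)
  show "1 \<in> S_set 3 3 3" by (simp add: S_set_def D deg)
  have "{\<delta> \<in> D_set 3 3 3. d_deg 3 3 \<delta> > 1} = {}" by (simp add: D deg)
  then show "Pi_pol 3 3 3 1 = 1" by (simp only: Pi_pol_def prod.empty)
qed

theorem theorem4p6:
  shows
    "(\<forall>(k::nat) (m::nat) (r::nat) (u::int) (v::int).
        k \<ge> 1 \<and> m \<ge> 1 \<and> r \<ge> 2 \<and>
        u * int m + v * int k = int (gcd m k) \<and>
        D_set k m (2 * r - 1) \<noteq> {} \<longrightarrow>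
        (let q = 2 * r - 1;
             e = u * int m - v * int k;
             I = E2_poly k r m;
             B = B_set k m q e
         in I = ideal_gen {[:A_pol q:], G_pol k, H_pol m} \<and>
            is_GB B I \<and>
            in_lex I = ideal_gen {X ^ degree (Pi_pol k m q j) * Y ^ j | j. j \<in> S_set k m q} \<and>
            is_reduced_GB (AG2 k r m) I \<and>
            (\<forall>G. interreduces_to (monic ` B) G \<longleftrightarrow> G = AG2 k r m) \<and>
            card B \<le> 4))
     \<and>
     (\<exists>(k::nat) (m::nat) (r::nat) (u::int) (v::int).
        k \<ge> 1 \<and> m \<ge> 1 \<and> r \<ge> 2 \<and>
        u * int m + v * int k = int (gcd m k) \<and>
        D_set k m (2 * r - 1) \<noteq> {} \<and>
        (\<exists>f \<in> B_set k m (2 * r - 1) (u * int m - v * int k).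
           is_GB (B_set k m (2 * r - 1) (u * int m - v * int k) - {f}) (E2_poly k r m)))"
proof (intro conjI allI impI)
  fix k m r :: nat and u v :: int
  assume "k \<ge> 1 \<and> m \<ge> 1 \<and> r \<ge> 2 \<and> u * int m + v * int k = int (gcd m k) \<and>
    D_set k m (2 * r - 1) \<noteq> {}"
  then have A: "k \<ge> 1" "m \<ge> 1" "r \<ge> 2" "u * int m + v * int k = int (gcd m k)"
    "D_set k m (2 * r - 1) \<noteq> {}" by blast+
  show "let q = 2 * r - 1;
             e = u * int m - v * int k;
             I = E2_poly k r m;
             B = B_set k m q e
         in I = ideal_gen {[:A_pol q:], G_pol k, H_pol m} \<and>
            is_GB B I \<and>
            in_lex I = ideal_gen {X ^ degree (Pi_pol k m q j) * Y ^ j | j. j \<in> S_set k m q} \<and>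
            is_reduced_GB (AG2 k r m) I \<and>
            (\<forall>G. interreduces_to (monic ` B) G \<longleftrightarrow> G = AG2 k r m) \<and>
            card B \<le> 4"
    unfolding Let_def
    by (intro conjI allI) (rule groebner_basis_of_elementary_ideal[OF A])+
next
  have odd: "odd (3::nat)" by simp
  have D: "D_set 3 3 3 \<noteq> {}" using redundant_example(1) by simp
  have uv: "(1::int) * int 3 + 0 * int 3 = int (gcd 3 3)" by simp
  have I: "E2_poly 3 2 3 = ideal_gen {[:A_pol 3:], G_pol 3, H_pol 3}"
    using E2_poly_eq[where k = 3 and r = 2 and m = 3] by simp
  have "\<exists>f \<in> B_set 3 3 3 (1 * int 3 - 0 * int 3).
      is_GB (B_set 3 3 3 (1 * int 3 - 0 * int 3) - {f}) (E2_poly 3 2 3)"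
    unfolding I
    using redundant_power_element[OF _ _ odd uv D refl redundant_example(3) _ redundant_example(2)]
    by (intro bexI) simp_all
  then show "\<exists>(k::nat) (m::nat) (r::nat) (u::int) (v::int).
        k \<ge> 1 \<and> m \<ge> 1 \<and> r \<ge> 2 \<and>
        u * int m + v * int k = int (gcd m k) \<and>
        D_set k m (2 * r - 1) \<noteq> {} \<and>
        (\<exists>f \<in> B_set k m (2 * r - 1) (u * int m - v * int k).
           is_GB (B_set k m (2 * r - 1) (u * int m - v * int k) - {f}) (E2_poly k r m))"
    using D by (intro exI[of _ 3] exI[of _ 2] exI[of _ "1::int"] exI[of _ "0::int"]) simp
qed

end
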